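(* Let $\mathcal{B}$ be an additive category and let $N\ge 3$ be an integer. Then the $2N$-tuple of full subcategories $$(\mathcal{F}^{[1,N-1]},\ \mathcal{E}^{[2,N-1]},\ \mathcal{E}^{1},\ \mathcal{F}^{[1,2]},\ \dots,\ \mathcal{E}^{s},\ \mathcal{F}^{[s,s+1]},\ \dots,\ \mathcal{E}^{N-2},\ \mathcal{F}^{[N-2,N-1]},\ \mathcal{E}^{N-1},\ \mathcal{E}^{[1,N-2]})$$ (where $s$ runs through $1,\dots,N-2$ in the repeated pattern $\mathcal{E}^s,\mathcal{F}^{[s,s+1]}$) is a $2N$-gon of recollements in $\mathsf{K}(\mathsf{Mor}^{\mathrm{sm}}_{N-1}(\mathcal{B}))$.
   Context: $\mathsf{Mor}^{\mathrm{sm}}_{N-1}(\mathcal{B})$ is the additive category whose objects are sequences $X: X^1\xrightarrow{\alpha_X^1}\cdots\xrightarrow{\alpha_X^{N-2}}X^{N-1}$ of split monomorphisms in $\mathcal{B}$ (inclusions of direct summands, i.e. morphisms isomorphic to a canonical inclusion $X\to X\oplus Z$), and whose morphisms $X\to Y$ are $(N-1)$-tuples $(f^1,\dots,f^{N-1})$ of morphisms $f^i:X^i\to Y^i$ with $f^{i+1}\alpha_X^i=\alpha_Y^if^i$ for $1\le i\le N-2$. $\mathsf{K}(\mathcal{C})$ denotes the homotopy category of (unbounded) complexes over an additive category $\mathcal{C}$, with its usual triangulated structure. An object of $\mathsf{K}(\mathsf{Mor}^{\mathrm{sm}}_{N-1}(\mathcal{B}))$ is a sequence $X^1\xrightarrow{\alpha^1}\cdots\xrightarrow{\alpha^{N-2}}X^{N-1}$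 of complexes over $\mathcal{B}$ and degreewise split monomorphic chain maps. For $1\le s\le t\le N-1$, $D_{[s,t]}:\mathsf{K}(\mathsf{Mor}^{\mathrm{sm}}_{N-1}(\mathcal{B}))\to\mathsf{K}(\mathsf{Mor}^{\mathrm{sm}}_{t-s+1}(\mathcal{B}))$ is the triangle functor sending $X^1\to\cdots\to X^{N-1}$ to $X^s\to\cdots\to X^t$; $D_{[s]}:=D_{[s,s]}$. Define full triangulated subcategories of $\mathsf{K}(\mathsf{Mor}^{\mathrm{sm}}_{N-1}(\mathcal{B}))$ by $\mathcal{E}^{[2,N-1]}=\operatorname{Ker}D_{[1]}$, $\mathcal{E}^{[1,N-2]}=\operatorname{Ker}D_{[N-1]}$, $\mathcal{E}^1=\operatorname{Ker}D_{[2,N-1]}$, $\mathcal{E}^{N-1}=\operatorname{Ker}D_{[1,N-2]}$, and $\mathcal{E}^s=\operatorname{Ker}D_{[1,s-1]}\cap\operatorname{Ker}D_{[s+1,N-1]}$ for $1<s<N-1$. For $1\le s<t\le N-1$, $\mathcal{F}^{[s,t]}$ is the full triangulated subcategory consisting of the objects (isomorphic to some) $X^1\xrightarrow{\alpha^1}\cdots\xrightarrow{\alpha^{N-2}}X^{N-1}$ with $\alpha^s=\cdots=\alpha^{t-1}=1$. A pair $(\mathcal{U},\mathcal{V})$ of full subcategories of a triangulated category $\mathcal{D}$ is a stable t-structure if $\mathcal{U}=\Sigma\mathcal{U}$, $\mathcal{V}=\Sigma\mathcal{V}$, $\operatorname{Hom}_{\mathcal{D}}(\mathcal{U},\mathcal{V})=0$,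 and every $X\in\mathcal{D}$ sits in a triangle $U\to X\to V\to\Sigma U$ with $U\in\mathcal{U}$, $V\in\mathcal{V}$. An $n$-tuple $(\mathcal{U}_1,\dots,\mathcal{U}_n)$ of full triangulated subcategories is an $n$-gon of recollements in $\mathcal{D}$ if $(\mathcal{U}_i,\mathcal{U}_{i+1})$ is a stable t-structure for $1\le i\le n$, where $\mathcal{U}_{n+1}=\mathcal{U}_1$. *)

theory Defs
  imports Main "HOL-Library.FuncSet"
begin

section \<open>Additive categories\<close>

text \<open>
  Composition, sum and negative are untyped: they are only meaningful on morphisms that lie in
  suitable sets \<open>Hom C X Y\<close>.  Hom sets are not required to be disjoint.  Every additive category
  can be presented in this form (tag each morphism with its domain and codomain).
\<close>

record ('o, 'm) cat =
  Ob :: "'o set"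
  Hom :: "'o \<Rightarrow> 'o \<Rightarrow> 'm set"
  Idm :: "'o \<Rightarrow> 'm"
  Cmp :: "'m \<Rightarrow> 'm \<Rightarrow> 'm"  (infixr "\<cdot>\<index>" 75)

record ('o, 'm) preadd = "('o, 'm) cat" +
  Zro :: "'o \<Rightarrow> 'o \<Rightarrow> 'm"
  Add :: "'m \<Rightarrow> 'm \<Rightarrow> 'm"  (infixl "\<oplus>\<index>" 65)
  Neg :: "'m \<Rightarrow> 'm"

locale category =
  fixes C :: "('o, 'm, 'z) cat_scheme" (structure)
  assumes Idm_in: "X \<in> Ob C \<Longrightarrow> Idm C X \<in> Hom C X X"
    and Cmp_in: "\<lbrakk>X \<in> Ob C; Y \<in> Ob C; Z \<in> Ob C; f \<in> Hom C X Y; g \<in> Hom C Y Z\<rbrakk>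
      \<Longrightarrow> g \<cdot> f \<in> Hom C X Z"
    and Idm_left: "\<lbrakk>X \<in> Ob C; Y \<in> Ob C; f \<in> Hom C X Y\<rbrakk> \<Longrightarrow> Idm C Y \<cdot> f = f"
    and Idm_right: "\<lbrakk>X \<in> Ob C; Y \<in> Ob C; f \<in> Hom C X Y\<rbrakk> \<Longrightarrow> f \<cdot> Idm C X = f"
    and Cmp_assoc: "\<lbrakk>W \<in> Ob C; X \<in> Ob C; Y \<in> Ob C; Z \<in> Ob C;
      f \<in> Hom C W X; g \<in> Hom C X Y; h \<in> Hom C Y Z\<rbrakk> \<Longrightarrow> (h \<cdot> g) \<cdot> f = h \<cdot> (g \<cdot> f)"

locale preadditive_category = category C
  for C :: "('o, 'm, 'z) preadd_scheme" (structure) +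
  assumes Zro_in: "\<lbrakk>X \<in> Ob C; Y \<in> Ob C\<rbrakk> \<Longrightarrow> Zro C X Y \<in> Hom C X Y"
    and Add_in: "\<lbrakk>X \<in> Ob C; Y \<in> Ob C; f \<in> Hom C X Y; g \<in> Hom C X Y\<rbrakk> \<Longrightarrow> f \<oplus> g \<in> Hom C X Y"
    and Neg_in: "\<lbrakk>X \<in> Ob C; Y \<in> Ob C; f \<in> Hom C X Y\<rbrakk> \<Longrightarrow> Neg C f \<in> Hom C X Y"
    and Add_assoc: "\<lbrakk>X \<in> Ob C; Y \<in> Ob C; f \<in> Hom C X Y; g \<in> Hom C X Y; h \<in> Hom C X Y\<rbrakk>
      \<Longrightarrow> (f \<oplus> g) \<oplus> h = f \<oplus> (g \<oplus> h)"
    and Add_comm: "\<lbrakk>X \<in> Ob C; Y \<in> Ob C; f \<in> Hom C X Y; g \<in> Hom C X Y\<rbrakk> \<Longrightarrow> f \<oplus> g = g \<oplus> f"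
    and Add_Zro: "\<lbrakk>X \<in> Ob C; Y \<in> Ob C; f \<in> Hom C X Y\<rbrakk> \<Longrightarrow> f \<oplus> Zro C X Y = f"
    and Add_Neg: "\<lbrakk>X \<in> Ob C; Y \<in> Ob C; f \<in> Hom C X Y\<rbrakk> \<Longrightarrow> f \<oplus> Neg C f = Zro C X Y"
    and Cmp_Add_left: "\<lbrakk>X \<in> Ob C; Y \<in> Ob C; Z \<in> Ob C;
      f \<in> Hom C X Y; g \<in> Hom C Y Z; h \<in> Hom C Y Z\<rbrakk> \<Longrightarrow> (g \<oplus> h) \<cdot> f = (g \<cdot> f) \<oplus> (h \<cdot> f)"
    and Cmp_Add_right: "\<lbrakk>X \<in> Ob C; Y \<in> Ob C; Z \<in> Ob C;
      f \<in> Hom C X Y; g \<in> Hom C X Y; h \<in> Hom C Y Z\<rbrakk> \<Longrightarrow> h \<cdot> (f \<oplus> g) = (h \<cdot> f) \<oplus> (h \<cdot> g)"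

definition is_zero_ob :: "('o, 'm, 'z) cat_scheme \<Rightarrow> 'o \<Rightarrow> bool" where
  "is_zero_ob C Z \<longleftrightarrow> Z \<in> Ob C \<and>
     (\<forall>X\<in>Ob C. (\<exists>!f. f \<in> Hom C Z X) \<and> (\<exists>!f. f \<in> Hom C X Z))"

definition is_iso :: "('o, 'm, 'z) cat_scheme \<Rightarrow> 'o \<Rightarrow> 'o \<Rightarrow> 'm \<Rightarrow> bool" where
  "is_iso C X Y f \<longleftrightarrow> X \<in> Ob C \<and> Y \<in> Ob C \<and> f \<in> Hom C X Y \<and>
     (\<exists>g\<in>Hom C Y X. g \<cdot>\<^bsub>C\<^esub> f = Idm C X \<and> f \<cdot>\<^bsub>C\<^esub> g = Idm C Y)"

definition isomorphic :: "('o, 'm, 'z) cat_scheme \<Rightarrow> 'o \<Rightarrow> 'o \<Rightarrow> bool" where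
  "isomorphic C X Y \<longleftrightarrow> (\<exists>f. is_iso C X Y f)"

text \<open>\<open>S\<close> is a direct sum of \<open>X\<close> and \<open>Y\<close> with injections \<open>i, j\<close> and projections \<open>p, q\<close>.\<close>

definition is_biproduct ::
    "('o, 'm, 'z) preadd_scheme \<Rightarrow> 'o \<Rightarrow> 'o \<Rightarrow> 'o \<Rightarrow> 'm \<Rightarrow> 'm \<Rightarrow> 'm \<Rightarrow> 'm \<Rightarrow> bool" where
  "is_biproduct C X Y S i j p q \<longleftrightarrow>
     X \<in> Ob C \<and> Y \<in> Ob C \<and> S \<in> Ob C \<and>
     i \<in> Hom C X S \<and> j \<in> Hom C Y S \<and> p \<in> Hom C S X \<and> q \<in> Hom C S Y \<and>
     p \<cdot>\<^bsub>C\<^esub> i = Idm C X \<and> q \<cdot>\<^bsub>C\<^esub> j = Idm C Y \<and>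
     p \<cdot>\<^bsub>C\<^esub> j = Zro C Y X \<and> q \<cdot>\<^bsub>C\<^esub> i = Zro C X Y \<and>
     (i \<cdot>\<^bsub>C\<^esub> p) \<oplus>\<^bsub>C\<^esub> (j \<cdot>\<^bsub>C\<^esub> q) = Idm C S"

locale additive_category = preadditive_category C
  for C :: "('o, 'm, 'z) preadd_scheme" (structure) +
  assumes zero_ob_ex: "\<exists>Z. is_zero_ob C Z"
    and biproduct_ex: "\<lbrakk>X \<in> Ob C; Y \<in> Ob C\<rbrakk> \<Longrightarrow> \<exists>S i j p q. is_biproduct C X Y S i j p q"


section \<open>Sequences of split monomorphisms\<close>

text \<open>Split monomorphism in the sense of inclusion of a direct summand: \<open>f\<close> is isomorphic, as an
  arrow, to a canonical injection \<open>X' \<rightarrow> X' \<oplus> Z\<close>.\<close>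

definition split_mono :: "('o, 'm, 'z) preadd_scheme \<Rightarrow> 'o \<Rightarrow> 'o \<Rightarrow> 'm \<Rightarrow> bool" where
  "split_mono C X Y f \<longleftrightarrow> X \<in> Ob C \<and> Y \<in> Ob C \<and> f \<in> Hom C X Y \<and>
     (\<exists>X' Z S i j p q u v. is_biproduct C X' Z S i j p q \<and>
        is_iso C X' X u \<and> is_iso C S Y v \<and> v \<cdot>\<^bsub>C\<^esub> i = f \<cdot>\<^bsub>C\<^esub> u)"

text \<open>\<open>MSeq X \<alpha>\<close> is the sequence \<open>X 1 \<rightarrow> \<dots> \<rightarrow> X n\<close> with \<open>\<alpha> i : X i \<rightarrow> X (i + 1)\<close>.\<close>

datatype ('o, 'm) mseq = MSeq (mob: "nat \<Rightarrow> 'o") (mar: "nat \<Rightarrow> 'm")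

text \<open>
  \<open>mor_sm B n\<close> is the category \<open>Mor\<^sup>s\<^sup>m\<^sub>n(B)\<close>.  Sequences and tuples are extensional functions
  (\<open>undefined\<close> outside their index range), so that equality is componentwise.
\<close>

definition mor_sm ::
    "('o, 'm, 'z) preadd_scheme \<Rightarrow> nat \<Rightarrow> (('o, 'm) mseq, nat \<Rightarrow> 'm) preadd" where
  "mor_sm B n = \<lparr>
     Ob = {X. mob X \<in> {1..n} \<rightarrow>\<^sub>E Ob B \<and> mar X \<in> extensional {1..<n} \<and>
              (\<forall>i\<in>{1..<n}. split_mono B (mob X i) (mob X (i + 1)) (mar X i))},
     Hom = (\<lambda>X Y. {f. f \<in> (\<Pi>\<^sub>E i\<in>{1..n}. Hom B (mob X i) (mob Y i)) \<and>
              (\<forall>i\<in>{1..<n}. f (i + 1) \<cdot>\<^bsub>B\<^esub> mar X i = mar Y i \<cdot>\<^bsub>B\<^esub> f i)}),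
     Idm = (\<lambda>X. \<lambda>i\<in>{1..n}. Idm B (mob X i)),
     Cmp = (\<lambda>g f. \<lambda>i\<in>{1..n}. g i \<cdot>\<^bsub>B\<^esub> f i),
     Zro = (\<lambda>X Y. \<lambda>i\<in>{1..n}. Zro B (mob X i) (mob Y i)),
     Add = (\<lambda>f g. \<lambda>i\<in>{1..n}. f i \<oplus>\<^bsub>B\<^esub> g i),
     Neg = (\<lambda>f. \<lambda>i\<in>{1..n}. Neg B (f i)) \<rparr>"


section \<open>The homotopy category and its triangulated structure\<close>

datatype ('o, 'm) cplx = Cplx (cob: "int \<Rightarrow> 'o") (cdf: "int \<Rightarrow> 'm")

definition complexes :: "('o, 'm, 'z) preadd_scheme \<Rightarrow> ('o, 'm) cplx set" where
  "complexes C = {X. \<forall>n. cob X n \<in> Ob C \<and> cdf X n \<in> Hom C (cob X n) (cob X (n + 1)) \<and>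
     cdf X (n + 1) \<cdot>\<^bsub>C\<^esub> cdf X n = Zro C (cob X n) (cob X (n + 2))}"

definition chain_maps ::
    "('o, 'm, 'z) preadd_scheme \<Rightarrow> ('o, 'm) cplx \<Rightarrow> ('o, 'm) cplx \<Rightarrow> (int \<Rightarrow> 'm) set" where
  "chain_maps C X Y = {f. \<forall>n. f n \<in> Hom C (cob X n) (cob Y n) \<and>
     f (n + 1) \<cdot>\<^bsub>C\<^esub> cdf X n = cdf Y n \<cdot>\<^bsub>C\<^esub> f n}"

definition homotopic ::
    "('o, 'm, 'z) preadd_scheme \<Rightarrow> ('o, 'm) cplx \<Rightarrow> ('o, 'm) cplx
      \<Rightarrow> (int \<Rightarrow> 'm) \<Rightarrow> (int \<Rightarrow> 'm) \<Rightarrow> bool" where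
  "homotopic C X Y f g \<longleftrightarrow> (\<exists>h. \<forall>n. h n \<in> Hom C (cob X n) (cob Y (n - 1)) \<and>
     f n = g n \<oplus>\<^bsub>C\<^esub> ((cdf Y (n - 1) \<cdot>\<^bsub>C\<^esub> h n) \<oplus>\<^bsub>C\<^esub> (h (n + 1) \<cdot>\<^bsub>C\<^esub> cdf X n)))"

text \<open>Morphisms of the homotopy category are homotopy classes of chain maps, tagged with domain and
  codomain (a bare set of families of morphisms does not determine the complexes it refers to).\<close>

datatype ('o, 'm) hmor =
  HMor (hdom: "('o, 'm) cplx") (hcls: "(int \<Rightarrow> 'm) set") (hcod: "('o, 'm) cplx")

definition hclass ::
    "('o, 'm, 'z) preadd_scheme \<Rightarrow> ('o, 'm) cplx \<Rightarrow> ('o, 'm) cplx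
      \<Rightarrow> (int \<Rightarrow> 'm) \<Rightarrow> ('o, 'm) hmor" where
  "hclass C X Y f = HMor X {g \<in> chain_maps C X Y. homotopic C X Y f g} Y"

definition homotopy_cat ::
    "('o, 'm, 'z) preadd_scheme \<Rightarrow> (('o, 'm) cplx, ('o, 'm) hmor) preadd" where
  "homotopy_cat C = \<lparr>
     Ob = complexes C,
     Hom = (\<lambda>X Y. hclass C X Y ` chain_maps C X Y),
     Idm = (\<lambda>X. hclass C X X (\<lambda>n. Idm C (cob X n))),
     Cmp = (\<lambda>G F. HMor (hdom F)
              (\<Union>g\<in>hcls G. \<Union>f\<in>hcls F. hcls (hclass C (hdom F) (hcod G) (\<lambda>n. g n \<cdot>\<^bsub>C\<^esub> f n)))
              (hcod G)),
     Zro = (\<lambda>X Y. hclass C X Y (\<lambda>n. Zro C (cob X n) (cob Y n))),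
     Add = (\<lambda>F G. HMor (hdom F)
              (\<Union>f\<in>hcls F. \<Union>g\<in>hcls G. hcls (hclass C (hdom F) (hcod F) (\<lambda>n. f n \<oplus>\<^bsub>C\<^esub> g n)))
              (hcod F)),
     Neg = (\<lambda>F. HMor (hdom F)
              (\<Union>f\<in>hcls F. hcls (hclass C (hdom F) (hcod F) (\<lambda>n. Neg C (f n))))
              (hcod F)) \<rparr>"

definition shift_cplx :: "('o, 'm, 'z) preadd_scheme \<Rightarrow> ('o, 'm) cplx \<Rightarrow> ('o, 'm) cplx" where
  "shift_cplx C X = Cplx (\<lambda>n. cob X (n + 1)) (\<lambda>n. Neg C (cdf X (n + 1)))"

definition shift_hmor :: "('o, 'm, 'z) preadd_scheme \<Rightarrow> ('o, 'm) hmor \<Rightarrow> ('o, 'm) hmor" where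
  "shift_hmor C F =
     HMor (shift_cplx C (hdom F)) ((\<lambda>f n. f (n + 1)) ` hcls F) (shift_cplx C (hcod F))"

text \<open>
  \<open>M\<close> is a mapping cone of the chain map \<open>f : X \<rightarrow> Y\<close>: in degree \<open>n\<close> it is a direct sum
  \<open>X (n + 1) \<oplus> Y n\<close> with injections \<open>i n, j n\<close> and projections \<open>p n, q n\<close>, and its differential is
  the matrix with rows \<open>(- d, 0)\<close> and \<open>(f, d)\<close>.  Direct sums are only determined up to
  isomorphism, so all choices are admitted.
\<close>

definition is_cone ::
    "('o, 'm, 'z) preadd_scheme \<Rightarrow> ('o, 'm) cplx \<Rightarrow> ('o, 'm) cplx \<Rightarrow> (int \<Rightarrow> 'm) \<Rightarrow> ('o, 'm) cplx
      \<Rightarrow> (int \<Rightarrow> 'm) \<Rightarrow> (int \<Rightarrow> 'm) \<Rightarrow> (int \<Rightarrow> 'm) \<Rightarrow> (int \<Rightarrow> 'm) \<Rightarrow> bool" where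
  "is_cone C X Y f M i j p q \<longleftrightarrow>
     X \<in> complexes C \<and> Y \<in> complexes C \<and> f \<in> chain_maps C X Y \<and>
     (\<forall>n. is_biproduct C (cob X (n + 1)) (cob Y n) (cob M n) (i n) (j n) (p n) (q n) \<and>
        cdf M n =
          (i (n + 1) \<cdot>\<^bsub>C\<^esub> Neg C (cdf X (n + 1)) \<cdot>\<^bsub>C\<^esub> p n) \<oplus>\<^bsub>C\<^esub>
          (j (n + 1) \<cdot>\<^bsub>C\<^esub> f (n + 1) \<cdot>\<^bsub>C\<^esub> p n) \<oplus>\<^bsub>C\<^esub>
          (j (n + 1) \<cdot>\<^bsub>C\<^esub> cdf Y n \<cdot>\<^bsub>C\<^esub> q n))"

text \<open>\<open>(X, Y, Z, u, v, w)\<close> stands for \<open>X \<rightarrow> Y \<rightarrow> Z \<rightarrow> \<Sigma>X\<close> with these maps in this order.\<close>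

type_synonym ('o, 'm) triangle = "'o \<times> 'o \<times> 'o \<times> 'm \<times> 'm \<times> 'm"

definition standard_triangles ::
    "('o, 'm, 'z) preadd_scheme \<Rightarrow> (('o, 'm) cplx, ('o, 'm) hmor) triangle set" where
  "standard_triangles C =
     {(X, Y, M, hclass C X Y f, hclass C Y M j, hclass C M (shift_cplx C X) p) | X Y M f i j p q.
        is_cone C X Y f M i j p q}"

definition distinguished_triangles ::
    "('o, 'm, 'z) preadd_scheme \<Rightarrow> (('o, 'm) cplx, ('o, 'm) hmor) triangle set" where
  "distinguished_triangles C = (let H = homotopy_cat C in
     {(X, Y, Z, u, v, w).
        u \<in> Hom H X Y \<and> v \<in> Hom H Y Z \<and> w \<in> Hom H Z (shift_cplx C X) \<and>
        (\<exists>X' Y' Z' u' v' w' a b c.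
           (X', Y', Z', u', v', w') \<in> standard_triangles C \<and>
           is_iso H X X' a \<and> is_iso H Y Y' b \<and> is_iso H Z Z' c \<and>
           b \<cdot>\<^bsub>H\<^esub> u = u' \<cdot>\<^bsub>H\<^esub> a \<and> c \<cdot>\<^bsub>H\<^esub> v = v' \<cdot>\<^bsub>H\<^esub> b \<and> shift_hmor C a \<cdot>\<^bsub>H\<^esub> w = w' \<cdot>\<^bsub>H\<^esub> c)})"

text \<open>Only the data of a triangulated category; the axioms are not imposed.\<close>

record ('o, 'm) tricat = "('o, 'm) preadd" +
  Shift :: "'o \<Rightarrow> 'o"
  ShiftM :: "'m \<Rightarrow> 'm"
  Triangles :: "('o, 'm) triangle set"

definition K :: "('o, 'm, 'z) preadd_scheme \<Rightarrow> (('o, 'm) cplx, ('o, 'm) hmor) tricat" where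
  "K C = preadd.extend (homotopy_cat C)
     \<lparr> Shift = shift_cplx C, ShiftM = shift_hmor C, Triangles = distinguished_triangles C \<rparr>"


section \<open>Stable t-structures and polygons of recollements\<close>

text \<open>A full subcategory is given by its set of objects.\<close>

definition triangulated_subcat :: "('o, 'm, 'z) tricat_scheme \<Rightarrow> 'o set \<Rightarrow> bool" where
  "triangulated_subcat D S \<longleftrightarrow> S \<subseteq> Ob D \<and> (\<exists>Z\<in>S. is_zero_ob D Z) \<and>
     (\<forall>X\<in>S. \<forall>Y\<in>Ob D. isomorphic D X Y \<longrightarrow> Y \<in> S) \<and>
     Shift D ` S = S \<and>
     (\<forall>X Y Z u v w. (X, Y, Z, u, v, w) \<in> Triangles D \<and> X \<in> S \<and> Y \<in> S \<longrightarrow> Z \<in> S)"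

definition stable_t_structure :: "('o, 'm, 'z) tricat_scheme \<Rightarrow> 'o set \<Rightarrow> 'o set \<Rightarrow> bool" where
  "stable_t_structure D U V \<longleftrightarrow> U \<subseteq> Ob D \<and> V \<subseteq> Ob D \<and>
     U = Shift D ` U \<and> V = Shift D ` V \<and>
     (\<forall>X\<in>U. \<forall>Y\<in>V. Hom D X Y = {Zro D X Y}) \<and>
     (\<forall>X\<in>Ob D. \<exists>A\<in>U. \<exists>B\<in>V. \<exists>u v w. (A, X, B, u, v, w) \<in> Triangles D)"

definition polygon_of_recollements ::
    "('o, 'm, 'z) tricat_scheme \<Rightarrow> nat \<Rightarrow> 'o set list \<Rightarrow> bool" where
  "polygon_of_recollements D n Us \<longleftrightarrow> length Us = n \<and>
     (\<forall>S\<in>set Us. triangulated_subcat D S) \<and>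
     (\<forall>i<n. stable_t_structure D (Us ! i) (Us ! ((i + 1) mod n)))"


section \<open>The subcategories E and F\<close>

definition seq_restrict :: "nat \<Rightarrow> nat \<Rightarrow> ('o, 'm) mseq \<Rightarrow> ('o, 'm) mseq" where
  "seq_restrict s t X =
     MSeq (\<lambda>i\<in>{1..t - s + 1}. mob X (s + i - 1)) (\<lambda>i\<in>{1..<t - s + 1}. mar X (s + i - 1))"

definition tuple_restrict :: "nat \<Rightarrow> nat \<Rightarrow> (nat \<Rightarrow> 'm) \<Rightarrow> (nat \<Rightarrow> 'm)" where
  "tuple_restrict s t f = (\<lambda>i\<in>{1..t - s + 1}. f (s + i - 1))"

text \<open>The functor \<open>D\<^sub>[\<^sub>s\<^sub>,\<^sub>t\<^sub>]\<close> on objects, which is all that its kernel depends on.\<close>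

definition D_restrict ::
    "nat \<Rightarrow> nat \<Rightarrow> (('o, 'm) mseq, nat \<Rightarrow> 'm) cplx \<Rightarrow> (('o, 'm) mseq, nat \<Rightarrow> 'm) cplx" where
  "D_restrict s t X =
     Cplx (\<lambda>n. seq_restrict s t (cob X n)) (\<lambda>n. tuple_restrict s t (cdf X n))"

definition Ker_D :: "('o, 'm, 'z) preadd_scheme \<Rightarrow> nat \<Rightarrow> nat \<Rightarrow> nat
    \<Rightarrow> (('o, 'm) mseq, nat \<Rightarrow> 'm) cplx set" where
  "Ker_D B N s t = {X \<in> Ob (K (mor_sm B (N - 1))).
     is_zero_ob (K (mor_sm B (t - s + 1))) (D_restrict s t X)}"

definition E_from_2 :: "('o, 'm, 'z) preadd_scheme \<Rightarrow> nat
    \<Rightarrow> (('o, 'm) mseq, nat \<Rightarrow> 'm) cplx set" where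
  "E_from_2 B N = Ker_D B N 1 1"

definition E_upto_N2 :: "('o, 'm, 'z) preadd_scheme \<Rightarrow> nat
    \<Rightarrow> (('o, 'm) mseq, nat \<Rightarrow> 'm) cplx set" where
  "E_upto_N2 B N = Ker_D B N (N - 1) (N - 1)"

definition E_at :: "('o, 'm, 'z) preadd_scheme \<Rightarrow> nat \<Rightarrow> nat
    \<Rightarrow> (('o, 'm) mseq, nat \<Rightarrow> 'm) cplx set" where
  "E_at B N s =
     (if s = 1 then Ker_D B N 2 (N - 1)
      else if s = N - 1 then Ker_D B N 1 (N - 2)
      else Ker_D B N 1 (s - 1) \<inter> Ker_D B N (s + 1) (N - 1))"

text \<open>\<open>\<alpha>\<^sup>i = 1\<close> means that source and target of \<open>\<alpha>\<^sup>i\<close> coincide and \<open>\<alpha>\<^sup>i\<close> is the identity; since the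
  differentials commute with \<open>\<alpha>\<^sup>i\<close>, they then coincide as well.\<close>

definition F_int :: "('o, 'm, 'z) preadd_scheme \<Rightarrow> nat \<Rightarrow> nat \<Rightarrow> nat
    \<Rightarrow> (('o, 'm) mseq, nat \<Rightarrow> 'm) cplx set" where
  "F_int B N s t = {X \<in> Ob (K (mor_sm B (N - 1))). \<exists>Y\<in>Ob (K (mor_sm B (N - 1))).
     isomorphic (K (mor_sm B (N - 1))) X Y \<and>
     (\<forall>n. \<forall>i\<in>{s..<t}. mob (cob Y n) (i + 1) = mob (cob Y n) i \<and>
        mar (cob Y n) i = Idm B (mob (cob Y n) i))}"

end

theory Submission
  imports Defs
begin

text \<open>
  All the functors involved are strictly idempotent: each of them is an additive endofunctor \<open>R\<close> of
  \<open>Mor\<^sup>s\<^sup>m\<close> with \<open>R R = R\<close> together with a natural transformation \<open>R \<rightarrow> 1\<close> or \<open>1 \<rightarrow> R\<close> that \<open>R\<close> turns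
  into the identity.  For such an \<open>R\<close>, the complexes isomorphic to some \<open>R Y\<close> and the complexes killed
  by \<open>R\<close> form a stable t-structure, in this order for \<open>R \<rightarrow> 1\<close> and in the opposite order for \<open>1 \<rightarrow> R\<close>;
  the triangles are given by the cone of the natural transformation.  Both classes are orthogonals of
  each other, hence triangulated.

  Collapsing the block \<open>{s..t}\<close> of a sequence to its first entry gives \<open>R \<rightarrow> 1\<close>, to its last entry
  \<open>1 \<rightarrow> R\<close>, and in both cases the image is \<open>F\<^sup>[\<^sup>s\<^sup>,\<^sup>t\<^sup>]\<close>.  Replacing the first \<open>s\<close> entries by zero gives
  \<open>R \<rightarrow> 1\<close>, which accounts for the two pairs without an \<open>F\<close>.  The kernels are determined by the fact
  that a complex of sequences is contractible as soon as each of its components is: contractions can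
  be extended along degreewise split monomorphisms.
\<close>

section \<open>A ring of graded morphisms\<close>

text \<open>\<open>K\<close> carries only the data of a triangulated category, and its distinguished
  triangles are those isomorphic to triangles of cones. What would normally come from rotation or
  from long exact Hom sequences is therefore done by explicit matrices. Degreewise, each composition
  would cost typing conditions and index arithmetic; in a ring the same identities follow from
  distributivity. Strictness of \<open>R R = R\<close> removes comparison isomorphisms from the
  orthogonality arguments.

  The number 2N arises as follows. There are N - 1 entries of type F: \<open>F^[1,N-1]\<close> and
  the \<open>F^[s,s+1]\<close>. Each is the image of two collapses and so has a left and a right
  partner, whose condition is contractibility outside the block and at the retained end. For the
  block {s, s+1} the partners are \<open>E^s\<close> on the left and \<open>E^(s+1)\<close> on the
  right; for the full block they are \<open>E^[1,N-2]\<close> and \<open>E^[2,N-1]\<close>. These 2N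
  - 2 pairs leave two gaps, from \<open>E^[2,N-1]\<close> to \<open>E^1\<close> and from
  \<open>E^(N-1)\<close> to \<open>E^[1,N-2]\<close>; truncation closes both.\<close>

text \<open>
  \<open>vec\<close> is the product of the groups \<open>Hom C W (X n)\<close> over all preadditive categories \<open>C\<close>, all objects
  \<open>W\<close>, all graded objects \<open>X\<close> and all \<open>n\<close>.  Taking all \<open>C\<close> at once makes it a type not depending on a
  locale parameter, so that its additive endomorphisms are an instance of the class \<open>ring\<close>.  A family
  \<open>f n : X n \<rightarrow> Y (n + k)\<close> acts on it by composition; this embeds the graded morphisms of \<open>C\<close> faithfully
  into the ring (\<open>arr\<close> below), and identities between them become identities in a ring.
\<close>

definition vec_index :: "('o, 'm, 'z) preadd_scheme \<Rightarrow> 'o \<Rightarrow> (int \<Rightarrow> 'o) \<Rightarrow> int \<Rightarrow> bool" where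
  "vec_index C W X n \<longleftrightarrow> preadditive_category C \<and> W \<in> Ob C \<and> X n \<in> Ob C"

typedef ('o, 'm, 'z) vec =
  "{v :: ('o, 'm, 'z) preadd_scheme \<Rightarrow> 'o \<Rightarrow> (int \<Rightarrow> 'o) \<Rightarrow> int \<Rightarrow> 'm.
     \<forall>C W X n. if vec_index C W X n then v C W X n \<in> Hom C W (X n) else v C W X n = undefined}"
  by (rule exI[of _ "\<lambda>C W X n. if vec_index C W X n then Zro C W (X n) else undefined"])
    (simp add: vec_index_def preadditive_category.Zro_in)

setup_lifting type_definition_vec

lemma Rep_vec_in: "vec_index C W X n \<Longrightarrow> Rep_vec v C W X n \<in> Hom C W (X n)"
  using Rep_vec[of v] by (simp add: if_split)

instantiation vec :: (type, type, type) ab_group_add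
begin

lift_definition zero_vec :: "('a, 'b, 'c) vec" is
  "\<lambda>C W X n. if vec_index C W X n then Zro C W (X n) else undefined"
  by (simp add: vec_index_def preadditive_category.Zro_in)

lift_definition plus_vec :: "('a, 'b, 'c) vec \<Rightarrow> ('a, 'b, 'c) vec \<Rightarrow> ('a, 'b, 'c) vec" is
  "\<lambda>v w C W X n. if vec_index C W X n then v C W X n \<oplus>\<^bsub>C\<^esub> w C W X n else undefined"
  by (simp add: vec_index_def preadditive_category.Add_in)

lift_definition uminus_vec :: "('a, 'b, 'c) vec \<Rightarrow> ('a, 'b, 'c) vec" is
  "\<lambda>v C W X n. if vec_index C W X n then Neg C (v C W X n) else undefined"
  by (simp add: vec_index_def preadditive_category.Neg_in)

definition minus_vec :: "('a, 'b, 'c) vec \<Rightarrow> ('a, 'b, 'c) vec \<Rightarrow> ('a, 'b, 'c) vec" where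
  "minus_vec v w = v + - w"

instance
proof
  fix a b c :: "('a, 'b, 'c) vec"
  show "a + b + c = a + (b + c)"
    by transfer (auto simp: vec_index_def fun_eq_iff preadditive_category.Add_assoc)
  show comm: "a + b = b + a" for a b :: "('a, 'b, 'c) vec"
    by transfer (auto simp: vec_index_def fun_eq_iff preadditive_category.Add_comm)
  have zero: "a + 0 = a"
    by transfer (auto simp: vec_index_def fun_eq_iff preadditive_category.Add_Zro)
  then show "0 + a = a" by (simp add: comm)
  have "a + - a = 0"
    by transfer (auto simp: vec_index_def fun_eq_iff preadditive_category.Add_Neg)
  then show "- a + a = 0" by (simp add: comm)
  show "a - b = a + - b" by (simp add: minus_vec_def)
qed

end

section \<open>Additive endomorphisms of an abelian group\<close>

typedef (overloaded) 'a endo = "{g :: 'a::ab_group_add \<Rightarrow> 'a. \<forall>x y. g (x + y) = g x + g y}"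
  by (rule exI[of _ "\<lambda>x. x"]) simp

setup_lifting type_definition_endo

instantiation endo :: (ab_group_add) ring
begin

lift_definition zero_endo :: "'a endo" is "\<lambda>x. 0" by simp
lift_definition plus_endo :: "'a endo \<Rightarrow> 'a endo \<Rightarrow> 'a endo" is "\<lambda>f g x. f x + g x"
  by (simp add: algebra_simps)
lift_definition uminus_endo :: "'a endo \<Rightarrow> 'a endo" is "\<lambda>f x. - f x"
  by (simp add: algebra_simps)
lift_definition minus_endo :: "'a endo \<Rightarrow> 'a endo \<Rightarrow> 'a endo" is "\<lambda>f g x. f x - g x"
  by (simp add: algebra_simps)
lift_definition times_endo :: "'a endo \<Rightarrow> 'a endo \<Rightarrow> 'a endo" is "\<lambda>f g x. f (g x)"
  by simp

instance
  by standard (transfer; simp add: algebra_simps fun_eq_iff)+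

end

section \<open>Graded morphisms as endomorphisms of \<open>vec\<close>\<close>

definition garr :: "('o, 'm, 'z) preadd_scheme \<Rightarrow> (int \<Rightarrow> 'o) \<Rightarrow> int \<Rightarrow> (int \<Rightarrow> 'm) \<Rightarrow> (int \<Rightarrow> 'o) \<Rightarrow> bool"
  where "garr C X k f Y \<longleftrightarrow> preadditive_category C \<and> (\<forall>n. X n \<in> Ob C) \<and> (\<forall>n. Y n \<in> Ob C) \<and>
     (\<forall>n. f n \<in> Hom C (X n) (Y (n + k)))"

text \<open>Works like a matrix unit: the \<open>X\<close>-components over \<open>C\<close> are
  composed with \<open>f\<close> and moved to the \<open>Y\<close>-components, everything else goes
  to zero. Degree \<open>m\<close> of the target is fed from degree \<open>m - k\<close>. Ill-typed
  data act as zero, so that \<open>arr\<close> is additive, hence an element of \<open>endo\<close>,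
  for arbitrary arguments.\<close>

lift_definition arr_vec :: "('o, 'm, 'z) preadd_scheme \<Rightarrow> (int \<Rightarrow> 'o) \<Rightarrow> int \<Rightarrow> (int \<Rightarrow> 'm)
    \<Rightarrow> (int \<Rightarrow> 'o) \<Rightarrow> ('o, 'm, 'z) vec \<Rightarrow> ('o, 'm, 'z) vec"
  is "\<lambda>C X k f Y v D W Z m.
    if \<not> vec_index D W Z m then undefined
    else if D = C \<and> Z = Y \<and> garr C X k f Y then f (m - k) \<cdot>\<^bsub>C\<^esub> v C W X (m - k)
    else Zro D W (Z m)"
  subgoal for C X k f Y v D W Z m
  proof (cases "vec_index D W Z m \<and> D = C \<and> Z = Y \<and> garr C X k f Y")
    case True
    assume v: "\<And>C W X n. if vec_index C W X n then v C W X n \<in> Hom C W (X n) else v C W X n = undefined"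
    from True have "preadditive_category C" and ob: "W \<in> Ob C" "X (m - k) \<in> Ob C" "Y m \<in> Ob C"
      and f: "f (m - k) \<in> Hom C (X (m - k)) (Y m)"
      by (auto simp: garr_def vec_index_def dest: spec[of _ "m - k"])
    then interpret preadditive_category C by simp
    have "v C W X (m - k) \<in> Hom C W (X (m - k))"
      using v[of C W X "m - k"] ob by (auto simp: vec_index_def preadditive_category_axioms)
    with True ob f show ?thesis by (simp add: Cmp_in)
  qed (auto simp: vec_index_def preadditive_category.Zro_in)
  done

context preadditive_category
begin

lemma Add_Zro_left: "\<lbrakk>X \<in> Ob C; Y \<in> Ob C; f \<in> Hom C X Y\<rbrakk> \<Longrightarrow> Zro C X Y \<oplus> f = f"
  using Add_comm Add_Zro Zro_in by metis

lemma Add_left_cancel: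
  assumes "X \<in> Ob C" "Y \<in> Ob C" "f \<in> Hom C X Y" "g \<in> Hom C X Y" "h \<in> Hom C X Y"
    and "f \<oplus> g = f \<oplus> h"
  shows "g = h"
proof -
  have "Neg C f \<oplus> (f \<oplus> x) = x" if "x \<in> Hom C X Y" for x
    using assms(1-3) that Add_assoc[of X Y "Neg C f" f x] Add_comm[of X Y "Neg C f" f]
    by (simp add: Neg_in Add_Neg Add_Zro_left)
  then show ?thesis using assms by metis
qed

lemma Neg_unique:
  assumes "X \<in> Ob C" "Y \<in> Ob C" "f \<in> Hom C X Y" "g \<in> Hom C X Y" "f \<oplus> g = Zro C X Y"
  shows "g = Neg C f"
  using Add_left_cancel[of X Y f g "Neg C f"] assms by (simp add: Neg_in Add_Neg)

lemma Zro_unique: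
  assumes "X \<in> Ob C" "Y \<in> Ob C" "f \<in> Hom C X Y" "f \<oplus> f = f"
  shows "f = Zro C X Y"
  using Add_left_cancel[of X Y f f "Zro C X Y"] assms by (simp add: Zro_in Add_Zro)

lemma Cmp_Zro_right:
  assumes "X \<in> Ob C" "Y \<in> Ob C" "Z \<in> Ob C" "g \<in> Hom C Y Z"
  shows "g \<cdot> Zro C X Y = Zro C X Z"
proof (rule Zro_unique)
  show "(g \<cdot> Zro C X Y) \<oplus> (g \<cdot> Zro C X Y) = g \<cdot> Zro C X Y"
    using Cmp_Add_right[of X Y Z "Zro C X Y" "Zro C X Y" g] assms
    by (simp add: Zro_in Add_Zro)
qed (use assms Cmp_in Zro_in in blast)+

lemma Cmp_Zro_left:
  assumes "X \<in> Ob C" "Y \<in> Ob C" "Z \<in> Ob C" "f \<in> Hom C X Y"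
  shows "Zro C Y Z \<cdot> f = Zro C X Z"
proof (rule Zro_unique)
  show "(Zro C Y Z \<cdot> f) \<oplus> (Zro C Y Z \<cdot> f) = Zro C Y Z \<cdot> f"
    using Cmp_Add_left[of X Y Z f "Zro C Y Z" "Zro C Y Z"] assms
    by (simp add: Zro_in Add_Zro)
qed (use assms Cmp_in Zro_in in blast)+

lemma Neg_Neg: "\<lbrakk>X \<in> Ob C; Y \<in> Ob C; f \<in> Hom C X Y\<rbrakk> \<Longrightarrow> Neg C (Neg C f) = f"
  using Neg_unique[of X Y "Neg C f" f] by (simp add: Neg_in Add_Neg Add_comm[of X Y "Neg C f" f])

lemma arr_vec_add: "arr_vec C X k f Y (v + w) = arr_vec C X k f Y v + arr_vec C X k f Y w"
proof (transfer fixing: C X k f Y, intro ext)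
  fix v w :: "('o, 'm, 'z) preadd_scheme \<Rightarrow> 'o \<Rightarrow> (int \<Rightarrow> 'o) \<Rightarrow> int \<Rightarrow> 'm" and D W Z m
  assume v: "\<forall>C W X n. if vec_index C W X n then v C W X n \<in> Hom C W (X n) else v C W X n = undefined"
    and w: "\<forall>C W X n. if vec_index C W X n then w C W X n \<in> Hom C W (X n) else w C W X n = undefined"
  let ?v = "v C W X (m - k)" and ?w = "w C W X (m - k)"
  show "(if \<not> vec_index D W Z m then undefined
    else if D = C \<and> Z = Y \<and> garr C X k f Y then f (m - k) \<cdot> (if vec_index C W X (m - k) then ?v \<oplus> ?w else undefined)
    else Zro D W (Z m)) = (if vec_index D W Z m then 
      (if \<not> vec_index D W Z m then undefined
    else if D = C \<and> Z = Y \<and> garr C X k f Y then f (m - k) \<cdot> ?v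
    else Zro D W (Z m)) \<oplus>\<^bsub>D\<^esub> (if \<not> vec_index D W Z m then undefined
    else if D = C \<and> Z = Y \<and> garr C X k f Y then f (m - k) \<cdot> ?w
    else Zro D W (Z m)) else undefined)"
  proof (cases "vec_index D W Z m \<and> D = C \<and> Z = Y \<and> garr C X k f Y")
    case True
    then have ob: "W \<in> Ob C" "X (m - k) \<in> Ob C" "Y m \<in> Ob C" "vec_index C W X (m - k)"
      and f: "f (m - k) \<in> Hom C (X (m - k)) (Y m)"
      by (auto simp: garr_def vec_index_def dest: spec[of _ "m - k"])
    moreover have "?v \<in> Hom C W (X (m - k))" "?w \<in> Hom C W (X (m - k))"
      using v w ob(4) by metis+
    ultimately show ?thesis using True by (simp add: Cmp_Add_right)
  next
    case False
    then show ?thesis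
      by (auto simp: vec_index_def preadditive_category.Add_Zro preadditive_category.Zro_in)
  qed
qed

end

lemma arr_vec_invalid: "\<not> garr C X k f Y \<Longrightarrow> arr_vec C X k f Y v = 0"
  by transfer (auto simp: fun_eq_iff)

lift_definition arr :: "('o, 'm, 'z) preadd_scheme \<Rightarrow> (int \<Rightarrow> 'o) \<Rightarrow> int \<Rightarrow> (int \<Rightarrow> 'm)
    \<Rightarrow> (int \<Rightarrow> 'o) \<Rightarrow> ('o, 'm, 'z) vec endo" is arr_vec
  by (metis arr_vec_invalid add.left_neutral garr_def preadditive_category.arr_vec_add)

context preadditive_category
begin

lemma arr_inj:
  assumes f: "garr C X k f Y" and g: "garr C X k g Y" and eq: "arr C X k f Y = arr C X k g Y"
  shows "f = g"
proof
  fix n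
  \<comment> \<open>Evaluation at an identity: the vector with \<open>Idm C (X n)\<close> at the
    component for \<open>X n\<close>, \<open>X\<close>, \<open>n\<close> and zero elsewhere is sent
    to a vector in which \<open>f n\<close> can be read off.\<close>
  define v where "v = Abs_vec (\<lambda>D W Z m. if vec_index D W Z m then
    if D = C \<and> W = X n \<and> Z = X \<and> m = n then Idm C (X n) else Zro D W (Z m) else undefined)"
  have v: "Rep_vec v = (\<lambda>D W Z m. if vec_index D W Z m then
    if D = C \<and> W = X n \<and> Z = X \<and> m = n then Idm C (X n) else Zro D W (Z m) else undefined)"
    unfolding v_def by (rule Abs_vec_inverse)
      (auto simp: vec_index_def preadditive_category.Zro_in Idm_in)
  have ob: "X n \<in> Ob C" "Y (n + k) \<in> Ob C" and fg: "f n \<in> Hom C (X n) (Y (n + k))" "g n \<in> Hom C (X n) (Y (n + k))"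
    using f g by (auto simp: garr_def)
  have "arr_vec C X k f Y v = arr_vec C X k g Y v"
    using arg_cong[OF eq, of Rep_endo] by (simp add: arr.rep_eq)
  then have "Rep_vec (arr_vec C X k f Y v) C (X n) Y (n + k) = Rep_vec (arr_vec C X k g Y v) C (X n) Y (n + k)"
    by simp
  then show "f n = g n"
    using ob fg f g
    by (simp add: arr_vec.rep_eq v vec_index_def preadditive_category_axioms Idm_right)
qed

lemma arr_mult:
  assumes g: "garr C Y l g Z" and f: "garr C X k f Y"
  shows "arr C Y l g Z * arr C X k f Y = arr C X (k + l) (\<lambda>n. g (n + k) \<cdot> f n) Z"
proof -
  have gf: "garr C X (k + l) (\<lambda>n. g (n + k) \<cdot> f n) Z"
    using f g unfolding garr_def by (metis Cmp_in add.assoc)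
  have "arr_vec C Y l g Z (arr_vec C X k f Y v) = arr_vec C X (k + l) (\<lambda>n. g (n + k) \<cdot> f n) Z v" for v
  proof (rule Rep_vec_inject[THEN iffD1], intro ext)
    fix D W T m
    show "Rep_vec (arr_vec C Y l g Z (arr_vec C X k f Y v)) D W T m =
      Rep_vec (arr_vec C X (k + l) (\<lambda>n. g (n + k) \<cdot> f n) Z v) D W T m"
    proof (cases "vec_index D W T m \<and> D = C \<and> T = Z")
      case True
      obtain n where m: "m = n + k + l" by (metis diff_add_cancel)
      have ob: "W \<in> Ob C" "X n \<in> Ob C" "Y (n + k) \<in> Ob C" "Z m \<in> Ob C"
        using True f g by (auto simp: vec_index_def garr_def)
      have fg: "f n \<in> Hom C (X n) (Y (n + k))" "g (n + k) \<in> Hom C (Y (n + k)) (Z m)"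
        using f g unfolding garr_def m by blast+
      have "Rep_vec v C W X n \<in> Hom C W (X n)"
        by (rule Rep_vec_in) (simp add: vec_index_def ob preadditive_category_axioms)
      moreover have "m - l = n + k" "m - (k + l) = n" "n + k - k = n"
        using m by simp_all
      ultimately show ?thesis
        using True f g gf ob fg unfolding arr_vec.rep_eq
        by (auto simp only: vec_index_def Cmp_assoc if_True simp_thms if_False)
    next
      case False
      then show ?thesis by (auto simp: arr_vec.rep_eq)
    qed
  qed
  then show ?thesis
    by (auto simp: arr.rep_eq times_endo.rep_eq fun_eq_iff intro!: Rep_endo_inject[THEN iffD1])
qed

lemma arr_add:
  assumes f: "garr C X k f Y" and g: "garr C X k g Y"
  shows "arr C X k f Y + arr C X k g Y = arr C X k (\<lambda>n. f n \<oplus> g n) Y"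
proof -
  have sum: "garr C X k (\<lambda>n. f n \<oplus> g n) Y"
    using f g unfolding garr_def by (metis Add_in)
  have "arr_vec C X k f Y v + arr_vec C X k g Y v = arr_vec C X k (\<lambda>n. f n \<oplus> g n) Y v" for v
  proof (rule Rep_vec_inject[THEN iffD1], intro ext)
    fix D W T m
    show "Rep_vec (arr_vec C X k f Y v + arr_vec C X k g Y v) D W T m =
      Rep_vec (arr_vec C X k (\<lambda>n. f n \<oplus> g n) Y v) D W T m"
    proof (cases "vec_index D W T m \<and> D = C \<and> T = Y")
      case True
      obtain n where m: "m = n + k" by (metis diff_add_cancel)
      have ob: "W \<in> Ob C" "X n \<in> Ob C" "Y m \<in> Ob C"
        using True f g by (auto simp: vec_index_def garr_def)
      have fg: "f n \<in> Hom C (X n) (Y m)" "g n \<in> Hom C (X n) (Y m)"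
        using f g unfolding garr_def m by blast+
      have "Rep_vec v C W X n \<in> Hom C W (X n)"
        by (rule Rep_vec_in) (simp add: vec_index_def ob preadditive_category_axioms)
      moreover have "m - k = n"
        using m by simp
      ultimately show ?thesis
        using True f g sum fg ob unfolding arr_vec.rep_eq plus_vec.rep_eq
        by (auto simp only: vec_index_def Cmp_Add_left if_True simp_thms if_False)
    next
      case False
      then show ?thesis
        by (auto simp: arr_vec.rep_eq plus_vec.rep_eq vec_index_def preadditive_category.Add_Zro preadditive_category.Zro_in)
    qed
  qed
  then show ?thesis
    by (auto simp: arr.rep_eq plus_endo.rep_eq fun_eq_iff intro!: Rep_endo_inject[THEN iffD1])
qed

lemma garr_Zro: "(\<And>n. X n \<in> Ob C) \<Longrightarrow> (\<And>n. Y n \<in> Ob C) \<Longrightarrow> garr C X k (\<lambda>n. Zro C (X n) (Y (n + k))) Y"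
  by (simp add: garr_def Zro_in preadditive_category_axioms)

lemma arr_Zro:
  assumes "\<And>n. X n \<in> Ob C" "\<And>n. Y n \<in> Ob C"
  shows "arr C X k (\<lambda>n. Zro C (X n) (Y (n + k))) Y = 0"
proof -
  have "arr C X k (\<lambda>n. Zro C (X n) (Y (n + k))) Y + arr C X k (\<lambda>n. Zro C (X n) (Y (n + k))) Y
      = arr C X k (\<lambda>n. Zro C (X n) (Y (n + k))) Y"
    using assms by (simp add: arr_add garr_Zro Add_Zro Zro_in)
  then show ?thesis by simp
qed

lemma garr_Neg: "garr C X k f Y \<Longrightarrow> garr C X k (\<lambda>n. Neg C (f n)) Y"
  by (simp add: garr_def Neg_in)

lemma arr_Neg:
  assumes f: "garr C X k f Y"
  shows "arr C X k (\<lambda>n. Neg C (f n)) Y = - arr C X k f Y"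
proof -
  have ob: "\<And>n. X n \<in> Ob C" "\<And>n. Y n \<in> Ob C" and "\<And>n. f n \<in> Hom C (X n) (Y (n + k))"
    using f by (auto simp: garr_def)
  then have "(\<lambda>n. f n \<oplus> Neg C (f n)) = (\<lambda>n. Zro C (X n) (Y (n + k)))"
    by (auto intro!: ext Add_Neg)
  then have "arr C X k f Y + arr C X k (\<lambda>n. Neg C (f n)) Y = 0"
    using arr_add[OF f garr_Neg[OF f]] arr_Zro[of X Y k] ob by simp
  then show ?thesis by (simp add: eq_neg_iff_add_eq_0 add.commute)
qed

end

section \<open>Complexes and homotopies inside the ring\<close>

definition gHom :: "('o, 'm, 'z) preadd_scheme \<Rightarrow> (int \<Rightarrow> 'o) \<Rightarrow> int \<Rightarrow> (int \<Rightarrow> 'o)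
    \<Rightarrow> ('o, 'm, 'z) vec endo set" where
  "gHom C X k Y = {arr C X k f Y | f. garr C X k f Y}"

text \<open>An idempotent rather than a unit of the ring: it projects onto the
  \<open>X\<close>-components over \<open>C\<close>, so it is absorbed by members of the matching
  \<open>gHom\<close> and not by arbitrary ring elements.\<close>

definition gid :: "('o, 'm, 'z) preadd_scheme \<Rightarrow> (int \<Rightarrow> 'o) \<Rightarrow> ('o, 'm, 'z) vec endo" where
  "gid C X = arr C X 0 (\<lambda>n. Idm C (X n)) X"

definition df :: "('o, 'm, 'z) preadd_scheme \<Rightarrow> ('o, 'm) cplx \<Rightarrow> ('o, 'm, 'z) vec endo" where
  "df C X = arr C (cob X) 1 (cdf X) (cob X)"

definition mp :: "('o, 'm, 'z) preadd_scheme \<Rightarrow> ('o, 'm) cplx \<Rightarrow> ('o, 'm) cplx \<Rightarrow> (int \<Rightarrow> 'm)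
    \<Rightarrow> ('o, 'm, 'z) vec endo" where
  "mp C X Y f = arr C (cob X) 0 f (cob Y)"

definition cmap :: "('o, 'm, 'z) preadd_scheme \<Rightarrow> ('o, 'm) cplx \<Rightarrow> ('o, 'm) cplx
    \<Rightarrow> ('o, 'm, 'z) vec endo set" where
  "cmap C X Y = {a \<in> gHom C (cob X) 0 (cob Y). df C Y * a = a * df C X}"

definition nul :: "('o, 'm, 'z) preadd_scheme \<Rightarrow> ('o, 'm) cplx \<Rightarrow> ('o, 'm) cplx
    \<Rightarrow> ('o, 'm, 'z) vec endo \<Rightarrow> bool" where
  "nul C X Y a \<longleftrightarrow> (\<exists>h\<in>gHom C (cob X) (-1) (cob Y). a = df C Y * h + h * df C X)"

definition orth :: "('o, 'm, 'z) preadd_scheme \<Rightarrow> ('o, 'm) cplx \<Rightarrow> ('o, 'm) cplx \<Rightarrow> bool" where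
  "orth C X Y \<longleftrightarrow> (\<forall>a\<in>cmap C X Y. nul C X Y a)"

definition heq :: "('o, 'm, 'z) preadd_scheme \<Rightarrow> ('o, 'm) cplx \<Rightarrow> ('o, 'm) cplx \<Rightarrow> bool" where
  "heq C X Y \<longleftrightarrow> (\<exists>a\<in>cmap C X Y. \<exists>b\<in>cmap C Y X.
     nul C X X (b * a - gid C (cob X)) \<and> nul C Y Y (a * b - gid C (cob Y)))"

definition contr :: "('o, 'm, 'z) preadd_scheme \<Rightarrow> ('o, 'm) cplx \<Rightarrow> bool" where
  "contr C X \<longleftrightarrow> nul C X X (gid C (cob X))"

text \<open>Products are kept nested to the right, where \<open>a * b\<close> is often not a
  subterm; in this form an equation still applies there as a rewrite rule.\<close>

lemma mult_ext: "a * b = c \<Longrightarrow> a * (b * x) = c * x" for a :: "'a::semigroup_mult"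
  by (metis mult.assoc)

section \<open>Graded Hom groups, chain maps and null-homotopies as ring elements\<close>

context preadditive_category
begin

lemma gHomI: "garr C X k f Y \<Longrightarrow> arr C X k f Y \<in> gHom C X k Y"
  by (auto simp: gHom_def)

lemma garr_mult: "garr C Y l g Z \<Longrightarrow> garr C X k f Y \<Longrightarrow> garr C X (k + l) (\<lambda>n. g (n + k) \<cdot> f n) Z"
  unfolding garr_def by (metis Cmp_in add.assoc)

lemma garr_add: "garr C X k f Y \<Longrightarrow> garr C X k g Y \<Longrightarrow> garr C X k (\<lambda>n. f n \<oplus> g n) Y"
  unfolding garr_def by (metis Add_in)

lemma gHom_mult: "a \<in> gHom C Y l Z \<Longrightarrow> b \<in> gHom C X k Y \<Longrightarrow> m = k + l \<Longrightarrow> a * b \<in> gHom C X m Z"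
  unfolding gHom_def using arr_mult garr_mult by blast

lemma gHom_add: "a \<in> gHom C X k Y \<Longrightarrow> b \<in> gHom C X k Y \<Longrightarrow> a + b \<in> gHom C X k Y"
  unfolding gHom_def by (auto simp: arr_add intro!: garr_add)

lemma gHom_uminus: "a \<in> gHom C X k Y \<Longrightarrow> - a \<in> gHom C X k Y"
  unfolding gHom_def by (auto simp: arr_Neg[symmetric] intro!: garr_Neg)

lemma gHom_minus: "a \<in> gHom C X k Y \<Longrightarrow> b \<in> gHom C X k Y \<Longrightarrow> a - b \<in> gHom C X k Y"
  using gHom_add[of a X k Y "- b"] by (simp add: gHom_uminus)

lemma gHom_0: "(\<And>n. X n \<in> Ob C) \<Longrightarrow> (\<And>n. Y n \<in> Ob C) \<Longrightarrow> 0 \<in> gHom C X k Y"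
  using gHomI[OF garr_Zro[of X Y k]] by (simp add: arr_Zro)

lemmas gHom_closed = gHom_add gHom_uminus gHom_minus

lemma garr_Idm: "(\<And>n. X n \<in> Ob C) \<Longrightarrow> garr C X 0 (\<lambda>n. Idm C (X n)) X"
  by (simp add: garr_def Idm_in preadditive_category_axioms)

lemma gid_in: "(\<And>n. X n \<in> Ob C) \<Longrightarrow> gid C X \<in> gHom C X 0 X"
  unfolding gid_def by (intro gHomI garr_Idm)

lemma gid_left: assumes "a \<in> gHom C X k Y" shows "gid C Y * a = a"
proof -
  obtain f where a: "a = arr C X k f Y" and f: "garr C X k f Y" using assms by (auto simp: gHom_def)
  have "(\<lambda>n. Idm C (Y (n + k)) \<cdot> f n) = f"
    using f by (intro ext) (metis Idm_left garr_def)
  moreover have "garr C Y 0 (\<lambda>n. Idm C (Y n)) Y" using f by (intro garr_Idm) (simp add: garr_def)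
  ultimately show ?thesis by (simp add: a gid_def arr_mult[OF _ f])
qed

lemma gid_right: assumes "a \<in> gHom C X k Y" shows "a * gid C X = a"
proof -
  obtain f where a: "a = arr C X k f Y" and f: "garr C X k f Y" using assms by (auto simp: gHom_def)
  have "(\<lambda>n. f n \<cdot> Idm C (X n)) = f"
    using f by (intro ext) (metis Idm_right garr_def)
  moreover have "garr C X 0 (\<lambda>n. Idm C (X n)) X" using f by (intro garr_Idm) (simp add: garr_def)
  ultimately show ?thesis by (simp add: a gid_def arr_mult[OF f])
qed

text \<open>The pattern of all translations into the ring: \<open>arr_mult\<close> turns the
  degreewise equation into an identity of ring elements, and \<open>arr_inj\<close> reads it back
  degree by degree.\<close>

lemma complexes_iff:
  "X \<in> complexes C \<longleftrightarrow> garr C (cob X) 1 (cdf X) (cob X) \<and> df C X * df C X = 0"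
proof -
  have "(df C X * df C X = 0) \<longleftrightarrow> (\<forall>n. cdf X (n + 1) \<cdot> cdf X n = Zro C (cob X n) (cob X (n + 2)))"
    if g: "garr C (cob X) 1 (cdf X) (cob X)"
  proof -
    have ob: "\<And>n. cob X n \<in> Ob C" using g by (simp add: garr_def)
    have gg: "garr C (cob X) 2 (\<lambda>n. cdf X (n + 1) \<cdot> cdf X n) (cob X)"
      using garr_mult[OF g g] by simp
    have "df C X * df C X = arr C (cob X) 2 (\<lambda>n. cdf X (n + 1) \<cdot> cdf X n) (cob X)"
      using arr_mult[OF g g] by (simp add: df_def)
    moreover have "arr C (cob X) 2 (\<lambda>n. Zro C (cob X n) (cob X (n + 2))) (cob X) = 0"
      by (rule arr_Zro) (rule ob)+
    ultimately show ?thesis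
      using arr_inj[OF gg garr_Zro[of "cob X" "cob X" 2]] ob by (auto simp: fun_eq_iff)
  qed
  then show ?thesis
    unfolding complexes_def by (auto simp: garr_def preadditive_category_axioms)
qed

lemma complexes_ob: "X \<in> complexes C \<Longrightarrow> cob X n \<in> Ob C"
  by (simp add: complexes_def)

lemma df_in: "X \<in> complexes C \<Longrightarrow> df C X \<in> gHom C (cob X) 1 (cob X)"
  by (simp add: complexes_iff df_def gHomI)

lemma df_df: "X \<in> complexes C \<Longrightarrow> df C X * df C X = 0"
  by (simp add: complexes_iff)

lemma chain_maps_iff:
  assumes X: "X \<in> complexes C" and Y: "Y \<in> complexes C"
  shows "f \<in> chain_maps C X Y \<longleftrightarrow>
    garr C (cob X) 0 f (cob Y) \<and> df C Y * mp C X Y f = mp C X Y f * df C X"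
proof -
  have "(df C Y * mp C X Y f = mp C X Y f * df C X) \<longleftrightarrow> (\<forall>n. f (n + 1) \<cdot> cdf X n = cdf Y n \<cdot> f n)"
    if g: "garr C (cob X) 0 f (cob Y)"
  proof -
    have dX: "garr C (cob X) 1 (cdf X) (cob X)" and dY: "garr C (cob Y) 1 (cdf Y) (cob Y)"
      using X Y by (simp_all add: complexes_iff)
    have "garr C (cob X) 1 (\<lambda>n. cdf Y n \<cdot> f n) (cob Y)" "garr C (cob X) 1 (\<lambda>n. f (n + 1) \<cdot> cdf X n) (cob Y)"
      using garr_mult[OF dY g] garr_mult[OF g dX] by simp_all
    note inj = arr_inj[OF this]
    have "df C Y * mp C X Y f = arr C (cob X) 1 (\<lambda>n. cdf Y n \<cdot> f n) (cob Y)"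
      "mp C X Y f * df C X = arr C (cob X) 1 (\<lambda>n. f (n + 1) \<cdot> cdf X n) (cob Y)"
      using arr_mult[OF dY g] arr_mult[OF g dX] by (simp_all add: df_def mp_def)
    then show ?thesis
      using inj by (metis (no_types, lifting) ext)
  qed
  then show ?thesis
    using X Y unfolding chain_maps_def by (auto simp: garr_def preadditive_category_axioms complexes_ob)
qed

lemma chain_maps_mp: "X \<in> complexes C \<Longrightarrow> Y \<in> complexes C \<Longrightarrow> f \<in> chain_maps C X Y \<Longrightarrow> mp C X Y f \<in> cmap C X Y"
  by (simp add: chain_maps_iff cmap_def mp_def gHomI)

lemma cmapE:
  assumes "a \<in> cmap C X Y" "X \<in> complexes C" "Y \<in> complexes C"
  obtains f where "f \<in> chain_maps C X Y" "a = mp C X Y f"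
proof -
  obtain f where "a = arr C (cob X) 0 f (cob Y)" "garr C (cob X) 0 f (cob Y)"
    using assms(1) by (auto simp: gHom_def cmap_def)
  then show ?thesis using assms that[of f] by (simp add: chain_maps_iff mp_def cmap_def)
qed

lemma chain_maps_garr: "X \<in> complexes C \<Longrightarrow> Y \<in> complexes C \<Longrightarrow> f \<in> chain_maps C X Y \<Longrightarrow> garr C (cob X) 0 f (cob Y)"
  by (simp add: chain_maps_iff)

lemma homotopic_iff:
  assumes X: "X \<in> complexes C" and Y: "Y \<in> complexes C"
    and f: "garr C (cob X) 0 f (cob Y)" and g: "garr C (cob X) 0 g (cob Y)"
  shows "homotopic C X Y f g \<longleftrightarrow> nul C X Y (mp C X Y f - mp C X Y g)"
proof -
  have dX: "garr C (cob X) 1 (cdf X) (cob X)" and dY: "garr C (cob Y) 1 (cdf Y) (cob Y)"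
    using X Y by (simp_all add: complexes_iff)
  have *: "(mp C X Y f - mp C X Y g = df C Y * arr C (cob X) (-1) h (cob Y) + arr C (cob X) (-1) h (cob Y) * df C X)
    \<longleftrightarrow> (\<forall>n. f n = g n \<oplus> ((cdf Y (n - 1) \<cdot> h n) \<oplus> (h (n + 1) \<cdot> cdf X n)))" (is "?l = ?r")
    if h: "garr C (cob X) (-1) h (cob Y)" for h
  proof -
    have dh: "garr C (cob X) 0 (\<lambda>n. cdf Y (n - 1) \<cdot> h n) (cob Y)"
      using garr_mult[OF dY h] by simp
    have hd: "garr C (cob X) 0 (\<lambda>n. h (n + 1) \<cdot> cdf X n) (cob Y)"
      using garr_mult[OF h dX] by simp
    note s = garr_add[OF g garr_add[OF dh hd]]
    have "mp C X Y g + (df C Y * arr C (cob X) (-1) h (cob Y) + arr C (cob X) (-1) h (cob Y) * df C X)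
      = arr C (cob X) 0 (\<lambda>n. g n \<oplus> ((cdf Y (n - 1) \<cdot> h n) \<oplus> (h (n + 1) \<cdot> cdf X n))) (cob Y)"
      using arr_mult[OF dY h] arr_mult[OF h dX] arr_add[OF dh hd] arr_add[OF g garr_add[OF dh hd]]
      by (simp add: mp_def df_def)
    then have "?l \<longleftrightarrow> arr C (cob X) 0 f (cob Y) =
       arr C (cob X) 0 (\<lambda>n. g n \<oplus> ((cdf Y (n - 1) \<cdot> h n) \<oplus> (h (n + 1) \<cdot> cdf X n))) (cob Y)"
      by (simp add: mp_def algebra_simps)
    also have "\<dots> \<longleftrightarrow> ?r"
      using arr_inj[OF f s] by (metis (no_types, lifting) ext)
    finally show ?thesis .
  qed
  have "homotopic C X Y f g \<longleftrightarrow> (\<exists>h. garr C (cob X) (-1) h (cob Y) \<and>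
     (\<forall>n. f n = g n \<oplus> ((cdf Y (n - 1) \<cdot> h n) \<oplus> (h (n + 1) \<cdot> cdf X n))))"
    using X Y by (auto simp: homotopic_def garr_def preadditive_category_axioms complexes_ob)
  also have "\<dots> \<longleftrightarrow> nul C X Y (mp C X Y f - mp C X Y g)"
    unfolding nul_def gHom_def using * by blast
  finally show ?thesis .
qed

lemma mp_cmp:
  assumes "garr C (cob Y) 0 g (cob Z)" "garr C (cob X) 0 f (cob Y)"
  shows "mp C X Z (\<lambda>n. g n \<cdot> f n) = mp C Y Z g * mp C X Y f"
  using arr_mult[OF assms] by (simp add: mp_def)

lemma mp_Idm: "mp C X X (\<lambda>n. Idm C (cob X n)) = gid C (cob X)"
  by (simp add: mp_def gid_def)

lemma cmap_in: "a \<in> cmap C X Y \<Longrightarrow> a \<in> gHom C (cob X) 0 (cob Y)"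
  by (simp add: cmap_def)

lemma cmap_df: "a \<in> cmap C X Y \<Longrightarrow> df C Y * a = a * df C X"
  by (simp add: cmap_def)

lemma cmap_mult: "a \<in> cmap C Y Z \<Longrightarrow> b \<in> cmap C X Y \<Longrightarrow> a * b \<in> cmap C X Z"
  unfolding cmap_def by (auto intro: gHom_mult) (metis mult.assoc)

lemma cmap_minus: "a \<in> cmap C X Y \<Longrightarrow> b \<in> cmap C X Y \<Longrightarrow> a - b \<in> cmap C X Y"
  unfolding cmap_def by (auto intro: gHom_closed simp: algebra_simps)

lemma cmap_gid: "X \<in> complexes C \<Longrightarrow> gid C (cob X) \<in> cmap C X X"
  by (simp add: cmap_def gid_in complexes_ob gid_left[OF df_in] gid_right[OF df_in])

lemma nulI: "h \<in> gHom C (cob X) (-1) (cob Y) \<Longrightarrow> a = df C Y * h + h * df C X \<Longrightarrow> nul C X Y a"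
  by (auto simp: nul_def)

lemma nul_add:
  assumes "nul C X Y a" "nul C X Y b" shows "nul C X Y (a + b)"
proof -
  obtain h k where "h \<in> gHom C (cob X) (-1) (cob Y)" "a = df C Y * h + h * df C X"
    "k \<in> gHom C (cob X) (-1) (cob Y)" "b = df C Y * k + k * df C X"
    using assms by (auto simp: nul_def)
  then show ?thesis by (intro nulI[of "h + k"]) (simp_all add: gHom_add algebra_simps)
qed

lemma nul_uminus: "nul C X Y a \<Longrightarrow> nul C X Y (- a)"
  unfolding nul_def by (auto intro!: bexI[OF _ gHom_uminus] simp: algebra_simps)

lemma nul_minus: "nul C X Y a \<Longrightarrow> nul C X Y b \<Longrightarrow> nul C X Y (a - b)"
  using nul_add[of X Y a "- b"] nul_uminus[of X Y b] by simp

lemma nul_0: "X \<in> complexes C \<Longrightarrow> Y \<in> complexes C \<Longrightarrow> nul C X Y 0"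
  by (rule nulI[of 0]) (auto intro: gHom_0 complexes_ob)

lemma nul_left: assumes "c \<in> cmap C Y Z" "nul C X Y a" shows "nul C X Z (c * a)"
proof -
  obtain h where h: "h \<in> gHom C (cob X) (-1) (cob Y)" "a = df C Y * h + h * df C X"
    using assms(2) by (auto simp: nul_def)
  have "c * (df C Y * h) = df C Z * (c * h)"
    using cmap_df[OF assms(1)] by (metis mult.assoc)
  with h show ?thesis
    by (intro nulI[of "c * h"]) (auto intro: gHom_mult cmap_in[OF assms(1)] simp: algebra_simps)
qed

lemma nul_right: assumes "c \<in> cmap C W X" "nul C X Y a" shows "nul C W Y (a * c)"
proof -
  obtain h where h: "h \<in> gHom C (cob X) (-1) (cob Y)" "a = df C Y * h + h * df C X"
    using assms(2) by (auto simp: nul_def)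
  have "h * df C X * c = h * c * df C W"
    using cmap_df[OF assms(1)] by (metis mult.assoc)
  with h show ?thesis
    by (intro nulI[of "h * c"]) (auto intro: gHom_mult cmap_in[OF assms(1)] simp: algebra_simps)
qed

lemma contr_orth_left: "contr C X \<Longrightarrow> orth C X Y"
  unfolding contr_def orth_def using nul_left cmap_in gid_right by metis

lemma contr_orth_right: "contr C Y \<Longrightarrow> orth C X Y"
  unfolding contr_def orth_def using nul_right cmap_in gid_left by metis

lemma heq_refl: "X \<in> complexes C \<Longrightarrow> heq C X X"
  unfolding heq_def
  by (intro bexI[of _ "gid C (cob X)"] conjI)
    (simp_all add: cmap_gid nul_0 gid_left[OF gid_in] complexes_ob)

lemma heq_sym: "heq C X Y \<Longrightarrow> heq C Y X"
  unfolding heq_def by blast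

text \<open>Up to homotopy \<open>f\<close> equals \<open>f * a * b\<close>, and
  \<open>f * a\<close> starts at \<open>X\<close>.\<close>

lemma orth_heq_left:
  assumes "heq C X Y" "orth C X T" shows "orth C Y T"
  unfolding orth_def
proof
  fix f assume f: "f \<in> cmap C Y T"
  obtain a b where a: "a \<in> cmap C X Y" "b \<in> cmap C Y X" "nul C Y Y (a * b - gid C (cob Y))"
    using assms(1) by (auto simp: heq_def)
  have "nul C Y T (f * a * b - f * (a * b - gid C (cob Y)))"
    using assms(2) a f by (intro nul_minus nul_left[OF f a(3)] nul_right[OF a(2)])
      (auto simp: orth_def cmap_mult)
  then show "nul C Y T f"
    using gid_right[OF cmap_in[OF f]] by (simp add: algebra_simps)
qed

lemma orth_heq_right:
  assumes "heq C X Y" "orth C T X" shows "orth C T Y"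
  unfolding orth_def
proof
  fix f assume f: "f \<in> cmap C T Y"
  obtain a b where a: "a \<in> cmap C X Y" "b \<in> cmap C Y X" "nul C Y Y (a * b - gid C (cob Y))"
    using assms(1) by (auto simp: heq_def)
  have "nul C T Y (a * (b * f) - (a * b - gid C (cob Y)) * f)"
    using assms(2) a f by (intro nul_minus nul_right[OF f a(3)] nul_left[OF a(1)])
      (auto simp: orth_def cmap_mult)
  then show "nul C T Y f"
    using gid_left[OF cmap_in[OF f]] by (simp add: algebra_simps)
qed

end

section \<open>The homotopy category\<close>

context preadditive_category
begin

lemma cmap_eq: "X \<in> complexes C \<Longrightarrow> Y \<in> complexes C \<Longrightarrow> cmap C X Y = mp C X Y ` chain_maps C X Y"
  by (auto simp: chain_maps_mp elim!: cmapE)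

lemma Idm_Idm: "X \<in> Ob C \<Longrightarrow> Idm C X \<cdot> Idm C X = Idm C X"
  using Idm_left Idm_in by blast

lemma homotopic_chain_maps_iff:
  assumes "X \<in> complexes C" "Y \<in> complexes C" "f \<in> chain_maps C X Y" "g \<in> chain_maps C X Y"
  shows "homotopic C X Y f g \<longleftrightarrow> nul C X Y (mp C X Y f - mp C X Y g)"
  using homotopic_iff assms chain_maps_garr by blast

lemma homotopic_class_eq:
  assumes "X \<in> complexes C" "Y \<in> complexes C" "f \<in> chain_maps C X Y" "g \<in> chain_maps C X Y"
    and "homotopic C X Y f g"
  shows "{k \<in> chain_maps C X Y. homotopic C X Y f k} = {k \<in> chain_maps C X Y. homotopic C X Y g k}"
proof -
  have fg: "nul C X Y (mp C X Y f - mp C X Y g)" using assms homotopic_chain_maps_iff by blast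
  have "nul C X Y (mp C X Y f - k) \<longleftrightarrow> nul C X Y (mp C X Y g - k)" for k
    using nul_minus[OF _ fg, of "mp C X Y f - k"] nul_add[OF _ fg, of "mp C X Y g - k"]
    by (auto simp: algebra_simps)
  then show ?thesis using assms homotopic_chain_maps_iff by blast
qed

lemma homotopic_refl:
  assumes "X \<in> complexes C" "Y \<in> complexes C" "f \<in> chain_maps C X Y"
  shows "homotopic C X Y f f"
  using assms by (simp add: homotopic_chain_maps_iff nul_0)

lemma hclass_eq_iff:
  assumes "X \<in> complexes C" "Y \<in> complexes C" "f \<in> chain_maps C X Y" "g \<in> chain_maps C X Y"
  shows "hclass C X Y f = hclass C X Y g \<longleftrightarrow> nul C X Y (mp C X Y f - mp C X Y g)"
proof
  assume "hclass C X Y f = hclass C X Y g"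
  then have "g \<in> {k \<in> chain_maps C X Y. homotopic C X Y f k}"
    using homotopic_refl[of X Y g] assms by (simp add: hclass_def)
  then show "nul C X Y (mp C X Y f - mp C X Y g)" using assms homotopic_chain_maps_iff by blast
next
  assume "nul C X Y (mp C X Y f - mp C X Y g)"
  then have "homotopic C X Y f g" using assms homotopic_chain_maps_iff by blast
  then show "hclass C X Y f = hclass C X Y g"
    using homotopic_class_eq assms by (simp add: hclass_def)
qed

lemma K_sel:
  "Ob (K C) = complexes C"
  "Hom (K C) X Y = hclass C X Y ` chain_maps C X Y"
  "Idm (K C) X = hclass C X X (\<lambda>n. Idm C (cob X n))"
  "Cmp (K C) = Cmp (homotopy_cat C)"
  "Zro (K C) X Y = hclass C X Y (\<lambda>n. Zro C (cob X n) (cob Y n))"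
  "Shift (K C) = shift_cplx C" "Triangles (K C) = distinguished_triangles C"
  by (simp_all add: K_def preadd.extend_def homotopy_cat_def)

lemma is_iso_homotopy_cat: "is_iso (homotopy_cat C) X Y f \<longleftrightarrow> is_iso (K C) X Y f"
  by (simp add: is_iso_def K_def preadd.extend_def)

lemma chain_maps_cmp:
  assumes "X \<in> complexes C" "Y \<in> complexes C" "Z \<in> complexes C"
    "f \<in> chain_maps C X Y" "g \<in> chain_maps C Y Z"
  shows "(\<lambda>n. g n \<cdot> f n) \<in> chain_maps C X Z"
    and "mp C X Z (\<lambda>n. g n \<cdot> f n) = mp C Y Z g * mp C X Y f"
proof -
  have g: "garr C (cob X) 0 f (cob Y)" "garr C (cob Y) 0 g (cob Z)" using assms chain_maps_garr by auto
  show *: "mp C X Z (\<lambda>n. g n \<cdot> f n) = mp C Y Z g * mp C X Y f"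
    by (rule mp_cmp) (rule g)+
  have "mp C Y Z g * mp C X Y f \<in> cmap C X Z" using assms chain_maps_mp cmap_mult by blast
  then show "(\<lambda>n. g n \<cdot> f n) \<in> chain_maps C X Z"
    using assms garr_mult[OF g(2) g(1)] by (simp add: chain_maps_iff * cmap_df)
qed

lemma chain_maps_Idm:
  assumes "X \<in> complexes C" shows "(\<lambda>n. Idm C (cob X n)) \<in> chain_maps C X X"
  using assms cmap_gid[OF assms] by (simp add: chain_maps_iff mp_Idm cmap_df garr_Idm complexes_ob)

text \<open>Replacing either factor by a homotopic one changes the product by a null-homotopic map.
  All classes in the union that defines \<open>Cmp\<close> therefore coincide, and reflexivity of
  homotopy makes the union nonempty.\<close>

lemma K_Cmp:
  assumes X: "X \<in> complexes C" and Y: "Y \<in> complexes C" and Z: "Z \<in> complexes C"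
    and f: "f \<in> chain_maps C X Y" and g: "g \<in> chain_maps C Y Z"
  shows "Cmp (K C) (hclass C Y Z g) (hclass C X Y f) = hclass C X Z (\<lambda>n. g n \<cdot> f n)"
proof -
  have eq: "hclass C X Z (\<lambda>n. g' n \<cdot> f' n) = hclass C X Z (\<lambda>n. g n \<cdot> f n)"
    if "g' \<in> chain_maps C Y Z" "homotopic C Y Z g g'" "f' \<in> chain_maps C X Y" "homotopic C X Y f f'" for g' f'
  proof -
    have "nul C X Y (mp C X Y f - mp C X Y f')" "nul C Y Z (mp C Y Z g - mp C Y Z g')"
      using that assms homotopic_chain_maps_iff by blast+
    then have "nul C X Z (mp C Y Z g' * (mp C X Y f - mp C X Y f'))" "nul C X Z ((mp C Y Z g - mp C Y Z g') * mp C X Y f)"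
      using nul_left[OF chain_maps_mp[OF Y Z]] nul_right[OF chain_maps_mp[OF X Y]] assms that by blast+
    then have "nul C X Z (- (mp C Y Z g' * (mp C X Y f - mp C X Y f') + (mp C Y Z g - mp C Y Z g') * mp C X Y f))"
      by (intro nul_uminus nul_add)
    then show ?thesis
      using assms that by (subst hclass_eq_iff) (auto simp: chain_maps_cmp algebra_simps)
  qed
  have ne: "f \<in> hcls (hclass C X Y f)" "g \<in> hcls (hclass C Y Z g)"
    using assms by (auto simp: hclass_def homotopic_refl)
  have "(\<Union>g'\<in>hcls (hclass C Y Z g). \<Union>f'\<in>hcls (hclass C X Y f). hcls (hclass C X Z (\<lambda>n. g' n \<cdot> f' n)))
     = hcls (hclass C X Z (\<lambda>n. g n \<cdot> f n))" (is "?l = ?r")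
  proof
    show "?l \<subseteq> ?r" using eq by (auto simp: hclass_def[of C X Y] hclass_def[of C Y Z])
    show "?r \<subseteq> ?l" using ne by blast
  qed
  then show ?thesis
    by (simp add: K_sel homotopy_cat_def) (simp add: hclass_def)
qed

lemma K_isomorphic_iff:
  assumes X: "X \<in> complexes C" and Y: "Y \<in> complexes C"
  shows "isomorphic (K C) X Y \<longleftrightarrow> heq C X Y"
proof -
  have *: "Cmp (K C) (hclass C Y X g) (hclass C X Y f) = Idm (K C) X
      \<longleftrightarrow> nul C X X (mp C Y X g * mp C X Y f - gid C (cob X))"
    if "f \<in> chain_maps C X Y" "g \<in> chain_maps C Y X" "X \<in> complexes C" "Y \<in> complexes C" for f g X Y
    using that by (simp add: K_Cmp K_sel(3) hclass_eq_iff chain_maps_cmp chain_maps_Idm mp_Idm)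
  have "isomorphic (K C) X Y \<longleftrightarrow> (\<exists>f\<in>chain_maps C X Y. \<exists>g\<in>chain_maps C Y X.
     Cmp (K C) (hclass C Y X g) (hclass C X Y f) = Idm (K C) X \<and>
     Cmp (K C) (hclass C X Y f) (hclass C Y X g) = Idm (K C) Y)"
    using assms unfolding isomorphic_def is_iso_def K_sel(1,2) by blast
  also have "\<dots> \<longleftrightarrow> (\<exists>f\<in>chain_maps C X Y. \<exists>g\<in>chain_maps C Y X.
     nul C X X (mp C Y X g * mp C X Y f - gid C (cob X)) \<and>
     nul C Y Y (mp C X Y f * mp C Y X g - gid C (cob Y)))"
    using * assms by auto
  also have "\<dots> \<longleftrightarrow> heq C X Y"
    unfolding heq_def by (simp add: cmap_eq assms)
  finally show ?thesis .
qed

lemma chain_maps_Zro: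
  assumes "X \<in> complexes C" "Y \<in> complexes C"
  shows "(\<lambda>n. Zro C (cob X n) (cob Y n)) \<in> chain_maps C X Y"
    and "mp C X Y (\<lambda>n. Zro C (cob X n) (cob Y n)) = 0"
proof -
  show *: "mp C X Y (\<lambda>n. Zro C (cob X n) (cob Y n)) = 0"
    using arr_Zro[of "cob X" "cob Y" 0] assms by (simp add: mp_def complexes_ob)
  show "(\<lambda>n. Zro C (cob X n) (cob Y n)) \<in> chain_maps C X Y"
    using garr_Zro[of "cob X" "cob Y" 0] assms by (simp add: chain_maps_iff * complexes_ob)
qed

lemma K_Hom_orth:
  assumes X: "X \<in> complexes C" and Y: "Y \<in> complexes C"
  shows "Hom (K C) X Y = {Zro (K C) X Y} \<longleftrightarrow> orth C X Y"
proof -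
  have "hclass C X Y f = Zro (K C) X Y \<longleftrightarrow> nul C X Y (mp C X Y f)" if "f \<in> chain_maps C X Y" for f
    using that assms by (simp add: K_sel hclass_eq_iff chain_maps_Zro)
  moreover have "Zro (K C) X Y \<in> Hom (K C) X Y"
    using assms by (auto simp: K_sel chain_maps_Zro)
  ultimately have "Hom (K C) X Y = {Zro (K C) X Y} \<longleftrightarrow> (\<forall>f\<in>chain_maps C X Y. nul C X Y (mp C X Y f))"
    unfolding K_sel(2) by blast
  also have "\<dots> \<longleftrightarrow> orth C X Y"
    unfolding orth_def by (simp add: cmap_eq assms)
  finally show ?thesis .
qed

text \<open>At a zero object the identity and the zero morphism coincide, which is a contraction.
  Conversely a contraction leaves only the zero class in every Hom set from or to the
  object.\<close>

lemma K_zero_iff: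
  "is_zero_ob (K C) Z \<longleftrightarrow> Z \<in> complexes C \<and> contr C Z"
proof
  assume z: "is_zero_ob (K C) Z"
  then have Z: "Z \<in> complexes C" by (simp add: is_zero_ob_def K_sel)
  have "Idm (K C) Z \<in> Hom (K C) Z Z" "Zro (K C) Z Z \<in> Hom (K C) Z Z"
    using Z by (auto simp: K_sel chain_maps_Zro chain_maps_Idm)
  then have "Idm (K C) Z = Zro (K C) Z Z"
    using z by (auto simp: is_zero_ob_def K_sel(1))
  then have "nul C Z Z (gid C (cob Z))"
    using Z by (simp add: K_sel hclass_eq_iff chain_maps_Zro chain_maps_Idm mp_Idm)
  with Z show "Z \<in> complexes C \<and> contr C Z" by (simp add: contr_def)
next
  assume z: "Z \<in> complexes C \<and> contr C Z"
  then have "Hom (K C) X Z = {Zro (K C) X Z}" "Hom (K C) Z X = {Zro (K C) Z X}" if "X \<in> complexes C" for X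
    using that K_Hom_orth contr_orth_left contr_orth_right by blast+
  with z show "is_zero_ob (K C) Z"
    unfolding is_zero_ob_def K_sel(1) by (metis singleton_iff)
qed

lemma K_iso_Idm: "X \<in> complexes C \<Longrightarrow> is_iso (K C) X X (Idm (K C) X)"
  unfolding is_iso_def
  by (auto simp: K_sel(1-3) K_Cmp chain_maps_Idm Idm_Idm complexes_ob intro!: bexI[of _ "\<lambda>n. Idm C (cob X n)"])

subsection \<open>Shifts and cones\<close>

lemma cob_shift [simp]: "cob (shift_cplx C X) n = cob X (n + 1)"
  and cdf_shift [simp]: "cdf (shift_cplx C X) n = Neg C (cdf X (n + 1))"
  by (simp_all add: shift_cplx_def)

text \<open>The suspension as a degree -1 map that is the identity in each degree; \<open>tg\<close>
  is its inverse. Shifting a map becomes conjugation, so shifts enter ring computations without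
  reindexing. The sign in the shifted differential makes both maps anticommute with the
  differentials.\<close>

definition sg where "sg X = arr C (cob X) (-1) (\<lambda>n. Idm C (cob X n)) (cob (shift_cplx C X))"
definition tg where "tg X = arr C (cob (shift_cplx C X)) 1 (\<lambda>n. Idm C (cob X (n + 1))) (cob X)"

lemma garr_sg: "(\<And>n. cob X n \<in> Ob C) \<Longrightarrow> garr C (cob X) (-1) (\<lambda>n. Idm C (cob X n)) (cob (shift_cplx C X))"
  and garr_tg: "(\<And>n. cob X n \<in> Ob C) \<Longrightarrow> garr C (cob (shift_cplx C X)) 1 (\<lambda>n. Idm C (cob X (n + 1))) (cob X)"
  by (simp_all add: garr_def Idm_in preadditive_category_axioms)

lemma sg_in: "(\<And>n. cob X n \<in> Ob C) \<Longrightarrow> sg X \<in> gHom C (cob X) (-1) (cob (shift_cplx C X))"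
  and tg_in: "(\<And>n. cob X n \<in> Ob C) \<Longrightarrow> tg X \<in> gHom C (cob (shift_cplx C X)) 1 (cob X)"
  using gHomI[OF garr_sg[of X]] gHomI[OF garr_tg[of X]] by (simp_all add: sg_def tg_def)

lemma sg_tg: assumes "\<And>n. cob X n \<in> Ob C"
  shows "sg X * tg X = gid C (cob (shift_cplx C X))" "tg X * sg X = gid C (cob X)"
  using arr_mult[OF garr_sg[of X] garr_tg[of X]] arr_mult[OF garr_tg[of X] garr_sg[of X]] assms
  by (simp_all add: sg_def tg_def gid_def Idm_Idm)

lemma arr_shift:
  assumes f: "garr C (cob X) k f (cob Y)"
  shows "garr C (cob (shift_cplx C X)) k (\<lambda>n. f (n + 1)) (cob (shift_cplx C Y))"
    and "arr C (cob (shift_cplx C X)) k (\<lambda>n. f (n + 1)) (cob (shift_cplx C Y)) = sg Y * arr C (cob X) k f (cob Y) * tg X"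
proof -
  have ob: "\<And>n. cob X n \<in> Ob C" "\<And>n. cob Y n \<in> Ob C" and h: "\<And>n. f n \<in> Hom C (cob X n) (cob Y (n + k))"
    using f by (auto simp: garr_def)
  show *: "garr C (cob (shift_cplx C X)) k (\<lambda>n. f (n + 1)) (cob (shift_cplx C Y))"
  proof -
    have "f (n + 1) \<in> Hom C (cob X (n + 1)) (cob Y (n + k + 1))" for n
      using h[of "n + 1"] by (simp add: ac_simps)
    then show ?thesis using ob by (simp add: garr_def preadditive_category_axioms)
  qed
  have ft: "garr C (cob (shift_cplx C X)) (1 + k) (\<lambda>n. f (n + 1) \<cdot> Idm C (cob X (n + 1))) (cob Y)"
    by (rule garr_mult[OF f garr_tg[OF ob(1)]])
  have ft2: "(\<lambda>n. f (n + 1) \<cdot> Idm C (cob X (n + 1))) = (\<lambda>n. f (n + 1))"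
    using Idm_right[OF ob(1) ob(2) h] by auto
  have "arr C (cob X) k f (cob Y) * tg X = arr C (cob (shift_cplx C X)) (1 + k) (\<lambda>n. f (n + 1)) (cob Y)"
    using arr_mult[OF f garr_tg[OF ob(1)]] ft2 by (simp add: tg_def)
  moreover have "(\<lambda>n. Idm C (cob Y (n + (1 + k))) \<cdot> f (n + 1)) = (\<lambda>n. f (n + 1))"
    using Idm_left[OF ob(1) ob(2)] h by (intro ext) (metis add.assoc add.commute)
  ultimately show "arr C (cob (shift_cplx C X)) k (\<lambda>n. f (n + 1)) (cob (shift_cplx C Y)) = sg Y * arr C (cob X) k f (cob Y) * tg X"
    using arr_mult[OF garr_sg[OF ob(2)] ft[unfolded ft2]] by (simp add: sg_def mult.assoc)
qed

lemma df_shift: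
  assumes "X \<in> complexes C"
  shows "df C (shift_cplx C X) = - (sg X * df C X * tg X)"
    and "garr C (cob (shift_cplx C X)) 1 (cdf (shift_cplx C X)) (cob (shift_cplx C X))"
proof -
  have g: "garr C (cob X) 1 (cdf X) (cob X)" using assms by (simp add: complexes_iff)
  have e: "cdf (shift_cplx C X) = (\<lambda>n. Neg C (cdf X (n + 1)))" by auto
  show "garr C (cob (shift_cplx C X)) 1 (cdf (shift_cplx C X)) (cob (shift_cplx C X))"
    unfolding e by (rule garr_Neg[OF arr_shift(1)[OF g]])
  show "df C (shift_cplx C X) = - (sg X * df C X * tg X)"
    unfolding df_def e arr_Neg[OF arr_shift(1)[OF g]] arr_shift(2)[OF g] ..
qed

lemma shift_complexes: assumes "X \<in> complexes C" shows "shift_cplx C X \<in> complexes C"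
proof -
  have "tg X * (sg X * (df C X * tg X)) = df C X * tg X"
    using sg_tg(2)[of X] gid_left[OF df_in[OF assms]] assms
    by (metis complexes_ob mult.assoc)
  then have "df C (shift_cplx C X) * df C (shift_cplx C X) = sg X * (df C X * df C X) * tg X"
    by (simp add: df_shift assms mult.assoc)
  then show ?thesis
    unfolding complexes_iff using df_shift assms by (simp add: df_df)
qed

text \<open>The inverse shift negates the differential once more, and the two signs cancel.
  Surjectivity is what turns invariance of a class under the shift into equality with its
  image.\<close>

lemma shift_surj:
  assumes "X \<in> complexes C"
  obtains X' where "X' \<in> complexes C" "shift_cplx C X' = X"
proof -
  let ?X' = "Cplx (\<lambda>n. cob X (n - 1)) (\<lambda>n. Neg C (cdf X (n - 1)))"
  have h: "\<And>n. cob X n \<in> Ob C" "\<And>n. cdf X n \<in> Hom C (cob X n) (cob X (n + 1))"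
    using assms by (auto simp: complexes_def)
  have h': "cdf X (n - 1) \<in> Hom C (cob X (n - 1)) (cob X n)" for n using h(2)[of "n - 1"] by simp
  have "shift_cplx C ?X' = X"
    using Neg_Neg[OF h(1) h(1) h(2)] by (cases X) (auto simp: shift_cplx_def)
  moreover have "garr C (cob ?X') 1 (cdf ?X') (cob ?X')"
    using h h' by (simp add: garr_def preadditive_category_axioms Neg_in)
  moreover have "df C ?X' * df C ?X' = 0"
  proof -
    have "garr C (cob ?X') 1 (\<lambda>n. cdf X (n - 1)) (cob ?X')"
      using h h' by (simp add: garr_def preadditive_category_axioms)
    note this arr_Neg[OF this]
    moreover from this have "df C ?X' * df C ?X' = arr C (cob ?X') 2 (\<lambda>n. cdf X (n + 1 - 1) \<cdot> cdf X (n - 1)) (cob ?X')"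
      using arr_mult[of "cob ?X'" 1 "\<lambda>n. cdf X (n - 1)" "cob ?X'" "cob ?X'" 1 "\<lambda>n. cdf X (n - 1)"]
      by (simp add: df_def)
    moreover have "(\<lambda>n. cdf X (n + 1 - 1) \<cdot> cdf X (n - 1)) = (\<lambda>n. Zro C (cob ?X' n) (cob ?X' (n + 2)))"
    proof
      fix n
      have "cdf X (n - 1 + 1) \<cdot> cdf X (n - 1) = Zro C (cob X (n - 1)) (cob X (n - 1 + 2))"
        using assms unfolding complexes_def by blast
      moreover have "n - 1 + 2 = n + 2 - 1" by simp
      ultimately show "cdf X (n + 1 - 1) \<cdot> cdf X (n - 1) = Zro C (cob ?X' n) (cob ?X' (n + 2))"
        by simp
    qed
    ultimately show ?thesis using arr_Zro[of "cob ?X'" "cob ?X'" 2] h by simp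
  qed
  ultimately show ?thesis using that[of ?X'] by (simp add: complexes_iff)
qed

end

section \<open>Mapping cones in matrix form\<close>

context preadditive_category
begin

lemma nul_cmap:
  assumes "X \<in> complexes C" "Y \<in> complexes C" "nul C X Y a" shows "a \<in> cmap C X Y"
proof -
  obtain h where h: "h \<in> gHom C (cob X) (-1) (cob Y)" "a = df C Y * h + h * df C X"
    using assms(3) by (auto simp: nul_def)
  have "df C Y * h \<in> gHom C (cob X) 0 (cob Y)" "h * df C X \<in> gHom C (cob X) 0 (cob Y)"
    using gHom_mult[OF df_in h(1)] gHom_mult[OF h(1) df_in] assms by auto
  then show ?thesis
    using h(2) assms by (simp add: cmap_def gHom_add algebra_simps df_df mult_ext[OF df_df])
qed

end

text \<open>A cone with its injections and projections as ring elements. Through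
  \<open>a * tg X\<close>, a degree 1 map from the shift of \<open>X\<close> to \<open>Y\<close>,
  the differential becomes a triangular matrix. About the differential of \<open>M\<close> only this
  shape and its typing are assumed; that it squares to zero is derived.\<close>

locale mapping_cone = preadditive_category C
  for C :: "('o, 'm, 'z) preadd_scheme" (structure) +
  fixes X Y M :: "('o, 'm) cplx" and a I J P Q :: "('o, 'm, 'z) vec endo"
  assumes X: "X \<in> complexes C" and Y: "Y \<in> complexes C"
    and garr_M: "garr C (cob M) 1 (cdf M) (cob M)"
    and a: "a \<in> cmap C X Y"
    and I: "I \<in> gHom C (cob (shift_cplx C X)) 0 (cob M)" and J: "J \<in> gHom C (cob Y) 0 (cob M)"
    and P: "P \<in> gHom C (cob M) 0 (cob (shift_cplx C X))" and Q: "Q \<in> gHom C (cob M) 0 (cob Y)"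
    and PI: "P * I = gid C (cob (shift_cplx C X))" and QJ: "Q * J = gid C (cob Y)"
    and PJ: "P * J = 0" and QI: "Q * I = 0" and IPJQ: "I * P + J * Q = gid C (cob M)"
    and dM: "df C M = I * df C (shift_cplx C X) * P + J * (a * tg X) * P + J * df C Y * Q"
begin

lemma S: "shift_cplx C X \<in> complexes C"
  by (rule shift_complexes[OF X])

lemmas sg_X = sg_in[of X, OF complexes_ob[OF X]] and tg_X = tg_in[of X, OF complexes_ob[OF X]]
  and sg_tg_X = sg_tg[of X, OF complexes_ob[OF X]]

lemma df_M_in: "df C M \<in> gHom C (cob M) 1 (cob M)"
  by (simp add: df_def gHomI garr_M)

lemmas gid_rules =
  gid_left[OF I] gid_left[OF J] gid_left[OF P] gid_left[OF Q] gid_left[OF sg_X] gid_left[OF tg_X]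
  gid_left[OF cmap_in[OF a]] gid_left[OF df_in[OF X]] gid_left[OF df_in[OF Y]] gid_left[OF df_in[OF S]]
  gid_left[OF df_M_in]
  gid_right[OF I] gid_right[OF J] gid_right[OF P] gid_right[OF Q] gid_right[OF sg_X] gid_right[OF tg_X]
  gid_right[OF cmap_in[OF a]] gid_right[OF df_in[OF X]] gid_right[OF df_in[OF Y]] gid_right[OF df_in[OF S]]
  gid_right[OF df_M_in]

lemmas incl_proj = PI QJ PJ QI sg_tg_X gid_rules PI[THEN mult_ext] QJ[THEN mult_ext]
  PJ[THEN mult_ext] QI[THEN mult_ext] sg_tg_X[THEN mult_ext] gid_rules[THEN mult_ext]

lemma dM_I: "df C M * I = I * df C (shift_cplx C X) + J * (a * tg X)"
  and dM_J: "df C M * J = J * df C Y"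
  and P_dM: "P * df C M = df C (shift_cplx C X) * P"
  and Q_dM: "Q * df C M = a * (tg X * P) + df C Y * Q"
  unfolding dM by (simp_all add: algebra_simps incl_proj)

lemma dS_sg: "df C (shift_cplx C X) * sg X = - (sg X * df C X)"
  and tg_dS: "tg X * df C (shift_cplx C X) = - (df C X * tg X)"
  by (simp_all add: df_shift[OF X] algebra_simps incl_proj)

lemmas a_df = cmap_df[OF a]

text \<open>The diagonal terms vanish because the shift of \<open>X\<close> and \<open>Y\<close> are
  complexes. The two mixed terms cancel because \<open>a\<close> commutes with the differentials
  while \<open>tg X\<close> anticommutes with them.\<close>

lemma M: "M \<in> complexes C"
proof -
  have "df C M * df C M = 0"
    unfolding dM by (simp add: algebra_simps incl_proj df_df[OF S] df_df[OF Y] mult_ext[OF df_df[OF S]]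
      mult_ext[OF df_df[OF Y]] mult_ext[OF tg_dS] mult_ext[OF a_df])
  with garr_M show ?thesis by (simp add: complexes_iff)
qed

lemma J_cmap: "J \<in> cmap C Y M"
  by (simp add: cmap_def J dM_J)

lemma P_cmap: "P \<in> cmap C M (shift_cplx C X)"
  by (simp add: cmap_def P P_dM)

lemma IP_expand: "g = g * I * P + g * J * Q" if "g \<in> gHom C (cob M) k Z"
  using gid_right[OF that] unfolding IPJQ[symmetric] by (simp add: algebra_simps)

lemma IP_expand': "g = I * (P * g) + J * (Q * g)" if "g \<in> gHom C Z k (cob M)"
  using gid_left[OF that] unfolding IPJQ[symmetric] by (simp add: algebra_simps)

text \<open>The long exact Hom sequence by hand: a null-homotopy \<open>h\<close> of
  \<open>g * J\<close> extends to \<open>M\<close> as \<open>h * Q\<close>. After subtracting its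
  boundary \<open>u\<close> the map vanishes on \<open>J\<close>, hence factors through
  \<open>P\<close> as a chain map from the shift of \<open>X\<close>, which is
  null-homotopic.\<close>

lemma orth_cone_left:
  assumes T: "T \<in> complexes C" and "orth C (shift_cplx C X) T" "orth C Y T"
  shows "orth C M T"
  unfolding orth_def
proof
  fix g assume g: "g \<in> cmap C M T"
  have "nul C Y T (g * J)" using assms(3) cmap_mult[OF g J_cmap] by (simp add: orth_def)
  then obtain h where h: "h \<in> gHom C (cob Y) (-1) (cob T)" "g * J = df C T * h + h * df C Y"
    by (auto simp: nul_def)
  define u where "u = df C T * (h * Q) + (h * Q) * df C M"
  have u: "nul C M T u"
    unfolding u_def by (rule nulI[OF _ refl], rule gHom_mult[OF h(1) Q]) simp
  have k: "g - u \<in> cmap C M T"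
    by (rule cmap_minus[OF g nul_cmap[OF M T u]])
  have kJ: "(g - u) * J = 0"
    unfolding u_def using gid_right[OF h(1)] h(2) by (simp add: algebra_simps dM_J incl_proj)
  have "df C T * ((g - u) * I) = (g - u) * (df C M * I)"
    using cmap_df[OF k] by (metis mult.assoc)
  also have "\<dots> = (g - u) * I * df C (shift_cplx C X)"
    using mult_ext[OF kJ] by (simp only: dM_I distrib_left mult.assoc mult_zero_left add_0_right)
  finally have "(g - u) * I \<in> cmap C (shift_cplx C X) T"
    using gHom_mult[OF cmap_in[OF k] I] by (simp add: cmap_def)
  then have "nul C (shift_cplx C X) T ((g - u) * I)" using assms(2) by (simp add: orth_def)
  then have "nul C M T ((g - u) * I * P + u)"
    by (intro nul_add u nul_right[OF P_cmap])
  moreover have "(g - u) * I * P = g - u"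
    using IP_expand[OF cmap_in[OF k]] kJ by simp
  ultimately show "nul C M T g" by simp
qed

text \<open>Dually, the boundary of \<open>I * h\<close> removes the \<open>P\<close>-component of
  \<open>g\<close>; the rest factors through \<open>J\<close>.\<close>

lemma orth_cone_right:
  assumes T: "T \<in> complexes C" and "orth C T (shift_cplx C X)" "orth C T Y"
  shows "orth C T M"
  unfolding orth_def
proof
  fix g assume g: "g \<in> cmap C T M"
  have "nul C T (shift_cplx C X) (P * g)" using assms(2) cmap_mult[OF P_cmap g] by (simp add: orth_def)
  then obtain h where h: "h \<in> gHom C (cob T) (-1) (cob (shift_cplx C X))"
      "P * g = df C (shift_cplx C X) * h + h * df C T"
    by (auto simp: nul_def)
  define u where "u = df C M * (I * h) + (I * h) * df C T"
  have u: "nul C T M u"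
    unfolding u_def by (rule nulI[OF _ refl], rule gHom_mult[OF I h(1)]) simp
  have k: "g - u \<in> cmap C T M"
    by (rule cmap_minus[OF g nul_cmap[OF T M u]])
  have Pk: "P * (g - u) = 0"
    unfolding u_def using gid_left[OF h(1)] h(2) by (simp add: algebra_simps P_dM mult_ext[OF P_dM] incl_proj mult_ext[OF gid_left[OF h(1)]])
  have "Q * (g - u) * df C T = (Q * df C M) * (g - u)"
    using cmap_df[OF k] by (metis mult.assoc)
  also have "\<dots> = df C Y * (Q * (g - u))"
    unfolding Q_dM by (simp only: distrib_right mult.assoc Pk mult_zero_right add_0_left)
  finally have "Q * (g - u) \<in> cmap C T Y"
    using gHom_mult[OF Q cmap_in[OF k]] by (simp add: cmap_def)
  then have "nul C T Y (Q * (g - u))" using assms(3) by (simp add: orth_def)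
  then have "nul C T M (J * (Q * (g - u)) + u)"
    by (intro nul_add u nul_left[OF J_cmap])
  moreover have "J * (Q * (g - u)) = g - u"
    using IP_expand'[OF cmap_in[OF k]] Pk by simp
  ultimately show "nul C T M g" by simp
qed

text \<open>The two components of a null-homotopy \<open>h\<close> of \<open>J\<close> are what is
  wanted: \<open>P * h\<close>, moved back to \<open>X\<close> by \<open>tg X\<close>, is the
  homotopy section, and \<open>Q * h\<close> is up to sign the homotopy that proves it.\<close>

lemma section_of_nul_J:
  assumes "nul C Y M J"
  obtains r where "r \<in> cmap C Y X" "nul C Y Y (a * r - gid C (cob Y))"
proof -
  obtain h where h: "h \<in> gHom C (cob Y) (-1) (cob M)" "J = df C M * h + h * df C Y"
    using assms by (auto simp: nul_def)
  have Ph: "P * h \<in> gHom C (cob Y) (-1) (cob (shift_cplx C X))" and Qh: "Q * h \<in> gHom C (cob Y) (-1) (cob Y)"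
    by (rule gHom_mult[OF _ h(1)], rule P Q, simp)+
  have "P * J = P * df C M * h + P * h * df C Y" using h(2) by (simp add: algebra_simps)
  then have "0 = tg X * (df C (shift_cplx C X) * P * h + P * h * df C Y)"
    by (simp add: PJ P_dM)
  then have "df C X * (tg X * (P * h)) = tg X * (P * h) * df C Y"
    by (simp add: algebra_simps mult_ext[OF tg_dS])
  then have r: "tg X * (P * h) \<in> cmap C Y X"
    using gHom_mult[OF tg_X Ph] by (simp add: cmap_def)
  have "Q * J = Q * df C M * h + Q * h * df C Y" using h(2) by (simp add: algebra_simps)
  then have "a * (tg X * (P * h)) - gid C (cob Y) = - (df C Y * (Q * h) + Q * h * df C Y)"
    by (simp add: QJ Q_dM algebra_simps)
  then have "nul C Y Y (a * (tg X * (P * h)) - gid C (cob Y))"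
    using nul_uminus[OF nulI[OF Qh refl]] by simp
  with r that show ?thesis by blast
qed

text \<open>Dual to the preceding lemma: \<open>h * J\<close> gives the homotopy retraction of
  \<open>a\<close>, and \<open>h * I\<close>, conjugated back to \<open>X\<close>, gives the
  homotopy.\<close>

lemma retraction_of_nul_P:
  assumes "nul C M (shift_cplx C X) P"
  obtains r where "r \<in> cmap C Y X" "nul C X X (r * a - gid C (cob X))"
proof -
  obtain h where h: "h \<in> gHom C (cob M) (-1) (cob (shift_cplx C X))"
      "P = df C (shift_cplx C X) * h + h * df C M"
    using assms by (auto simp: nul_def)
  have hI: "h * I \<in> gHom C (cob (shift_cplx C X)) (-1) (cob (shift_cplx C X))"
    and hJ: "h * J \<in> gHom C (cob Y) (-1) (cob (shift_cplx C X))"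
    by (rule gHom_mult[OF h(1)], rule I J, simp)+
  have "P * J = df C (shift_cplx C X) * h * J + h * (df C M * J)" using h(2) by (simp add: algebra_simps)
  then have "0 = tg X * (df C (shift_cplx C X) * h * J + h * (J * df C Y))"
    by (simp add: PJ dM_J)
  then have "df C X * (tg X * (h * J)) = tg X * (h * J) * df C Y"
    by (simp add: algebra_simps mult_ext[OF tg_dS])
  then have r: "tg X * (h * J) \<in> cmap C Y X"
    using gHom_mult[OF tg_X hJ] by (simp add: cmap_def)
  have "P * I = df C (shift_cplx C X) * h * I + h * (df C M * I)" using h(2) by (simp add: algebra_simps)
  then have "tg X * (gid C (cob (shift_cplx C X)) * sg X) = tg X * ((df C (shift_cplx C X) * h * I + h * (df C M * I)) * sg X)"
    by (simp add: PI)
  then have "tg X * (h * J) * a - gid C (cob X)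
      = df C X * (tg X * (h * I) * sg X) + (tg X * (h * I) * sg X) * df C X"
    by (simp add: dM_I algebra_simps incl_proj mult_ext[OF tg_dS] dS_sg)
  moreover have "tg X * (h * I) * sg X \<in> gHom C (cob X) (-1) (cob X)"
    by (rule gHom_mult[OF gHom_mult[OF tg_X hI refl] sg_X]) simp
  ultimately have "nul C X X (tg X * (h * J) * a - gid C (cob X))"
    by (intro nulI)
  with r that show ?thesis by blast
qed

text \<open>The contraction is the strict inverse \<open>b\<close>, placed in the matrix corner that
  leads from \<open>Y\<close> back to the shift of \<open>X\<close>; \<open>sg X\<close> supplies
  the degree -1.\<close>

lemma contr_cone_of_iso:
  assumes b: "b \<in> cmap C Y X" and ab: "a * b = gid C (cob Y)" and ba: "b * a = gid C (cob X)"
  shows "contr C M"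
  unfolding contr_def
proof (rule nulI)
  have "I * sg X * b \<in> gHom C (cob Y) (-1) (cob M)"
    by (rule gHom_mult[OF gHom_mult[OF I sg_X refl] cmap_in[OF b]]) simp
  from gHom_mult[OF this Q refl] show "I * sg X * b * Q \<in> gHom C (cob M) (-1) (cob M)" by simp
  note cmap_df[OF b, symmetric]
  then show "gid C (cob M) = df C M * (I * sg X * b * Q) + (I * sg X * b * Q) * df C M"
    unfolding IPJQ[symmetric]
    by (simp add: algebra_simps mult_ext[OF dM_I] Q_dM incl_proj ab ba ab[THEN mult_ext] ba[THEN mult_ext]
      mult_ext[OF dS_sg] mult_ext[OF cmap_df[OF b, symmetric]])
qed

end

context preadditive_category
begin

lemma mapping_cone_of_is_cone:
  assumes "is_cone C X Y f M i j p q"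
  shows "mapping_cone C X Y M (mp C X Y f)
    (arr C (cob (shift_cplx C X)) 0 i (cob M)) (arr C (cob Y) 0 j (cob M))
    (arr C (cob M) 0 p (cob (shift_cplx C X))) (arr C (cob M) 0 q (cob Y))"
proof -
  let ?S = "shift_cplx C X"
  have X: "X \<in> complexes C" and Y: "Y \<in> complexes C" and f: "f \<in> chain_maps C X Y"
    and bp: "\<And>n. is_biproduct C (cob X (n + 1)) (cob Y n) (cob M n) (i n) (j n) (p n) (q n)"
    and d: "cdf M = (\<lambda>n. (i (n + 1) \<cdot> cdf ?S n \<cdot> p n) \<oplus> (j (n + 1) \<cdot> f (n + 1) \<cdot> p n) \<oplus>
          (j (n + 1) \<cdot> cdf Y n \<cdot> q n))"
    using assms by (auto simp: is_cone_def)
  have ob: "\<And>n. cob X n \<in> Ob C" "\<And>n. cob Y n \<in> Ob C" "\<And>n. cob M n \<in> Ob C"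
    using X Y bp by (auto simp: complexes_ob is_biproduct_def)
  have gi: "garr C (cob ?S) 0 i (cob M)" and gj: "garr C (cob Y) 0 j (cob M)"
    and gp: "garr C (cob M) 0 p (cob ?S)" and gq: "garr C (cob M) 0 q (cob Y)"
    using bp ob by (auto simp: is_biproduct_def garr_def preadditive_category_axioms)
  have gS: "garr C (cob ?S) 1 (cdf ?S) (cob ?S)" by (rule df_shift(2)[OF X])
  have gY: "garr C (cob Y) 1 (cdf Y) (cob Y)" using Y by (simp add: complexes_iff)
  have gf: "garr C (cob ?S) 1 (\<lambda>n. f (n + 1)) (cob Y)" and f_tg: "mp C X Y f * tg X = arr C (cob ?S) 1 (\<lambda>n. f (n + 1)) (cob Y)"
  proof -
    have fX: "garr C (cob X) 0 f (cob Y)" by (rule chain_maps_garr[OF X Y f])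
    then have h: "f (n + 1) \<in> Hom C (cob X (n + 1)) (cob Y (n + 1))" for n by (simp add: garr_def)
    then show "garr C (cob ?S) 1 (\<lambda>n. f (n + 1)) (cob Y)" using ob by (simp add: garr_def preadditive_category_axioms)
    show "mp C X Y f * tg X = arr C (cob ?S) 1 (\<lambda>n. f (n + 1)) (cob Y)"
      using arr_mult[OF fX garr_tg[OF ob(1)]] Idm_right[OF ob(1) ob(2) h] by (simp add: mp_def tg_def)
  qed
  have comp: "garr C (cob M) 1 (\<lambda>n. k (n + 1) \<cdot> g n \<cdot> l n) (cob M)"
    "arr C A' 0 k (cob M) * arr C A 1 g A' * arr C (cob M) 0 l A = arr C (cob M) 1 (\<lambda>n. k (n + 1) \<cdot> g n \<cdot> l n) (cob M)"
    if "garr C A' 0 k (cob M)" "garr C A 1 g A'" "garr C (cob M) 0 l A" for k g l A A'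
  proof -
    have gl: "garr C (cob M) 1 (\<lambda>n. g n \<cdot> l n) A'" using garr_mult[OF that(2,3)] by simp
    show "garr C (cob M) 1 (\<lambda>n. k (n + 1) \<cdot> g n \<cdot> l n) (cob M)" using garr_mult[OF that(1) gl] by simp
    show "arr C A' 0 k (cob M) * arr C A 1 g A' * arr C (cob M) 0 l A = arr C (cob M) 1 (\<lambda>n. k (n + 1) \<cdot> g n \<cdot> l n) (cob M)"
      using arr_mult[OF that(2,3)] arr_mult[OF that(1) gl] by (simp add: mult.assoc)
  qed
  note c1 = comp[OF gi gS gp] and c2 = comp[OF gj gf gp] and c3 = comp[OF gj gY gq]
  have gM: "garr C (cob M) 1 (cdf M) (cob M)"
    unfolding d by (rule garr_add[OF garr_add[OF c1(1) c2(1)] c3(1)])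
  have "df C M = arr C (cob M) 1 (\<lambda>n. i (n + 1) \<cdot> cdf ?S n \<cdot> p n) (cob M)
    + arr C (cob M) 1 (\<lambda>n. j (n + 1) \<cdot> f (n + 1) \<cdot> p n) (cob M)
    + arr C (cob M) 1 (\<lambda>n. j (n + 1) \<cdot> cdf Y n \<cdot> q n) (cob M)"
    unfolding df_def d arr_add[OF c1(1) c2(1)] arr_add[OF garr_add[OF c1(1) c2(1)] c3(1)] ..
  then have dM: "df C M = arr C (cob ?S) 0 i (cob M) * df C ?S * arr C (cob M) 0 p (cob ?S)
    + arr C (cob Y) 0 j (cob M) * (mp C X Y f * tg X) * arr C (cob M) 0 p (cob ?S)
    + arr C (cob Y) 0 j (cob M) * df C Y * arr C (cob M) 0 q (cob Y)"
    unfolding c1(2)[symmetric] c2(2)[symmetric] c3(2)[symmetric] f_tg by (simp add: df_def)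
  have bpr: "p n \<cdot> i n = Idm C (cob X (n + 1))" "q n \<cdot> j n = Idm C (cob Y n)"
     "p n \<cdot> j n = Zro C (cob Y n) (cob X (n + 1))" "q n \<cdot> i n = Zro C (cob X (n + 1)) (cob Y n)"
     "(i n \<cdot> p n) \<oplus> (j n \<cdot> q n) = Idm C (cob M n)" for n
    using bp[of n] by (auto simp: is_biproduct_def)
  show ?thesis
  proof (unfold_locales, goal_cases)
    case 1 show ?case by (rule X)
  next
    case 2 show ?case by (rule Y)
  next
    case 3 show ?case by (rule gM)
  next
    case 4 show ?case by (rule chain_maps_mp[OF X Y f])
  next
    case 9 show ?case using arr_mult[OF gp gi] by (simp add: bpr gid_def)
  next
    case 10 show ?case using arr_mult[OF gq gj] by (simp add: bpr gid_def)
  next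
    case 11 show ?case using arr_mult[OF gp gj] arr_Zro[of "cob Y" "cob ?S" 0] by (simp add: bpr ob)
  next
    case 12 show ?case using arr_mult[OF gq gi] arr_Zro[of "cob ?S" "cob Y" 0] by (simp add: bpr ob)
  next
    case 13 show ?case
      using arr_mult[OF gi gp] arr_mult[OF gj gq] arr_add[OF garr_mult[OF gi gp] garr_mult[OF gj gq]]
      by (simp add: bpr gid_def)
  next
    case 14 show ?case by (rule dM)
  qed (intro gHomI gi gj gp gq)+
qed

text \<open>Rotation of triangles: \<open>M'\<close> is the desuspended cone of \<open>a\<close>, and \<open>B\<close> is the cone of \<open>M' \<rightarrow> X\<close>.\<close>

lemma rotated_cone:
  assumes "mapping_cone C X Y M a I J P Q" and M': "M' \<in> complexes C" "shift_cplx C M' = M"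
    and "mapping_cone C M' X B (tg X * P * sg M') I' J' P' Q'"
  shows "heq C B Y"
proof -
  interpret c: mapping_cone C X Y M a I J P Q by fact
  interpret b: mapping_cone C M' X B "tg X * P * sg M'" I' J' P' Q' by fact
  note sh = b.dM[unfolded M'(2)]
  \<comment> \<open>As a graded object \<open>B\<close> consists of the shift of \<open>X\<close>,
    of \<open>Y\<close> and of \<open>X\<close>, where the first two make up \<open>M\<close>. The
    parts coming from \<open>X\<close> cancel up to homotopy. \<open>?iota\<close> includes
    \<open>Y\<close>, and the term \<open>a * Q'\<close> corrects the projection to \<open>Y\<close>
    so that it becomes a chain map.\<close>
  let ?phi = "Q * P' - a * Q'" and ?iota = "I' * J"
  have IJ: "I' \<in> gHom C (cob M) 0 (cob B)" "P' \<in> gHom C (cob B) 0 (cob M)"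
    using b.I b.P M'(2) by simp_all
  have st: "sg M' * tg M' = gid C (cob M)" using b.sg_tg_X M' by simp
  have P'I': "P' * I' = gid C (cob M)" using b.PI M' by simp
  have P'dB: "P' * df C B = df C M * P'" using b.P_dM M'(2) by simp
  have Q'dB: "Q' * df C B = tg X * (P * P') + df C X * Q'"
    using b.Q_dM by (simp add: mult.assoc mult_ext[OF st] mult_ext[OF gid_left[OF IJ(2)]] gid_left[OF IJ(2)])
  have dB_I': "df C B * I' = I' * df C M + J' * (tg X * P)"
    using b.dM_I M'(2) by (simp add: mult.assoc st c.gid_rules)
  note rules = algebra_simps P'dB mult_ext[OF P'dB] Q'dB dB_I' mult_ext[OF dB_I'] c.incl_proj 
    b.PJ b.QJ b.QI b.PJ[THEN mult_ext] b.QJ[THEN mult_ext] b.QI[THEN mult_ext] b.dM_J mult_ext[OF b.dM_J]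
    P'I' mult_ext[OF P'I'] c.Q_dM mult_ext[OF c.Q_dM] c.dM_J mult_ext[OF c.dM_J] c.dM_I mult_ext[OF c.dM_I]
    c.P_dM mult_ext[OF c.P_dM] c.dS_sg mult_ext[OF c.dS_sg] c.a_df mult_ext[OF c.a_df]
  have phi: "?phi \<in> cmap C B Y"
    unfolding cmap_def
  proof (safe)
    show "?phi \<in> gHom C (cob B) 0 (cob Y)"
      by (intro gHom_minus) (rule gHom_mult[OF c.Q IJ(2)] gHom_mult[OF cmap_in[OF c.a] b.Q], simp)+
    show "df C Y * ?phi = ?phi * df C B" by (simp add: rules)
  qed
  have iota: "?iota \<in> cmap C Y B"
    unfolding cmap_def
  proof (safe)
    show "?iota \<in> gHom C (cob Y) 0 (cob B)"
      by (rule gHom_mult[OF IJ(1) c.J]) simp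
    show "df C B * ?iota = ?iota * df C Y" by (simp add: rules)
  qed
  have "?phi * ?iota = gid C (cob Y)" by (simp add: rules)
  moreover have "nul C B B (?iota * ?phi - gid C (cob B))"
  proof -
    \<comment> \<open>The homotopy carries the summand \<open>X\<close> identically onto the summand
      that is its shift.\<close>
    have "- (?iota * ?phi - gid C (cob B)) = df C B * (I' * I * sg X * Q') + (I' * I * sg X * Q') * df C B"
    proof -
      have "I' * (I * P + J * Q) * P' = I' * P'" using c.IPJQ gid_left[OF IJ(2)] by (simp add: mult.assoc)
      then show ?thesis unfolding b.IPJQ[symmetric] by (simp add: rules gid_left[OF b.Q])
    qed
    moreover have "I' * I * sg X * Q' \<in> gHom C (cob B) (-1) (cob B)"
      by (rule gHom_mult[OF gHom_mult[OF gHom_mult[OF IJ(1) c.I refl] c.sg_X refl] b.Q]) simp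
    ultimately have "nul C B B (- (?iota * ?phi - gid C (cob B)))" by (intro nulI)
    then show ?thesis using nul_uminus by fastforce
  qed
  ultimately show ?thesis
    unfolding heq_def using nul_0[OF c.Y c.Y]
    by (intro bexI[OF _ phi] bexI[OF _ iota] conjI) simp_all
qed

end

locale standard_cone = preadditive_category C
  for C :: "('o, 'm, 'z) preadd_scheme" (structure) +
  fixes X Y :: "('o, 'm) cplx" and f :: "int \<Rightarrow> 'm" and M :: "('o, 'm) cplx" and i j p q :: "int \<Rightarrow> 'm"
  assumes cone: "is_cone C X Y f M i j p q"

sublocale standard_cone \<subseteq> mapping_cone C X Y M "mp C X Y f"
    "arr C (cob (shift_cplx C X)) 0 i (cob M)" "arr C (cob Y) 0 j (cob M)"
    "arr C (cob M) 0 p (cob (shift_cplx C X))" "arr C (cob M) 0 q (cob Y)"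
  by (rule mapping_cone_of_is_cone[OF cone])

section \<open>Orthogonal pairs and stable t-structures\<close>

definition left_perp :: "('o, 'm, 'z) preadd_scheme \<Rightarrow> ('o, 'm) cplx set \<Rightarrow> ('o, 'm) cplx set" where
  "left_perp C V = {X \<in> complexes C. \<forall>T\<in>V. orth C X T}"

definition right_perp :: "('o, 'm, 'z) preadd_scheme \<Rightarrow> ('o, 'm) cplx set \<Rightarrow> ('o, 'm) cplx set" where
  "right_perp C U = {X \<in> complexes C. \<forall>T\<in>U. orth C T X}"

section \<open>The shift on chain maps, homotopies and orthogonality\<close>

context preadditive_category
begin

lemma shift_conj_rules:
  assumes "X \<in> complexes C"
  shows "sg X * df C X = - (df C (shift_cplx C X) * sg X)"
    and "df C X * tg X = - (tg X * df C (shift_cplx C X))"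
    and "tg X * sg X = gid C (cob X)" and "sg X * tg X = gid C (cob (shift_cplx C X))"
    and "\<And>a k Y. a \<in> gHom C (cob X) k Y \<Longrightarrow> a * tg X * sg X = a"
    and "\<And>a k Y. a \<in> gHom C (cob (shift_cplx C X)) k Y \<Longrightarrow> a * sg X * tg X = a"
    and "\<And>a k Y. a \<in> gHom C Y k (cob X) \<Longrightarrow> tg X * (sg X * a) = a"
    and "\<And>a k Y. a \<in> gHom C Y k (cob (shift_cplx C X)) \<Longrightarrow> sg X * (tg X * a) = a"
proof -
  note ob = complexes_ob[OF assms]
  note st = sg_tg[of X, OF ob]
  show "tg X * sg X = gid C (cob X)" "sg X * tg X = gid C (cob (shift_cplx C X))" by (rule st)+
  show *: "a * tg X * sg X = a" if "a \<in> gHom C (cob X) k Y" for a k Y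
    using gid_right[OF that] st by (simp add: mult.assoc)
  show "a * sg X * tg X = a" if "a \<in> gHom C (cob (shift_cplx C X)) k Y" for a k Y
    using gid_right[OF that] st by (simp add: mult.assoc)
  show **: "tg X * (sg X * a) = a" if "a \<in> gHom C Y k (cob X)" for a k Y
    using gid_left[OF that] st by (simp add: mult.assoc[symmetric])
  show "sg X * (tg X * a) = a" if "a \<in> gHom C Y k (cob (shift_cplx C X))" for a k Y
    using gid_left[OF that] st by (simp add: mult.assoc[symmetric])
  have "sg X * df C X * tg X * sg X = sg X * df C X"
    using *[OF df_in[OF assms]] by (simp add: mult.assoc)
  then show "sg X * df C X = - (df C (shift_cplx C X) * sg X)"
    by (simp add: df_shift[OF assms])
  have "tg X * (sg X * (df C X * tg X)) = df C X * tg X"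
    using **[OF df_in[OF assms]] by (metis mult.assoc)
  then show "df C X * tg X = - (tg X * df C (shift_cplx C X))"
    by (simp add: df_shift[OF assms] mult.assoc)
qed

lemma cmap_shift:
  assumes X: "X \<in> complexes C" and T: "T \<in> complexes C" and a: "a \<in> cmap C X T"
  shows "sg T * a * tg X \<in> cmap C (shift_cplx C X) (shift_cplx C T)"
proof -
  note X' = shift_conj_rules[OF X] and T' = shift_conj_rules[OF T]
  have "df C (shift_cplx C T) * (sg T * a * tg X) = - (sg T * (df C T * a) * tg X)"
    by (simp only: T'(1)[THEN eq_neg_iff_add_eq_0[THEN iffD1], THEN eq_neg_iff_add_eq_0[THEN iffD2]] mult.assoc[symmetric])
      (simp add: T'(1))
  also have "\<dots> = sg T * a * tg X * df C (shift_cplx C X)"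
    using X'(2) by (simp add: cmap_df[OF a] mult.assoc)
  finally show ?thesis
    using gHom_mult[OF gHom_mult[OF sg_in cmap_in[OF a] refl] tg_in] X T
    by (simp add: cmap_def complexes_ob)
qed

lemma cmap_unshift:
  assumes X: "X \<in> complexes C" and T: "T \<in> complexes C"
    and a: "a \<in> cmap C (shift_cplx C X) (shift_cplx C T)"
  shows "tg T * a * sg X \<in> cmap C X T"
proof -
  note X' = shift_conj_rules[OF X] and T' = shift_conj_rules[OF T]
  have "df C T * (tg T * a * sg X) = - (tg T * (df C (shift_cplx C T) * a) * sg X)"
    using T'(2) by (simp add: mult.assoc[symmetric])
  also have "\<dots> = tg T * a * sg X * df C X"
    using X'(1) by (simp add: cmap_df[OF a] mult.assoc)
  finally show ?thesis
    using gHom_mult[OF gHom_mult[OF tg_in cmap_in[OF a] refl] sg_in] X T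
    by (simp add: cmap_def complexes_ob)
qed

lemma nul_unshift:
  assumes X: "X \<in> complexes C" and T: "T \<in> complexes C"
    and a: "nul C (shift_cplx C X) (shift_cplx C T) a"
  shows "nul C X T (tg T * a * sg X)"
proof -
  note X' = shift_conj_rules[OF X] and T' = shift_conj_rules[OF T]
  obtain h where h: "h \<in> gHom C (cob (shift_cplx C X)) (-1) (cob (shift_cplx C T))"
      "a = df C (shift_cplx C T) * h + h * df C (shift_cplx C X)"
    using a by (auto simp: nul_def)
  have "tg T * h * sg X \<in> gHom C (cob X) (-1) (cob T)"
    by (rule gHom_mult[OF gHom_mult[OF tg_in h(1) refl] sg_in]) (simp_all add: complexes_ob X T)
  \<comment> \<open>The sign in the shifted differential is absorbed by negating the conjugated
    homotopy.\<close>
  moreover have "tg T * a * sg X = df C T * - (tg T * h * sg X) + - (tg T * h * sg X) * df C X"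
    by (simp add: h(2) algebra_simps X'(1) T'(2) mult_ext[OF T'(2)])
  ultimately show ?thesis by (rule nulI[OF gHom_uminus])
qed

lemma nul_shift:
  assumes X: "X \<in> complexes C" and T: "T \<in> complexes C" and a: "nul C X T a"
  shows "nul C (shift_cplx C X) (shift_cplx C T) (sg T * a * tg X)"
proof -
  note X' = shift_conj_rules[OF X] and T' = shift_conj_rules[OF T]
  obtain h where h: "h \<in> gHom C (cob X) (-1) (cob T)" "a = df C T * h + h * df C X"
    using a by (auto simp: nul_def)
  have "sg T * h * tg X \<in> gHom C (cob (shift_cplx C X)) (-1) (cob (shift_cplx C T))"
    by (rule gHom_mult[OF gHom_mult[OF sg_in h(1) refl] tg_in]) (simp_all add: complexes_ob X T)
  moreover have "sg T * a * tg X = df C (shift_cplx C T) * - (sg T * h * tg X) + - (sg T * h * tg X) * df C (shift_cplx C X)"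
    by (simp add: h(2) algebra_simps X'(2) T'(1) mult_ext[OF T'(1)])
  ultimately show ?thesis by (rule nulI[OF gHom_uminus])
qed

text \<open>\<open>shift_hmor\<close> reindexes a whole class elementwise. Reindexing is a bijection
  on chain maps that preserves and reflects homotopy, by conjugation with \<open>sg\<close> and
  \<open>tg\<close>, so the result is again a full homotopy class.\<close>

lemma shift_hmor_hclass:
  assumes X: "X \<in> complexes C" and Y: "Y \<in> complexes C" and f: "f \<in> chain_maps C X Y"
  shows "shift_hmor C (hclass C X Y f) = hclass C (shift_cplx C X) (shift_cplx C Y) (\<lambda>n. f (n + 1))"
    (is "_ = hclass C ?X ?Y _")
proof -
  have unconj: "tg Y * (sg Y * a * tg X) * sg X = a" if "a \<in> gHom C (cob X) 0 (cob Y)" for a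
    using shift_conj_rules(5)[OF X that] shift_conj_rules(7)[OF Y that] by (simp add: mult.assoc)
  have mp_shift: "mp C ?X ?Y (\<lambda>n. k (n + 1)) = sg Y * mp C X Y k * tg X" if "garr C (cob X) 0 k (cob Y)" for k
    unfolding mp_def by (rule arr_shift(2)[OF that])
  have chain: "(\<lambda>n. k (n + 1)) \<in> chain_maps C ?X ?Y \<longleftrightarrow> k \<in> chain_maps C X Y"
    if k: "garr C (cob X) 0 k (cob Y)" for k
  proof -
    let ?k = "mp C X Y k"
    have kin: "?k \<in> gHom C (cob X) 0 (cob Y)" by (simp add: mp_def gHomI k)
    have "sg Y * ?k * tg X \<in> cmap C ?X ?Y \<longleftrightarrow> ?k \<in> cmap C X Y"
      using cmap_shift[OF X Y, of ?k] cmap_unshift[OF X Y, of "sg Y * ?k * tg X"] unconj[OF kin] by auto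
    moreover have "sg Y * ?k * tg X \<in> gHom C (cob ?X) 0 (cob ?Y)"
      using gHomI[OF arr_shift(1)[OF k]] mp_shift[OF k] by (simp add: mp_def)
    ultimately show ?thesis
      using k kin arr_shift(1)[OF k] X Y by (simp add: chain_maps_iff shift_complexes mp_shift cmap_def)
  qed
  have homot: "homotopic C ?X ?Y (\<lambda>n. f (n + 1)) (\<lambda>n. k (n + 1)) \<longleftrightarrow> homotopic C X Y f k"
    if k: "garr C (cob X) 0 k (cob Y)" for k
  proof -
    have fg: "garr C (cob X) 0 f (cob Y)" using assms chain_maps_garr by blast
    define a where "a = mp C X Y f - mp C X Y k"
    have "a \<in> gHom C (cob X) 0 (cob Y)" by (simp add: a_def mp_def gHom_minus gHomI k fg)
    then have "nul C ?X ?Y (sg Y * a * tg X) \<longleftrightarrow> nul C X Y a"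
      using nul_shift[OF X Y, of a] nul_unshift[OF X Y, of "sg Y * a * tg X"] unconj by auto
    moreover have "mp C ?X ?Y (\<lambda>n. f (n + 1)) - mp C ?X ?Y (\<lambda>n. k (n + 1)) = sg Y * a * tg X"
      by (simp add: a_def mp_shift k fg algebra_simps)
    ultimately show ?thesis
      using X Y k fg by (auto simp: homotopic_iff arr_shift(1) shift_complexes a_def)
  qed
  have "(\<lambda>k n. k (n + 1)) ` {k \<in> chain_maps C X Y. homotopic C X Y f k}
    = {k \<in> chain_maps C ?X ?Y. homotopic C ?X ?Y (\<lambda>n. f (n + 1)) k}" (is "?l = ?r")
  proof
    show "?l \<subseteq> ?r" using chain homot chain_maps_garr[OF X Y] by auto
    show "?r \<subseteq> ?l"
    proof
      fix k assume k: "k \<in> ?r"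
      define k' where "k' = (\<lambda>n. k (n - 1))"
      have kk: "k = (\<lambda>n. k' (n + 1))" by (simp add: k'_def)
      have kg: "k n \<in> Hom C (cob X (n + 1)) (cob Y (n + 1))" for n
        using k by (auto simp: chain_maps_def)
      have "garr C (cob X) 0 k' (cob Y)"
        using kg[of "_ - 1"] X Y by (simp add: garr_def k'_def complexes_ob preadditive_category_axioms)
      then have "k' \<in> {k \<in> chain_maps C X Y. homotopic C X Y f k}"
        using k chain homot unfolding kk by blast
      then show "k \<in> ?l" unfolding kk by blast
    qed
  qed
  then show ?thesis by (simp add: shift_hmor_def hclass_def)
qed

lemma orth_shift_iff:
  assumes X: "X \<in> complexes C" and T: "T \<in> complexes C"
  shows "orth C (shift_cplx C X) (shift_cplx C T) \<longleftrightarrow> orth C X T"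
proof -
  note X' = shift_conj_rules[OF X] and T' = shift_conj_rules[OF T]
  have 1: "tg T * (sg T * a * tg X) * sg X = a" if "a \<in> cmap C X T" for a
    using X'(5)[OF cmap_in[OF that]] T'(7)[OF cmap_in[OF that]] by (simp add: mult.assoc)
  have 2: "sg T * (tg T * a * sg X) * tg X = a" if "a \<in> cmap C (shift_cplx C X) (shift_cplx C T)" for a
    using X'(6)[OF cmap_in[OF that]] T'(8)[OF cmap_in[OF that]] by (simp add: mult.assoc)
  show ?thesis
    unfolding orth_def using 1 2 nul_shift[OF X T] nul_unshift[OF X T] cmap_shift[OF X T] cmap_unshift[OF X T]
    by metis
qed

text \<open>The identity is itself a chain map. In this form contractibility inherits its invariance
  under the shift from \<open>orth_shift_iff\<close>.\<close>

lemma contr_iff_orth: "X \<in> complexes C \<Longrightarrow> contr C X \<longleftrightarrow> orth C X X"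
  using contr_orth_left cmap_gid by (auto simp: contr_def orth_def)

lemma contr_shift_iff: "X \<in> complexes C \<Longrightarrow> contr C (shift_cplx C X) \<longleftrightarrow> contr C X"
  by (simp add: contr_iff_orth shift_complexes orth_shift_iff)

lemma shift_image_eq:
  assumes "S \<subseteq> complexes C" and "\<And>X. X \<in> complexes C \<Longrightarrow> shift_cplx C X \<in> S \<longleftrightarrow> X \<in> S"
  shows "shift_cplx C ` S = S"
proof (safe)
  show "shift_cplx C X \<in> S" if "X \<in> S" for X using assms that by blast
  show "X \<in> shift_cplx C ` S" if XS: "X \<in> S" for X
  proof -
    obtain X' where X': "X' \<in> complexes C" "shift_cplx C X' = X" using shift_surj[of X] assms(1) XS by blast
    then show ?thesis using assms(2)[of X'] XS by blast
  qed
qed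

lemma shift_left_perp:
  assumes V: "V \<subseteq> complexes C" and sV: "shift_cplx C ` V = V" and X: "X \<in> complexes C"
  shows "shift_cplx C X \<in> left_perp C V \<longleftrightarrow> X \<in> left_perp C V"
proof -
  have "(\<forall>T\<in>V. orth C (shift_cplx C X) T) \<longleftrightarrow> (\<forall>T\<in>shift_cplx C ` V. orth C (shift_cplx C X) T)"
    by (simp only: sV)
  also have "\<dots> \<longleftrightarrow> (\<forall>T\<in>V. orth C X T)" using X V by (auto simp: orth_shift_iff subset_iff)
  finally show ?thesis by (simp add: left_perp_def X shift_complexes)
qed

lemma shift_right_perp:
  assumes U: "U \<subseteq> complexes C" and sU: "shift_cplx C ` U = U" and X: "X \<in> complexes C"
  shows "shift_cplx C X \<in> right_perp C U \<longleftrightarrow> X \<in> right_perp C U"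
proof -
  have "(\<forall>T\<in>U. orth C T (shift_cplx C X)) \<longleftrightarrow> (\<forall>T\<in>shift_cplx C ` U. orth C T (shift_cplx C X))"
    by (simp only: sU)
  also have "\<dots> \<longleftrightarrow> (\<forall>T\<in>U. orth C T X)" using X U by (auto simp: orth_shift_iff subset_iff)
  finally show ?thesis by (simp add: right_perp_def X shift_complexes)
qed

lemma standard_triangle_distinguished:
  assumes cone: "is_cone C X Y f M i j p q"
  shows "(X, Y, M, hclass C X Y f, hclass C Y M j, hclass C M (shift_cplx C X) p) \<in> Triangles (K C)"
proof -
  interpret standard_cone C X Y f M i j p q by unfold_locales (rule cone)
  have f: "f \<in> chain_maps C X Y" using cone by (simp add: is_cone_def)
  have ob: "\<And>n. cob X n \<in> Ob C" "\<And>n. cob Y n \<in> Ob C" using X Y complexes_ob by auto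
  have "is_biproduct C (cob X (n + 1)) (cob Y n) (cob M n) (i n) (j n) (p n) (q n)" for n
    using cone by (auto simp: is_cone_def)
  then have "garr C (cob Y) 0 j (cob M)" "garr C (cob M) 0 p (cob (shift_cplx C X))"
    using ob by (auto simp: garr_def is_biproduct_def preadditive_category_axioms)
  then have j: "j \<in> chain_maps C Y M" and p: "p \<in> chain_maps C M (shift_cplx C X)"
    using dM_J P_dM S by (simp_all add: chain_maps_iff X Y M mp_def)
  have unit: "Cmp (K C) (Idm (K C) B) (hclass C A B g) = hclass C A B g"
      "Cmp (K C) (hclass C A B g) (Idm (K C) A) = hclass C A B g"
    if "A \<in> complexes C" "B \<in> complexes C" "g \<in> chain_maps C A B" for A B g
  proof -
    have h: "g n \<in> Hom C (cob A n) (cob B n)" for n using that by (simp add: chain_maps_def)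
    show "Cmp (K C) (Idm (K C) B) (hclass C A B g) = hclass C A B g"
      using that Idm_left[OF _ _ h] by (simp add: K_sel(3) K_Cmp chain_maps_Idm complexes_ob)
    show "Cmp (K C) (hclass C A B g) (Idm (K C) A) = hclass C A B g"
      using that Idm_right[OF _ _ h] by (simp add: K_sel(3) K_Cmp chain_maps_Idm complexes_ob)
  qed
  have shift_Idm: "shift_hmor C (Idm (K C) X) = Idm (K C) (shift_cplx C X)"
    using shift_hmor_hclass[OF X X chain_maps_Idm[OF X]] by (simp add: K_sel(3))
  have "\<exists>X' Y' Z' u' v' w' a b c.
           (X', Y', Z', u', v', w') \<in> standard_triangles C \<and>
           is_iso (homotopy_cat C) X X' a \<and> is_iso (homotopy_cat C) Y Y' b \<and> is_iso (homotopy_cat C) M Z' c \<and>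
           b \<cdot>\<^bsub>homotopy_cat C\<^esub> hclass C X Y f = u' \<cdot>\<^bsub>homotopy_cat C\<^esub> a \<and>
           c \<cdot>\<^bsub>homotopy_cat C\<^esub> hclass C Y M j = v' \<cdot>\<^bsub>homotopy_cat C\<^esub> b \<and>
           shift_hmor C a \<cdot>\<^bsub>homotopy_cat C\<^esub> hclass C M (shift_cplx C X) p = w' \<cdot>\<^bsub>homotopy_cat C\<^esub> c"
    unfolding is_iso_homotopy_cat K_sel(4)[symmetric]
    apply (rule exI[of _ X], rule exI[of _ Y], rule exI[of _ M], rule exI[of _ "hclass C X Y f"],
      rule exI[of _ "hclass C Y M j"], rule exI[of _ "hclass C M (shift_cplx C X) p"],
      rule exI[of _ "Idm (K C) X"], rule exI[of _ "Idm (K C) Y"], rule exI[of _ "Idm (K C) M"], intro conjI)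
    subgoal using cone unfolding standard_triangles_def by blast
    using X Y M S f j p by (simp_all add: K_iso_Idm unit shift_Idm)
  then show ?thesis
    using f j p by (simp add: K_sel(7) distinguished_triangles_def Let_def) (simp add: homotopy_cat_def)
qed

text \<open>A distinguished triangle is isomorphic to a standard one, and isomorphism in
  \<open>K C\<close> is homotopy equivalence. Closure under homotopy equivalence thus reduces the
  condition on triangles to genuine cones.\<close>

lemma triangulated_subcatI:
  assumes sub: "S \<subseteq> complexes C" and zero: "\<exists>Z\<in>S. contr C Z"
    and iso: "\<And>X Y. X \<in> S \<Longrightarrow> Y \<in> complexes C \<Longrightarrow> heq C X Y \<Longrightarrow> Y \<in> S"
    and shift: "shift_cplx C ` S = S"
    and cone: "\<And>X Y f M i j p q. X \<in> S \<Longrightarrow> Y \<in> S \<Longrightarrow> is_cone C X Y f M i j p q \<Longrightarrow> M \<in> S"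
  shows "triangulated_subcat (K C) S"
proof -
  have "Z \<in> S" if t: "(X, Y, Z, u, v, w) \<in> Triangles (K C)" and XY: "X \<in> S" "Y \<in> S" for X Y Z u v w
  proof -
    obtain X' Y' Z' u' v' w' a b c where
      st: "(X', Y', Z', u', v', w') \<in> standard_triangles C"
      and isos: "is_iso (K C) X X' a" "is_iso (K C) Y Y' b" "is_iso (K C) Z Z' c"
      using t by (auto simp: K_sel(7) distinguished_triangles_def Let_def is_iso_homotopy_cat)
    obtain f i j p q where "is_cone C X' Y' f Z' i j p q"
      using st by (auto simp: standard_triangles_def)
    moreover have cx: "X' \<in> complexes C" "Y' \<in> complexes C" "Z \<in> complexes C" "Z' \<in> complexes C"
      "X \<in> complexes C" "Y \<in> complexes C"
      using isos by (auto simp: is_iso_def K_sel)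
    moreover have "isomorphic (K C) X X'" "isomorphic (K C) Y Y'" "isomorphic (K C) Z Z'"
      using isos unfolding isomorphic_def by blast+
    then have "heq C X X'" "heq C Y Y'" "heq C Z Z'" using cx K_isomorphic_iff by blast+
    ultimately show ?thesis using iso cone XY heq_sym by metis
  qed
  then have tri: "\<forall>X Y Z u v w. (X, Y, Z, u, v, w) \<in> Triangles (K C) \<and> X \<in> S \<and> Y \<in> S \<longrightarrow> Z \<in> S"
    by blast
  have "\<forall>X\<in>S. \<forall>Y\<in>Ob (K C). isomorphic (K C) X Y \<longrightarrow> Y \<in> S"
    using sub iso K_isomorphic_iff unfolding K_sel(1) by blast
  moreover have "\<exists>Z\<in>S. is_zero_ob (K C) Z" using zero sub K_zero_iff by blast
  ultimately show ?thesis
    unfolding triangulated_subcat_def K_sel(1,6) using sub shift tri by (intro conjI)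
qed

end

section \<open>Triangulated orthogonals and a criterion for stable t-structures\<close>

context additive_category
begin

lemma zero_complex: obtains Z where "Z \<in> complexes C" "contr C Z"
proof -
  obtain O' where z: "is_zero_ob C O'" using zero_ob_ex by blast
  then have O': "O' \<in> Ob C" by (simp add: is_zero_ob_def)
  let ?Z = "Cplx (\<lambda>_. O') (\<lambda>_. Zro C O' O')"
  have Z: "?Z \<in> complexes C"
    using O' by (simp add: complexes_def Zro_in Cmp_Zro_left)
  have "Idm C O' = Zro C O' O'"
    using z O' Idm_in Zro_in unfolding is_zero_ob_def by metis
  then have "gid C (cob ?Z) = 0"
    using arr_Zro[of "cob ?Z" "cob ?Z" 0] O' by (simp add: gid_def)
  then show ?thesis using that[OF Z] Z by (simp add: contr_def nul_0)
qed

lemma cone_ex: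
  assumes "X \<in> complexes C" "Y \<in> complexes C" "f \<in> chain_maps C X Y"
  obtains M i j p q where "is_cone C X Y f M i j p q"
proof -
  have "\<forall>n. \<exists>S i j p q. is_biproduct C (cob X (n + 1)) (cob Y n) S i j p q"
    using assms complexes_ob biproduct_ex by blast
  then obtain S i j p q where "\<And>n. is_biproduct C (cob X (n + 1)) (cob Y n) (S n) (i n) (j n) (p n) (q n)"
    by metis
  then have "is_cone C X Y f (Cplx S (\<lambda>n. (i (n + 1) \<cdot> Neg C (cdf X (n + 1)) \<cdot> p n) \<oplus>
          (j (n + 1) \<cdot> f (n + 1) \<cdot> p n) \<oplus> (j (n + 1) \<cdot> cdf Y n \<cdot> q n))) i j p q"
    using assms by (simp add: is_cone_def)
  then show ?thesis using that by blast
qed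

lemma triangulated_left_perp:
  assumes V: "V \<subseteq> complexes C" and sV: "shift_cplx C ` V = V"
  shows "triangulated_subcat (K C) (left_perp C V)"
proof (rule triangulated_subcatI)
  show sub: "left_perp C V \<subseteq> complexes C" by (auto simp: left_perp_def)
  show "\<exists>Z\<in>left_perp C V. contr C Z"
    by (rule zero_complex) (auto simp: left_perp_def intro: contr_orth_left)
  show "shift_cplx C ` left_perp C V = left_perp C V"
    by (rule shift_image_eq[OF sub shift_left_perp[OF V sV]])
  show "Y \<in> left_perp C V" if "X \<in> left_perp C V" "Y \<in> complexes C" "heq C X Y" for X Y
    using that orth_heq_left by (auto simp: left_perp_def)
  show "M \<in> left_perp C V" if h: "X \<in> left_perp C V" "Y \<in> left_perp C V" "is_cone C X Y f M i j p q"
    for X Y f M i j p q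
  proof -
    interpret standard_cone C X Y f M i j p q by unfold_locales (rule h(3))
    have "shift_cplx C X \<in> left_perp C V" using h(1) shift_left_perp[OF V sV X] by blast
    then show ?thesis using h(2) orth_cone_left M V by (auto simp: left_perp_def)
  qed
qed

lemma triangulated_right_perp:
  assumes U: "U \<subseteq> complexes C" and sU: "shift_cplx C ` U = U"
  shows "triangulated_subcat (K C) (right_perp C U)"
proof (rule triangulated_subcatI)
  show sub: "right_perp C U \<subseteq> complexes C" by (auto simp: right_perp_def)
  show "\<exists>Z\<in>right_perp C U. contr C Z"
    by (rule zero_complex) (auto simp: right_perp_def intro: contr_orth_right)
  show "shift_cplx C ` right_perp C U = right_perp C U"
    by (rule shift_image_eq[OF sub shift_right_perp[OF U sU]])
  show "Y \<in> right_perp C U" if "X \<in> right_perp C U" "Y \<in> complexes C" "heq C X Y" for X Y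
    using that orth_heq_right by (auto simp: right_perp_def)
  show "M \<in> right_perp C U" if h: "X \<in> right_perp C U" "Y \<in> right_perp C U" "is_cone C X Y f M i j p q"
    for X Y f M i j p q
  proof -
    interpret standard_cone C X Y f M i j p q by unfold_locales (rule h(3))
    have "shift_cplx C X \<in> right_perp C U" using h(1) shift_right_perp[OF U sU X] by blast
    then show ?thesis using h(2) orth_cone_right M U by (auto simp: right_perp_def)
  qed
qed

text \<open>Shift stability of one class passes to the other, since orthogonality is unchanged when
  both arguments are shifted; this is why a disjunction suffices in the hypothesis.\<close>

lemma stable_t_structureI:
  assumes U: "U = left_perp C V" and V: "V = right_perp C U"
    and shift: "shift_cplx C ` U = U \<or> shift_cplx C ` V = V"
    and cones: "\<And>X. X \<in> complexes C \<Longrightarrow> \<exists>A\<in>U. \<exists>B\<in>V. \<exists>f i j p q. is_cone C A X f B i j p q"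
  shows "stable_t_structure (K C) U V" "triangulated_subcat (K C) U" "triangulated_subcat (K C) V"
proof -
  have sub: "U \<subseteq> complexes C" "V \<subseteq> complexes C"
    using U V by (auto simp: left_perp_def right_perp_def)
  have sU: "shift_cplx C ` U = U" if "shift_cplx C ` V = V"
    unfolding U by (rule shift_image_eq) (use U sub shift_left_perp[OF sub(2) that] in auto)
  have sV: "shift_cplx C ` V = V" if "shift_cplx C ` U = U"
    using shift_image_eq[of "right_perp C U"] V sub shift_right_perp[OF sub(1) that] by auto
  have s: "shift_cplx C ` U = U" "shift_cplx C ` V = V" using shift sU sV by blast+
  show "triangulated_subcat (K C) U" using triangulated_left_perp[OF sub(2) s(2)] U by simp
  show "triangulated_subcat (K C) V" using triangulated_right_perp[OF sub(1) s(1)] V by simp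
  have "Hom (K C) X Y = {Zro (K C) X Y}" if "X \<in> U" "Y \<in> V" for X Y
    using that U sub by (subst K_Hom_orth) (auto simp: left_perp_def)
  moreover have "\<exists>A\<in>U. \<exists>B\<in>V. \<exists>u v w. (A, X, B, u, v, w) \<in> Triangles (K C)" if "X \<in> complexes C" for X
    using cones[OF that] standard_triangle_distinguished by metis
  ultimately show "stable_t_structure (K C) U V"
    unfolding stable_t_structure_def K_sel(1) using sub s by (simp add: K_sel(6))
qed

end

section \<open>Strictly idempotent coreflections and reflections\<close>

text \<open>Idempotence is demanded of objects only. On morphisms between objects
  \<open>RO X\<close> and \<open>RO Y\<close> the functor turns out to act as the identity once a
  natural transformation is given, see \<open>RM_RO\<close> below.\<close>

locale idempotent_functor = additive_category C
  for C :: "('o, 'm, 'z) preadd_scheme" (structure) +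
  fixes RO :: "'o \<Rightarrow> 'o" and RM :: "'m \<Rightarrow> 'm"
  assumes RO_in: "X \<in> Ob C \<Longrightarrow> RO X \<in> Ob C"
    and RM_in: "\<lbrakk>X \<in> Ob C; Y \<in> Ob C; f \<in> Hom C X Y\<rbrakk> \<Longrightarrow> RM f \<in> Hom C (RO X) (RO Y)"
    and RM_Idm: "X \<in> Ob C \<Longrightarrow> RM (Idm C X) = Idm C (RO X)"
    and RM_Cmp: "\<lbrakk>X \<in> Ob C; Y \<in> Ob C; Z \<in> Ob C; f \<in> Hom C X Y; g \<in> Hom C Y Z\<rbrakk>
      \<Longrightarrow> RM (g \<cdot> f) = RM g \<cdot> RM f"
    and RM_Add: "\<lbrakk>X \<in> Ob C; Y \<in> Ob C; f \<in> Hom C X Y; g \<in> Hom C X Y\<rbrakk> \<Longrightarrow> RM (f \<oplus> g) = RM f \<oplus> RM g"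
    and RO_RO: "X \<in> Ob C \<Longrightarrow> RO (RO X) = RO X"
begin

definition R :: "('o, 'm) cplx \<Rightarrow> ('o, 'm) cplx" where
  "R X = Cplx (\<lambda>n. RO (cob X n)) (\<lambda>n. RM (cdf X n))"

lemma cob_R [simp]: "cob (R X) n = RO (cob X n)" and cdf_R [simp]: "cdf (R X) n = RM (cdf X n)"
  by (simp_all add: R_def)

lemma RM_Zro: "X \<in> Ob C \<Longrightarrow> Y \<in> Ob C \<Longrightarrow> RM (Zro C X Y) = Zro C (RO X) (RO Y)"
  using RM_Add[of X Y "Zro C X Y" "Zro C X Y"]
  by (intro Zro_unique) (simp_all add: RO_in RM_in Zro_in Add_Zro)

lemma RM_Neg: "X \<in> Ob C \<Longrightarrow> Y \<in> Ob C \<Longrightarrow> f \<in> Hom C X Y \<Longrightarrow> RM (Neg C f) = Neg C (RM f)"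
  using RM_Add[of X Y f "Neg C f"]
  by (intro Neg_unique[of "RO X" "RO Y"]) (simp_all add: RO_in RM_in Neg_in Add_Neg RM_Zro)

lemma cdf_in: "X \<in> complexes C \<Longrightarrow> cdf X n \<in> Hom C (cob X n) (cob X (n + 1))"
  by (simp add: complexes_def)

lemma R_complexes: assumes "X \<in> complexes C" shows "R X \<in> complexes C"
proof -
  have "RM (cdf X (n + 1)) \<cdot> RM (cdf X n) = Zro C (RO (cob X n)) (RO (cob X (n + 2)))" for n
  proof -
    have "cdf X (n + 1) \<in> Hom C (cob X (n + 1)) (cob X (n + 2))"
      using cdf_in[OF assms, of "n + 1"] by (simp add: add.assoc)
    then have "RM (cdf X (n + 1)) \<cdot> RM (cdf X n) = RM (cdf X (n + 1) \<cdot> cdf X n)"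
      using assms by (subst RM_Cmp[of "cob X n" "cob X (n + 1)" "cob X (n + 2)"]) (simp_all add: complexes_ob cdf_in)
    also have "\<dots> = Zro C (RO (cob X n)) (RO (cob X (n + 2)))"
      using assms by (simp add: complexes_def RM_Zro)
    finally show ?thesis .
  qed
  then show ?thesis
    using assms by (simp add: complexes_def RO_in RM_in)
qed

lemma R_shift: "X \<in> complexes C \<Longrightarrow> R (shift_cplx C X) = shift_cplx C (R X)"
  by (simp add: R_def shift_cplx_def RM_Neg[OF complexes_ob complexes_ob cdf_in])

lemma chain_map_in: "f \<in> chain_maps C X Y \<Longrightarrow> f n \<in> Hom C (cob X n) (cob Y n)"
  by (simp add: chain_maps_def)

lemma R_chain_maps:
  assumes X: "X \<in> complexes C" and Y: "Y \<in> complexes C" and f: "f \<in> chain_maps C X Y"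
  shows "(\<lambda>n. RM (f n)) \<in> chain_maps C (R X) (R Y)"
proof -
  note ob = complexes_ob[OF X] complexes_ob[OF Y] and h = chain_map_in[OF f]
  have "RM (f (n + 1)) \<cdot> RM (cdf X n) = RM (cdf Y n) \<cdot> RM (f n)" for n
    using f RM_Cmp[OF ob(1) ob(1) ob(2) cdf_in[OF X] h, of n] RM_Cmp[OF ob(1) ob(2) ob(2) h cdf_in[OF Y], of n]
    by (simp add: chain_maps_def)
  then show ?thesis using RM_in[OF ob h] by (simp add: chain_maps_def)
qed

lemma R_homotopic:
  assumes X: "X \<in> complexes C" and Y: "Y \<in> complexes C"
    and f: "f \<in> chain_maps C X Y" and g: "g \<in> chain_maps C X Y" and fg: "homotopic C X Y f g"
  shows "homotopic C (R X) (R Y) (\<lambda>n. RM (f n)) (\<lambda>n. RM (g n))"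
proof -
  obtain h where h: "\<And>n. h n \<in> Hom C (cob X n) (cob Y (n - 1))"
    and e: "\<And>n. f n = g n \<oplus> ((cdf Y (n - 1) \<cdot> h n) \<oplus> (h (n + 1) \<cdot> cdf X n))"
    using fg by (auto simp: homotopic_def)
  note ob = complexes_ob[OF X] complexes_ob[OF Y]
  have "RM (f n) = RM (g n) \<oplus> ((RM (cdf Y (n - 1)) \<cdot> RM (h n)) \<oplus> (RM (h (n + 1)) \<cdot> RM (cdf X n)))" for n
  proof -
    have d: "cdf Y (n - 1) \<in> Hom C (cob Y (n - 1)) (cob Y n)" and h': "h (n + 1) \<in> Hom C (cob X (n + 1)) (cob Y n)"
      using cdf_in[OF Y, of "n - 1"] h[of "n + 1"] by simp_all
    have in1: "cdf Y (n - 1) \<cdot> h n \<in> Hom C (cob X n) (cob Y n)" and in2: "h (n + 1) \<cdot> cdf X n \<in> Hom C (cob X n) (cob Y n)"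
      by (rule Cmp_in[OF ob(1) ob(2) ob(2) h d], rule Cmp_in[OF ob(1) ob(1) ob(2) cdf_in[OF X] h'])
    show ?thesis
      unfolding e[of n] RM_Add[OF ob chain_map_in[OF g] Add_in[OF ob in1 in2]] RM_Add[OF ob in1 in2]
        RM_Cmp[OF ob(1) ob(2) ob(2) h d] RM_Cmp[OF ob(1) ob(1) ob(2) cdf_in[OF X] h'] ..
  qed
  then show ?thesis
    unfolding homotopic_def using RM_in[OF ob h] by (auto intro!: exI[of _ "\<lambda>n. RM (h n)"])
qed

lemma R_nul:
  assumes X: "X \<in> complexes C" and Y: "Y \<in> complexes C"
    and f: "f \<in> chain_maps C X Y" and g: "g \<in> chain_maps C X Y" and "nul C X Y (mp C X Y f - mp C X Y g)"
  shows "nul C (R X) (R Y) (mp C (R X) (R Y) (\<lambda>n. RM (f n)) - mp C (R X) (R Y) (\<lambda>n. RM (g n)))"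
  using R_homotopic[OF X Y f g] assms
  by (simp add: homotopic_chain_maps_iff R_complexes R_chain_maps)

lemma R_biproduct:
  assumes "is_biproduct C X Y S i j p q"
  shows "is_biproduct C (RO X) (RO Y) (RO S) (RM i) (RM j) (RM p) (RM q)"
proof -
  have ob: "X \<in> Ob C" "Y \<in> Ob C" "S \<in> Ob C" and h: "i \<in> Hom C X S" "j \<in> Hom C Y S" "p \<in> Hom C S X" "q \<in> Hom C S Y"
    and e: "p \<cdot> i = Idm C X" "q \<cdot> j = Idm C Y" "p \<cdot> j = Zro C Y X" "q \<cdot> i = Zro C X Y" "(i \<cdot> p) \<oplus> (j \<cdot> q) = Idm C S"
    using assms by (auto simp: is_biproduct_def)
  have "RM (i \<cdot> p) \<oplus> RM (j \<cdot> q) = Idm C (RO S)"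
    using RM_Add[of S S "i \<cdot> p" "j \<cdot> q"] Cmp_in[of S X S p i] Cmp_in[of S Y S q j] ob h e(5) RM_Idm by simp
  moreover have "RM (p \<cdot> i) = Idm C (RO X)" "RM (q \<cdot> j) = Idm C (RO Y)" "RM (p \<cdot> j) = Zro C (RO Y) (RO X)"
    "RM (q \<cdot> i) = Zro C (RO X) (RO Y)"
    using e ob by (simp_all add: RM_Idm RM_Zro)
  ultimately show ?thesis
    unfolding is_biproduct_def using ob h RM_Cmp
    by (metis RM_in RO_in)
qed

text \<open>An additive functor preserves biproducts and acts entrywise on the differential of a
  cone. This identifies the image of the cone of a natural transformation with the cone of an
  identity.\<close>

lemma R_cone:
  assumes c: "is_cone C X Y f M i j p q"
  shows "is_cone C (R X) (R Y) (\<lambda>n. RM (f n)) (R M) (\<lambda>n. RM (i n)) (\<lambda>n. RM (j n)) (\<lambda>n. RM (p n)) (\<lambda>n. RM (q n))"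
proof -
  have X: "X \<in> complexes C" and Y: "Y \<in> complexes C" and f: "f \<in> chain_maps C X Y"
    and bp: "\<And>n. is_biproduct C (cob X (n + 1)) (cob Y n) (cob M n) (i n) (j n) (p n) (q n)"
    and d: "\<And>n. cdf M n = (i (n + 1) \<cdot> Neg C (cdf X (n + 1)) \<cdot> p n) \<oplus> (j (n + 1) \<cdot> f (n + 1) \<cdot> p n) \<oplus>
          (j (n + 1) \<cdot> cdf Y n \<cdot> q n)"
    using c by (auto simp: is_cone_def)
  note ob = complexes_ob[OF X] complexes_ob[OF Y]
  have obM: "cob M n \<in> Ob C" for n using bp by (auto simp: is_biproduct_def)
  have h: "i n \<in> Hom C (cob X (n + 1)) (cob M n)" "j n \<in> Hom C (cob Y n) (cob M n)"
    "p n \<in> Hom C (cob M n) (cob X (n + 1))" "q n \<in> Hom C (cob M n) (cob Y n)" for n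
    using bp by (auto simp: is_biproduct_def)
  have comp: "RM (k \<cdot> g \<cdot> l) = RM k \<cdot> RM g \<cdot> RM l \<and> k \<cdot> g \<cdot> l \<in> Hom C A B"
    if "A \<in> Ob C" "A' \<in> Ob C" "B' \<in> Ob C" "B \<in> Ob C" "l \<in> Hom C A A'" "g \<in> Hom C A' B'" "k \<in> Hom C B' B"
    for k g l A A' B' B
    using RM_Cmp[OF that(1-3,5,6)] RM_Cmp[OF that(1,3,4) Cmp_in[OF that(1-3,5,6)] that(7)]
      Cmp_in[OF that(1,3,4) Cmp_in[OF that(1-3,5,6)] that(7)] by simp
  have "RM (cdf M n) = (RM (i (n + 1)) \<cdot> Neg C (RM (cdf X (n + 1))) \<cdot> RM (p n)) \<oplus>
      (RM (j (n + 1)) \<cdot> RM (f (n + 1)) \<cdot> RM (p n)) \<oplus> (RM (j (n + 1)) \<cdot> RM (cdf Y n) \<cdot> RM (q n))" for n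
  proof -
    note c1 = comp[OF obM ob(1) ob(1) obM h(3)[of n] Neg_in[OF ob(1) ob(1) cdf_in[OF X]] h(1)[of "n + 1"]]
    note c2 = comp[OF obM ob(1) ob(2) obM h(3)[of n] chain_map_in[OF f] h(2)[of "n + 1"]]
    note c3 = comp[OF obM ob(2) ob(2) obM h(4)[of n] cdf_in[OF Y] h(2)[of "n + 1"]]
    show ?thesis
      unfolding d using c1 c2 c3 RM_Add[OF obM obM conjunct2[OF c1] conjunct2[OF c2]]
        RM_Add[OF obM obM Add_in[OF obM obM conjunct2[OF c1] conjunct2[OF c2]] conjunct2[OF c3]]
      by (simp add: RM_Neg[OF ob(1) ob(1) cdf_in[OF X]])
  qed
  then show ?thesis
    unfolding is_cone_def using X Y f bp by (simp add: R_complexes R_chain_maps R_biproduct)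
qed

definition Kernel :: "('o, 'm) cplx set" where
  "Kernel = {X \<in> complexes C. contr C (R X)}"

text \<open>Closed under homotopy equivalence by construction, in line with the words "isomorphic to
  some" in the definition of the classes F.\<close>

definition Image :: "('o, 'm) cplx set" where
  "Image = {X \<in> complexes C. \<exists>Y\<in>complexes C. heq C X (R Y)}"

lemma shift_Kernel: "shift_cplx C ` Kernel = Kernel"
  by (rule shift_image_eq) (auto simp: Kernel_def R_shift contr_shift_iff R_complexes shift_complexes)

text \<open>The natural transformation becomes the identity under the functor, so its cone dies.\<close>

lemma cone_in_Kernel:
  assumes c: "is_cone C X Y f M i j p q" and XY: "R X = R Y" and f: "\<And>n. RM (f n) = Idm C (RO (cob X n))"
  shows "M \<in> Kernel"
proof -
  have f': "(\<lambda>n. RM (f n)) = (\<lambda>n. Idm C (cob (R X) n))" using f by simp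
  have X: "X \<in> complexes C" using c by (simp add: is_cone_def)
  interpret c: standard_cone C X Y f M i j p q by unfold_locales (rule c)
  note rc = mapping_cone_of_is_cone[OF R_cone[OF c], unfolded f' XY[symmetric] mp_Idm]
  note RX = R_complexes[OF X]
  have "contr C (R M)"
    by (rule mapping_cone.contr_cone_of_iso[OF rc cmap_gid[OF RX]])
      (simp_all add: gid_left[OF gid_in] complexes_ob[OF RX] del: cob_R)
  then show ?thesis using c.M by (simp add: Kernel_def)
qed

end

section \<open>Strictly idempotent functors with a transformation to the identity\<close>

locale coreflection = idempotent_functor +
  fixes u
  assumes u_in: "X \<in> Ob C \<Longrightarrow> u X \<in> Hom C (RO X) X"
    and u_natural: "\<lbrakk>X \<in> Ob C; Y \<in> Ob C; f \<in> Hom C X Y\<rbrakk> \<Longrightarrow> f \<cdot> u X = u Y \<cdot> RM f"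
    and u_RO: "X \<in> Ob C \<Longrightarrow> u (RO X) = Idm C (RO X)"
    and RM_u: "X \<in> Ob C \<Longrightarrow> RM (u X) = Idm C (RO X)"
begin

text \<open>This is naturality of \<open>u\<close> at objects of the image, where both instances of
  \<open>u\<close> are identities.\<close>

lemma RM_RO: 
  assumes X: "X \<in> Ob C" and Y: "Y \<in> Ob C" and f: "f \<in> Hom C (RO X) (RO Y)" shows "RM f = f"
  using u_natural[OF RO_in[OF X] RO_in[OF Y] f] u_RO X Y Idm_right[OF RO_in[OF X] RO_in[OF Y] f]
    Idm_left[OF RO_in[OF X] RO_in[OF Y]] RM_in[OF RO_in[OF X] RO_in[OF Y] f] RO_RO by simp

lemma R_R: "X \<in> complexes C \<Longrightarrow> R (R X) = R X"
  using RM_RO[OF _ _ RM_in[OF _ _ cdf_in[of X]]]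
  by (simp add: R_def RO_RO complexes_ob)

lemma u_chain: assumes "X \<in> complexes C" shows "(\<lambda>n. u (cob X n)) \<in> chain_maps C (R X) X"
  using assms u_natural[OF _ _ cdf_in[OF assms]] by (simp add: chain_maps_def u_in complexes_ob)

text \<open>By naturality every map from \<open>R X\<close> to \<open>Y\<close> factors as
  \<open>u\<close> after its own image under \<open>R\<close>, hence through \<open>R Y\<close>,
  which is contractible.\<close>

lemma orth_Image_Kernel:
  assumes X: "X \<in> complexes C" and Y: "Y \<in> Kernel" shows "orth C (R X) Y"
  unfolding orth_def
proof
  fix a assume a: "a \<in> cmap C (R X) Y"
  have Yc: "Y \<in> complexes C" "contr C (R Y)" using Y by (auto simp: Kernel_def)
  note RX = R_complexes[OF X] and RY = R_complexes[OF Yc(1)]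
  obtain f where f: "f \<in> chain_maps C (R X) Y" "a = mp C (R X) Y f" using cmapE[OF a RX Yc(1)] .
  have "(\<lambda>n. RM (f n)) \<in> chain_maps C (R X) (R Y)"
    using R_chain_maps[OF RX Yc(1) f(1)] R_R[OF X] by simp
  note cm = chain_maps_cmp[OF RX RY Yc(1) this u_chain[OF Yc(1)]] this
  have "f n = u (cob Y n) \<cdot> RM (f n)" for n
    using u_natural[OF complexes_ob[OF RX] complexes_ob[OF Yc(1)] chain_map_in[OF f(1)], of n]
      Idm_right[OF complexes_ob[OF RX] complexes_ob[OF Yc(1)] chain_map_in[OF f(1)], of n]
      u_RO[OF complexes_ob[OF X]] by simp
  then have "a = mp C (R Y) Y (\<lambda>n. u (cob Y n)) * mp C (R X) (R Y) (\<lambda>n. RM (f n))"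
    using cm(2) f(2) by simp
  moreover have "nul C (R X) (R Y) (mp C (R X) (R Y) (\<lambda>n. RM (f n)))"
    using contr_orth_right[OF Yc(2)] chain_maps_mp[OF RX RY cm(3)] by (simp add: orth_def)
  ultimately show "nul C (R X) Y a"
    using nul_left[OF chain_maps_mp[OF RY Yc(1) u_chain[OF Yc(1)]]] by simp
qed

text \<open>The cone of \<open>R X -> X\<close> lies in the kernel, so for \<open>X\<close>
  orthogonal to the kernel the map from \<open>X\<close> into the cone is null-homotopic and
  \<open>u\<close> acquires a homotopy section \<open>s\<close>. Applying \<open>R\<close> to the
  homotopy from \<open>u s\<close> to the identity shows that \<open>s\<close> is also a left
  inverse.\<close>

lemma Image_eq: "Image = left_perp C Kernel"
proof
  show "Image \<subseteq> left_perp C Kernel"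
    using orth_Image_Kernel orth_heq_left heq_sym by (fastforce simp: Image_def left_perp_def)
  show "left_perp C Kernel \<subseteq> Image"
  proof
    fix X assume "X \<in> left_perp C Kernel"
    then have X: "X \<in> complexes C" and orth: "\<And>T. T \<in> Kernel \<Longrightarrow> orth C X T" by (auto simp: left_perp_def)
    note RX = R_complexes[OF X] and ob = complexes_ob[OF X]
    let ?u = "\<lambda>n. u (cob X n)"
    obtain M i j p q where c: "is_cone C (R X) X ?u M i j p q"
      using cone_ex[OF RX X u_chain[OF X]] by blast
    interpret c: standard_cone C "R X" X ?u M i j p q by unfold_locales (rule c)
    have "M \<in> Kernel"
      by (rule cone_in_Kernel[OF c R_R[OF X]]) (simp add: RM_u ob RO_RO)
    then have "nul C X M (arr C (cob X) 0 j (cob M))" using orth c.J_cmap by (simp add: orth_def)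
    then obtain r where r: "r \<in> cmap C X (R X)" "nul C X X (mp C (R X) X ?u * r - gid C (cob X))"
      using c.section_of_nul_J by blast
    obtain s where s: "s \<in> chain_maps C X (R X)" "r = mp C X (R X) s" using cmapE[OF r(1) X RX] .
    note us = chain_maps_cmp[OF X RX X s(1) u_chain[OF X]] and su = chain_maps_cmp[OF RX X RX u_chain[OF X] s(1)]
    have "nul C (R X) (R X) (mp C (R X) (R X) (\<lambda>n. RM (u (cob X n) \<cdot> s n)) - mp C (R X) (R X) (\<lambda>n. RM (Idm C (cob X n))))"
      using R_nul[OF X X us(1) chain_maps_Idm[OF X]] r(2) us(2) s(2) by (simp add: mp_Idm)
    \<comment> \<open>\<open>R\<close> sends \<open>u\<close> to the identity, and naturality of
      \<open>u\<close> along \<open>s\<close> moves the remaining factor to the other side. So the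
      image of \<open>u s\<close> under \<open>R\<close> is literally \<open>s u\<close>.\<close>
    moreover have "RM (u (cob X n) \<cdot> s n) = s n \<cdot> u (cob X n)" for n
    proof -
      have "RM (u (cob X n) \<cdot> s n) = Idm C (RO (cob X n)) \<cdot> RM (s n)"
        using RM_Cmp[OF ob RO_in[OF ob] ob chain_map_in[OF s(1), unfolded cob_R] u_in[OF ob]] RM_u[OF ob] by simp
      also have "\<dots> = u (RO (cob X n)) \<cdot> RM (s n)" by (simp add: u_RO ob)
      also have "\<dots> = s n \<cdot> u (cob X n)"
        using u_natural[OF ob RO_in[OF ob] chain_map_in[OF s(1), unfolded cob_R]] by simp
      finally show ?thesis .
    qed
    ultimately have "nul C (R X) (R X) (r * mp C (R X) X ?u - gid C (cob (R X)))"
      using su(2) s(2) by (simp add: RM_Idm ob gid_def mp_def)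
    then have "heq C X (R X)"
      unfolding heq_def using r chain_maps_mp[OF RX X u_chain[OF X]] by blast
    then show "X \<in> Image" using X by (auto simp: Image_def)
  qed
qed

text \<open>\<open>R X\<close> belongs to the image, so for \<open>X\<close> right orthogonal to the
  image \<open>u\<close> is null-homotopic. \<open>R\<close> turns \<open>u\<close> into the
  identity of \<open>R X\<close>, which is then null-homotopic as well.\<close>

lemma Kernel_eq: "Kernel = right_perp C Image"
proof
  show "Kernel \<subseteq> right_perp C Image"
    using Image_eq by (auto simp: right_perp_def left_perp_def Kernel_def)
  show "right_perp C Image \<subseteq> Kernel"
  proof
    fix X assume "X \<in> right_perp C Image"
    then have X: "X \<in> complexes C" and orth: "\<And>T. T \<in> Image \<Longrightarrow> orth C T X" by (auto simp: right_perp_def)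
    note RX = R_complexes[OF X] and ob = complexes_ob[OF X]
    have "R X \<in> Image" using RX X heq_refl by (auto simp: Image_def)
    then have "nul C (R X) X (mp C (R X) X (\<lambda>n. u (cob X n)))"
      using orth chain_maps_mp[OF RX X u_chain[OF X]] by (auto simp: orth_def)
    then have "nul C (R (R X)) (R X) (mp C (R (R X)) (R X) (\<lambda>n. RM (u (cob X n)))
        - mp C (R (R X)) (R X) (\<lambda>n. RM (Zro C (cob (R X) n) (cob X n))))"
      using R_nul[OF RX X u_chain[OF X] chain_maps_Zro(1)[OF RX X]] chain_maps_Zro(2)[OF RX X] by simp
    moreover have "(\<lambda>n. RM (Zro C (cob (R X) n) (cob X n))) = (\<lambda>n. Zro C (cob (R X) n) (cob (R X) n))"
      by (simp add: RM_Zro RO_in ob RO_RO)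
    ultimately have "nul C (R X) (R X) (gid C (cob (R X)))"
      using chain_maps_Zro(2)[OF RX RX] R_R[OF X] by (simp add: RM_u ob gid_def mp_def)
    then show "X \<in> Kernel" using X by (simp add: Kernel_def contr_def)
  qed
qed

theorem coreflection_stable:
  "stable_t_structure (K C) Image Kernel" "triangulated_subcat (K C) Image" "triangulated_subcat (K C) Kernel"
proof -
  have cones: "\<exists>A\<in>Image. \<exists>B\<in>Kernel. \<exists>f i j p q. is_cone C A X f B i j p q" if X: "X \<in> complexes C" for X
  proof -
    note RX = R_complexes[OF X]
    obtain M i j p q where c: "is_cone C (R X) X (\<lambda>n. u (cob X n)) M i j p q"
      using cone_ex[OF RX X u_chain[OF X]] by blast
    have "M \<in> Kernel"
      by (rule cone_in_Kernel[OF c R_R[OF X]]) (simp add: RM_u complexes_ob[OF X] RO_RO)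
    moreover have "R X \<in> Image" using RX X heq_refl by (auto simp: Image_def)
    ultimately show ?thesis using c by blast
  qed
  note * = stable_t_structureI[OF Image_eq Kernel_eq disjI2[OF shift_Kernel] cones]
  show "stable_t_structure (K C) Image Kernel" "triangulated_subcat (K C) Image" "triangulated_subcat (K C) Kernel"
    by (rule *, assumption)+
qed

end

section \<open>Strictly idempotent functors with a transformation from the identity\<close>

locale reflection = idempotent_functor +
  fixes v
  assumes v_in: "X \<in> Ob C \<Longrightarrow> v X \<in> Hom C X (RO X)"
    and v_natural: "\<lbrakk>X \<in> Ob C; Y \<in> Ob C; f \<in> Hom C X Y\<rbrakk> \<Longrightarrow> RM f \<cdot> v X = v Y \<cdot> f"
    and v_RO: "X \<in> Ob C \<Longrightarrow> v (RO X) = Idm C (RO X)"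
    and RM_v: "X \<in> Ob C \<Longrightarrow> RM (v X) = Idm C (RO X)"
begin

lemma RM_RO: 
  assumes X: "X \<in> Ob C" and Y: "Y \<in> Ob C" and f: "f \<in> Hom C (RO X) (RO Y)" shows "RM f = f"
  using v_natural[OF RO_in[OF X] RO_in[OF Y] f] v_RO X Y Idm_left[OF RO_in[OF X] RO_in[OF Y] f]
    Idm_right[OF RO_in[OF X] RO_in[OF Y]] RM_in[OF RO_in[OF X] RO_in[OF Y] f] RO_RO by simp

lemma R_R: "X \<in> complexes C \<Longrightarrow> R (R X) = R X"
  using RM_RO[OF _ _ RM_in[OF _ _ cdf_in[of X]]]
  by (simp add: R_def RO_RO complexes_ob)

lemma v_chain: assumes "X \<in> complexes C" shows "(\<lambda>n. v (cob X n)) \<in> chain_maps C X (R X)"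
  using assms v_natural[OF _ _ cdf_in[OF assms]] by (simp add: chain_maps_def v_in complexes_ob)

text \<open>By naturality a map from \<open>X\<close> to \<open>R Y\<close> is its own image under
  \<open>R\<close> preceded by \<open>v\<close>, hence factors through the contractible complex
  \<open>R X\<close>.\<close>

lemma orth_Kernel_Image:
  assumes X: "X \<in> Kernel" and Y: "Y \<in> complexes C" shows "orth C X (R Y)"
  unfolding orth_def
proof
  fix a assume a: "a \<in> cmap C X (R Y)"
  have Xc: "X \<in> complexes C" "contr C (R X)" using X by (auto simp: Kernel_def)
  note RX = R_complexes[OF Xc(1)] and RY = R_complexes[OF Y]
  obtain f where f: "f \<in> chain_maps C X (R Y)" "a = mp C X (R Y) f" using cmapE[OF a Xc(1) RY] .
  have "(\<lambda>n. RM (f n)) \<in> chain_maps C (R X) (R Y)"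
    using R_chain_maps[OF Xc(1) RY f(1)] R_R[OF Y] by simp
  note cm = chain_maps_cmp[OF Xc(1) RX RY v_chain[OF Xc(1)] this] this
  have "f n = RM (f n) \<cdot> v (cob X n)" for n
    using v_natural[OF complexes_ob[OF Xc(1)] complexes_ob[OF RY] chain_map_in[OF f(1)], of n]
      Idm_left[OF complexes_ob[OF Xc(1)] complexes_ob[OF RY] chain_map_in[OF f(1)], of n]
      v_RO[OF complexes_ob[OF Y]] by simp
  then have "a = mp C (R X) (R Y) (\<lambda>n. RM (f n)) * mp C X (R X) (\<lambda>n. v (cob X n))"
    using cm(2) f(2) by simp
  moreover have "nul C (R X) (R Y) (mp C (R X) (R Y) (\<lambda>n. RM (f n)))"
    using contr_orth_left[OF Xc(2)] chain_maps_mp[OF RX RY cm(3)] by (simp add: orth_def)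
  ultimately show "nul C X (R Y) a"
    using nul_right[OF chain_maps_mp[OF Xc(1) RX v_chain[OF Xc(1)]]] by simp
qed

lemma Kernel_eq: "Kernel = left_perp C Image"
proof
  show "Kernel \<subseteq> left_perp C Image"
    using orth_Kernel_Image orth_heq_right heq_sym by (fastforce simp: Image_def left_perp_def Kernel_def)
  show "left_perp C Image \<subseteq> Kernel"
  proof
    fix X assume "X \<in> left_perp C Image"
    then have X: "X \<in> complexes C" and orth: "\<And>T. T \<in> Image \<Longrightarrow> orth C X T" by (auto simp: left_perp_def)
    note RX = R_complexes[OF X] and ob = complexes_ob[OF X]
    have "R X \<in> Image" using RX X heq_refl by (auto simp: Image_def)
    then have "nul C X (R X) (mp C X (R X) (\<lambda>n. v (cob X n)))"
      using orth chain_maps_mp[OF X RX v_chain[OF X]] by (auto simp: orth_def)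
    then have "nul C (R X) (R (R X)) (mp C (R X) (R (R X)) (\<lambda>n. RM (v (cob X n)))
        - mp C (R X) (R (R X)) (\<lambda>n. RM (Zro C (cob X n) (cob (R X) n))))"
      using R_nul[OF X RX v_chain[OF X] chain_maps_Zro(1)[OF X RX]] chain_maps_Zro(2)[OF X RX] by simp
    moreover have "(\<lambda>n. RM (Zro C (cob X n) (cob (R X) n))) = (\<lambda>n. Zro C (cob (R X) n) (cob (R X) n))"
      by (simp add: RM_Zro RO_in ob RO_RO)
    ultimately have "nul C (R X) (R X) (gid C (cob (R X)))"
      using chain_maps_Zro(2)[OF RX RX] R_R[OF X] by (simp add: RM_v ob gid_def mp_def)
    then show "X \<in> Kernel" using X by (simp add: Kernel_def contr_def)
  qed
qed

text \<open>Here the map to be killed leads from the cone of \<open>v\<close> to the shift of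
  \<open>X\<close>, so shift stability of the orthogonal is used first. The resulting homotopy
  retraction of \<open>v\<close> is made two-sided by applying \<open>R\<close>, as for
  coreflections.\<close>

lemma Image_eq: "Image = right_perp C Kernel"
proof
  show "Image \<subseteq> right_perp C Kernel"
    using Kernel_eq by (auto simp: right_perp_def left_perp_def Image_def)
  show "right_perp C Kernel \<subseteq> Image"
  proof
    fix X assume perp: "X \<in> right_perp C Kernel"
    then have X: "X \<in> complexes C" by (auto simp: right_perp_def)
    note RX = R_complexes[OF X] and ob = complexes_ob[OF X]
    let ?v = "\<lambda>n. v (cob X n)"
    obtain M i j p q where c: "is_cone C X (R X) ?v M i j p q"
      using cone_ex[OF X RX v_chain[OF X]] by blast
    interpret c: standard_cone C X "R X" ?v M i j p q by unfold_locales (rule c)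
    have "M \<in> Kernel"
      by (rule cone_in_Kernel[OF c R_R[OF X, symmetric]]) (simp add: RM_v ob RO_RO)
    moreover have "shift_cplx C X \<in> right_perp C Kernel"
      using shift_right_perp[OF _ shift_Kernel X] perp by (auto simp: Kernel_def)
    ultimately have "nul C M (shift_cplx C X) (arr C (cob M) 0 p (cob (shift_cplx C X)))"
      using c.P_cmap by (auto simp: orth_def right_perp_def)
    then obtain r where r: "r \<in> cmap C (R X) X" "nul C X X (r * mp C X (R X) ?v - gid C (cob X))"
      using c.retraction_of_nul_P by blast
    obtain s where s: "s \<in> chain_maps C (R X) X" "r = mp C (R X) X s" using cmapE[OF r(1) RX X] .
    note sv = chain_maps_cmp[OF X RX X v_chain[OF X] s(1)] and vs = chain_maps_cmp[OF RX X RX s(1) v_chain[OF X]]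
    have "nul C (R X) (R X) (mp C (R X) (R X) (\<lambda>n. RM (s n \<cdot> v (cob X n))) - mp C (R X) (R X) (\<lambda>n. RM (Idm C (cob X n))))"
      using R_nul[OF X X sv(1) chain_maps_Idm[OF X]] r(2) sv(2) s(2) by (simp add: mp_Idm)
    moreover have "RM (s n \<cdot> v (cob X n)) = v (cob X n) \<cdot> s n" for n
    proof -
      have "RM (s n \<cdot> v (cob X n)) = RM (s n) \<cdot> Idm C (RO (cob X n))"
        using RM_Cmp[OF ob RO_in[OF ob] ob v_in[OF ob] chain_map_in[OF s(1), unfolded cob_R]] RM_v[OF ob] by simp
      also have "\<dots> = RM (s n) \<cdot> v (RO (cob X n))" by (simp add: v_RO ob)
      also have "\<dots> = v (cob X n) \<cdot> s n"
        using v_natural[OF RO_in[OF ob] ob chain_map_in[OF s(1), unfolded cob_R]] by simp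
      finally show ?thesis .
    qed
    ultimately have "nul C (R X) (R X) (mp C X (R X) ?v * r - gid C (cob (R X)))"
      using vs(2) s(2) by (simp add: RM_Idm ob gid_def mp_def)
    then have "heq C X (R X)"
      unfolding heq_def using r chain_maps_mp[OF X RX v_chain[OF X]] by blast
    then show "X \<in> Image" using X by (auto simp: Image_def)
  qed
qed

text \<open>The cone \<open>M\<close> of \<open>X -> R X\<close> sits at the wrong end: a stable
  t-structure wants \<open>X\<close> in the middle, with an object of the kernel before it. So
  \<open>M\<close> is desuspended to \<open>A\<close>, and \<open>rotated_cone\<close> identifies
  the cone of the map from \<open>A\<close> to \<open>X\<close> with \<open>R X\<close> up to
  homotopy.\<close>

theorem reflection_stable:
  "stable_t_structure (K C) Kernel Image" "triangulated_subcat (K C) Kernel" "triangulated_subcat (K C) Image"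
proof -
  have cones: "\<exists>A\<in>Kernel. \<exists>B\<in>Image. \<exists>f i j p q. is_cone C A X f B i j p q" if X: "X \<in> complexes C" for X
  proof -
    note RX = R_complexes[OF X]
    let ?v = "\<lambda>n. v (cob X n)"
    obtain M i j p q where c: "is_cone C X (R X) ?v M i j p q"
      using cone_ex[OF X RX v_chain[OF X]] by blast
    note mc = mapping_cone_of_is_cone[OF c]
    interpret c: standard_cone C X "R X" ?v M i j p q by unfold_locales (rule c)
    have "M \<in> Kernel"
      by (rule cone_in_Kernel[OF c R_R[OF X, symmetric]]) (simp add: RM_v complexes_ob[OF X] RO_RO)
    moreover obtain A where A: "A \<in> complexes C" "shift_cplx C A = M" using shift_surj[OF c.M] by blast
    ultimately have "A \<in> Kernel"
      using R_shift[OF A(1)] contr_shift_iff[OF R_complexes[OF A(1)]] by (simp add: Kernel_def)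
    have "tg X * arr C (cob M) 0 p (cob (shift_cplx C X)) * sg A \<in> cmap C A X"
      using cmap_unshift[OF A(1) X] c.P_cmap A(2) by simp
    then obtain a where a: "a \<in> chain_maps C A X"
        "tg X * arr C (cob M) 0 p (cob (shift_cplx C X)) * sg A = mp C A X a"
      using cmapE[OF _ A(1) X] by blast
    obtain B i' j' p' q' where b: "is_cone C A X a B i' j' p' q'" using cone_ex[OF A(1) X a(1)] by blast
    have "heq C B (R X)"
      by (rule rotated_cone[OF mc A], unfold a(2), rule mapping_cone_of_is_cone[OF b])
    moreover have "B \<in> complexes C" using mapping_cone.M[OF mapping_cone_of_is_cone[OF b]] .
    ultimately have "B \<in> Image" using X by (auto simp: Image_def)
    then show ?thesis using \<open>A \<in> Kernel\<close> b by blast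
  qed
  note * = stable_t_structureI[OF Kernel_eq Image_eq disjI1[OF shift_Kernel] cones]
  show "stable_t_structure (K C) Kernel Image" "triangulated_subcat (K C) Kernel" "triangulated_subcat (K C) Image"
    by (rule *, assumption)+
qed

end

section \<open>Sequences of split monomorphisms form an additive category\<close>

context preadditive_category
begin

text \<open>Constant families in degree 0 carry single morphisms into the same ring, so that direct
  sum decompositions, too, can be verified by ring computations.\<close>

definition ar where "ar X f Y = arr C (\<lambda>_. X) 0 (\<lambda>_. f) (\<lambda>_. Y)"

definition aHom where "aHom X Y = (\<lambda>f. ar X f Y) ` Hom C X Y"

lemma garr_const: "X \<in> Ob C \<Longrightarrow> Y \<in> Ob C \<Longrightarrow> f \<in> Hom C X Y \<Longrightarrow> garr C (\<lambda>_. X) 0 (\<lambda>_. f) (\<lambda>_. Y)"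
  by (simp add: garr_def preadditive_category_axioms)

lemma ar_mult: "\<lbrakk>X \<in> Ob C; Y \<in> Ob C; Z \<in> Ob C; f \<in> Hom C X Y; g \<in> Hom C Y Z\<rbrakk>
    \<Longrightarrow> ar Y g Z * ar X f Y = ar X (g \<cdot> f) Z"
  and ar_add: "\<lbrakk>X \<in> Ob C; Y \<in> Ob C; f \<in> Hom C X Y; h \<in> Hom C X Y\<rbrakk> \<Longrightarrow> ar X f Y + ar X h Y = ar X (f \<oplus> h) Y"
  and ar_Zro: "\<lbrakk>X \<in> Ob C; Y \<in> Ob C\<rbrakk> \<Longrightarrow> ar X (Zro C X Y) Y = 0"
  using arr_mult[OF garr_const[of Y Z g] garr_const[of X Y f]] arr_add[OF garr_const[of X Y f] garr_const[of X Y h]]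
    arr_Zro[of "\<lambda>_. X" "\<lambda>_. Y" 0]
  by (simp_all add: ar_def)

lemma ar_inj: "\<lbrakk>X \<in> Ob C; Y \<in> Ob C; f \<in> Hom C X Y; g \<in> Hom C X Y\<rbrakk> \<Longrightarrow> ar X f Y = ar X g Y \<longleftrightarrow> f = g"
  using arr_inj[OF garr_const[of X Y f] garr_const[of X Y g]] by (auto simp: ar_def fun_eq_iff)

lemma ar_in: "f \<in> Hom C X Y \<Longrightarrow> ar X f Y \<in> aHom X Y"
  by (simp add: aHom_def)

lemma aHom_mult: "\<lbrakk>X \<in> Ob C; Y \<in> Ob C; Z \<in> Ob C; a \<in> aHom Y Z; b \<in> aHom X Y\<rbrakk> \<Longrightarrow> a * b \<in> aHom X Z"
  unfolding aHom_def by (auto simp: ar_mult intro!: Cmp_in imageI)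

lemma aHom_add: "\<lbrakk>X \<in> Ob C; Y \<in> Ob C; a \<in> aHom X Y; b \<in> aHom X Y\<rbrakk> \<Longrightarrow> a + b \<in> aHom X Y"
  unfolding aHom_def by (auto simp: ar_add intro!: Add_in imageI)

lemma ar_Idm_left: "\<lbrakk>X \<in> Ob C; Y \<in> Ob C; a \<in> aHom X Y\<rbrakk> \<Longrightarrow> ar Y (Idm C Y) Y * a = a"
  unfolding aHom_def by (auto simp: ar_mult Idm_in Idm_left)

lemma ar_Idm_right: "\<lbrakk>X \<in> Ob C; Y \<in> Ob C; a \<in> aHom X Y\<rbrakk> \<Longrightarrow> a * ar X (Idm C X) X = a"
  unfolding aHom_def by (auto simp: ar_mult Idm_in Idm_right)

definition ebip where
  "ebip X Y S i j p q \<longleftrightarrow> X \<in> Ob C \<and> Y \<in> Ob C \<and> S \<in> Ob C \<and>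
     i \<in> aHom X S \<and> j \<in> aHom Y S \<and> p \<in> aHom S X \<and> q \<in> aHom S Y \<and>
     p * i = ar X (Idm C X) X \<and> q * j = ar Y (Idm C Y) Y \<and> p * j = 0 \<and> q * i = 0 \<and>
     i * p + j * q = ar S (Idm C S) S"

lemma is_biproduct_iff:
  assumes "i \<in> Hom C X S" "j \<in> Hom C Y S" "p \<in> Hom C S X" "q \<in> Hom C S Y"
  shows "is_biproduct C X Y S i j p q \<longleftrightarrow> ebip X Y S (ar X i S) (ar Y j S) (ar S p X) (ar S q Y)"
proof (cases "X \<in> Ob C \<and> Y \<in> Ob C \<and> S \<in> Ob C")
  case True
  have ij: "i \<cdot> p \<in> Hom C S S" "j \<cdot> q \<in> Hom C S S" "p \<cdot> i \<in> Hom C X X" "q \<cdot> j \<in> Hom C Y Y"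
    "p \<cdot> j \<in> Hom C Y X" "q \<cdot> i \<in> Hom C X Y"
    using True assms Cmp_in by blast+
  have "ar S p X * ar X i S = ar X (Idm C X) X \<longleftrightarrow> p \<cdot> i = Idm C X"
    "ar S q Y * ar Y j S = ar Y (Idm C Y) Y \<longleftrightarrow> q \<cdot> j = Idm C Y"
    "ar S p X * ar Y j S = 0 \<longleftrightarrow> p \<cdot> j = Zro C Y X"
    "ar S q Y * ar X i S = 0 \<longleftrightarrow> q \<cdot> i = Zro C X Y"
    "ar X i S * ar S p X + ar Y j S * ar S q Y = ar S (Idm C S) S \<longleftrightarrow> (i \<cdot> p) \<oplus> (j \<cdot> q) = Idm C S"
    using True assms ij ar_inj[of Y X "p \<cdot> j" "Zro C Y X"] ar_inj[of X Y "q \<cdot> i" "Zro C X Y"]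
    by (simp_all add: ar_mult ar_add ar_inj Idm_in Zro_in Add_in ar_Zro)
  then show ?thesis
    unfolding is_biproduct_def ebip_def using True assms by (simp add: ar_in)
qed (auto simp: is_biproduct_def ebip_def)

lemma ebipE:
  assumes "ebip X Y S i j p q"
  obtains i' j' p' q' where "i = ar X i' S" "i' \<in> Hom C X S" "j = ar Y j' S" "p = ar S p' X" "q = ar S q' Y"
    "is_biproduct C X Y S i' j' p' q'"
proof -
  obtain i' j' p' q' where *: "i = ar X i' S" "i' \<in> Hom C X S" "j = ar Y j' S" "j' \<in> Hom C Y S"
    "p = ar S p' X" "p' \<in> Hom C S X" "q = ar S q' Y" "q' \<in> Hom C S Y"
    using assms by (auto simp: ebip_def aHom_def)
  then show ?thesis using that assms is_biproduct_iff[OF *(2,4,6,8)] by blast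
qed

lemma is_biproduct_ebip: "is_biproduct C X Y S i j p q \<Longrightarrow> ebip X Y S (ar X i S) (ar Y j S) (ar S p X) (ar S q Y)"
  using is_biproduct_iff[of i X S j Y p q] by (auto simp: is_biproduct_def)

lemma ebip_rules:
  assumes "ebip X Y S i j p q"
  shows "p * i = ar X (Idm C X) X" "q * j = ar Y (Idm C Y) Y" "p * j = 0" "q * i = 0"
    "i * ar X (Idm C X) X = i" "j * ar Y (Idm C Y) Y = j" "ar X (Idm C X) X * p = p" "ar Y (Idm C Y) Y * q = q"
    "ar S (Idm C S) S * i = i" "ar S (Idm C S) S * j = j" "p * ar S (Idm C S) S = p" "q * ar S (Idm C S) S = q"
    "X \<in> Ob C" "Y \<in> Ob C" "S \<in> Ob C" "i \<in> aHom X S" "j \<in> aHom Y S" "p \<in> aHom S X" "q \<in> aHom S Y"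
    "i * p + j * q = ar S (Idm C S) S"
  using assms by (auto simp: ebip_def ar_Idm_left ar_Idm_right)

lemma is_iso_Idm: "X \<in> Ob C \<Longrightarrow> is_iso C X X (Idm C X)"
  unfolding is_iso_def using Idm_in Idm_left[of X X "Idm C X"] by blast

lemma split_monoI:
  assumes "is_biproduct C X Z Y f j p q" shows "split_mono C X Y f"
proof -
  have "X \<in> Ob C" "Y \<in> Ob C" "f \<in> Hom C X Y" using assms by (auto simp: is_biproduct_def)
  moreover from this have "Idm C Y \<cdot> f = f \<cdot> Idm C X" by (simp add: Idm_left Idm_right)
  ultimately show ?thesis unfolding split_mono_def using assms is_iso_Idm by blast
qed

text \<open>The definition makes \<open>f\<close> only isomorphic to an injection. Transporting the
  biproduct along the isomorphisms \<open>u\<close> and \<open>v\<close> makes \<open>f\<close>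
  itself an injection into a biproduct, which is the usable form.\<close>

lemma split_monoE:
  assumes "split_mono C X Y f"
  obtains Z j p q where "ebip X Z Y (ar X f Y) j p q"
proof -
  obtain X' Z S i j p q u v where b: "is_biproduct C X' Z S i j p q"
    and u: "is_iso C X' X u" and v: "is_iso C S Y v" and e: "v \<cdot> i = f \<cdot> u"
    and ob: "X \<in> Ob C" "Y \<in> Ob C" "f \<in> Hom C X Y"
    using assms by (auto simp: split_mono_def)
  obtain u' where u': "u' \<in> Hom C X X'" "u' \<cdot> u = Idm C X'" "u \<cdot> u' = Idm C X" and uh: "X' \<in> Ob C" "u \<in> Hom C X' X"
    using u by (auto simp: is_iso_def)
  obtain v' where v': "v' \<in> Hom C Y S" "v' \<cdot> v = Idm C S" "v \<cdot> v' = Idm C Y" and vh: "S \<in> Ob C" "v \<in> Hom C S Y"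
    using v by (auto simp: is_iso_def)
  note eb = is_biproduct_ebip[OF b] and r = ebip_rules[OF is_biproduct_ebip[OF b]]
  let ?i = "ar X' i S" and ?j = "ar Z j S" and ?p = "ar S p X'" and ?q = "ar S q Z"
  let ?u = "ar X' u X" and ?u' = "ar X u' X'" and ?v = "ar S v Y" and ?v' = "ar Y v' S" and ?f = "ar X f Y"
  have hi: "i \<in> Hom C X' S" using b by (simp add: is_biproduct_def)
  have m: "?u' * ?u = ar X' (Idm C X') X'" "?u * ?u' = ar X (Idm C X) X"
    "?v' * ?v = ar S (Idm C S) S" "?v * ?v' = ar Y (Idm C Y) Y" "?v * ?i = ?f * ?u"
    using ob u' v' uh vh hi e by (simp_all add: ar_mult)
  have ids: "ar X (Idm C X) X * ?u = ?u" "?u' * ar X (Idm C X) X = ?u'" "?f * ar X (Idm C X) X = ?f"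
    "ar Y (Idm C Y) Y * ?v = ?v" "?v' * ar Y (Idm C Y) Y = ?v'" "ar X' (Idm C X') X' * ?u' = ?u'"
    "ar S (Idm C S) S * ?v' = ?v'"
    using ob u'(1) v'(1) uh vh by (simp_all add: ar_Idm_left ar_Idm_right ar_in)
  have f: "?f = ?v * ?i * ?u'" using m ids by (simp add: mult.assoc)
  have "?v * (?i * ?p + ?j * ?q) * ?v' = ar Y (Idm C Y) Y" using r(20) m ids by (simp add: mult.assoc)
  then have "ebip X Z Y ?f (?v * ?j) (?u * ?p * ?v') (?q * ?v')"
    unfolding ebip_def f using ob r(13-19) vh uh u'(1) v'(1) m(1-4) ids
    by (simp add: algebra_simps mult_ext[OF m(1)] mult_ext[OF m(2)] mult_ext[OF m(3)] mult_ext[OF m(4)]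
       r(1-12) r(1-12)[THEN mult_ext] ids[THEN mult_ext] aHom_mult[OF _ _ _ aHom_mult] ar_in aHom_mult)
  then show ?thesis using that by blast
qed

lemma split_mono_hom: "split_mono C X Y f \<Longrightarrow> f \<in> Hom C X Y" "split_mono C X Y f \<Longrightarrow> X \<in> Ob C"
  "split_mono C X Y f \<Longrightarrow> Y \<in> Ob C"
  by (simp_all add: split_mono_def)

lemma split_mono_of_ebip:
  assumes "ebip X Z Y (ar X f Y) j p q" "f \<in> Hom C X Y"
  shows "split_mono C X Y f"
proof -
  obtain i' j' p' q' where "ar X f Y = ar X i' Y" "i' \<in> Hom C X Y" "is_biproduct C X Z Y i' j' p' q'"
    using ebipE[OF assms(1)] by metis
  then show ?thesis using assms ar_inj[of X Y f i'] split_monoI by (auto simp: ebip_def)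
qed

text \<open>The complement is all of \<open>Y\<close>. This permits zeros at the beginning of a
  sequence.\<close>

lemma ebip_zero: assumes "Y \<in> Ob C" "is_zero_ob C O'" shows "split_mono C O' Y (Zro C O' Y)"
proof -
  have O': "O' \<in> Ob C" and 1: "Idm C O' = Zro C O' O'"
    using assms Idm_in Zro_in unfolding is_zero_ob_def by metis+
  then have "is_biproduct C O' Y Y (Zro C O' Y) (Idm C Y) (Zro C Y O') (Idm C Y)"
    using assms(1) Idm_left[of Y Y "Idm C Y"] unfolding is_biproduct_def
    by (simp add: Zro_in Idm_in Cmp_Zro_left Cmp_Zro_right Add_Zro_left)
  then show ?thesis by (rule split_monoI)
qed

end

context additive_category
begin

lemma split_mono_Idm: assumes "X \<in> Ob C" shows "split_mono C X X (Idm C X)"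
proof -
  obtain O' where O': "is_zero_ob C O'" using zero_ob_ex by blast
  then have "O' \<in> Ob C" "Idm C O' = Zro C O' O'"
    using Idm_in Zro_in unfolding is_zero_ob_def by metis+
  then have "is_biproduct C X O' X (Idm C X) (Zro C O' X) (Idm C X) (Zro C X O')"
    using assms Idm_left[of X X "Idm C X"] unfolding is_biproduct_def
    by (simp add: Zro_in Idm_in Cmp_Zro_left Cmp_Zro_right Add_Zro)
  then show ?thesis by (rule split_monoI)
qed

text \<open>The complement is the sum \<open>T\<close> of the complements \<open>Z\<close> of
  \<open>f\<close> and \<open>Z'\<close> of \<open>g\<close>: the first is embedded by
  \<open>j\<close> followed by \<open>g\<close>, the second by \<open>j'\<close>.\<close>

lemma split_mono_Cmp:
  assumes f: "split_mono C X Y f" and g: "split_mono C Y W g"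
  shows "split_mono C X W (g \<cdot> f)"
proof -
  obtain Z j r q where F: "ebip X Z Y (ar X f Y) j r q" using split_monoE[OF f] .
  obtain Z' j' r' q' where G: "ebip Y Z' W (ar Y g W) j' r' q'" using split_monoE[OF g] .
  note rF = ebip_rules[OF F] and rG = ebip_rules[OF G]
  obtain T k1 k2 l1 l2 where "is_biproduct C Z Z' T k1 k2 l1 l2"
    using biproduct_ex[OF rF(14) rG(14)] by blast
  note T = is_biproduct_ebip[OF this]
  note rT = ebip_rules[OF T]
  let ?k1 = "ar Z k1 T" and ?k2 = "ar Z' k2 T" and ?l1 = "ar T l1 Z" and ?l2 = "ar T l2 Z'"
  have rT': "?k2 * ?l2 + ?k1 * ?l1 = ar T (Idm C T) T"
    using rT(20) by (simp add: add.commute)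
  let ?f = "ar X f Y" and ?g = "ar Y g W"
  have gf: "?g * ?f = ar X (g \<cdot> f) W"
    using ar_mult f g split_mono_hom by blast
  have "?g * (?f * r + j * q) * r' + j' * q' = ar W (Idm C W) W"
    using rG(1-12,20) unfolding rF(20) by (simp add: mult.assoc)
  then have "?g * ?f * r * r' + (?g * j * q * r' + j' * q') = ar W (Idm C W) W"
    by (simp add: algebra_simps)
  moreover have "(?g * j * ?l1 + j' * ?l2) * (?k1 * q * r' + ?k2 * q') = ?g * j * q * r' + j' * q'"
    by (simp add: algebra_simps rT(1-12) rT(1-4)[THEN mult_ext] rF rF(1-12)[THEN mult_ext] rG rG(1-12)[THEN mult_ext])
  moreover have "?g * j * ?l1 + j' * ?l2 \<in> aHom T W" "r * r' \<in> aHom W X" "?k1 * q * r' + ?k2 * q' \<in> aHom W T"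
    "?g * ?f \<in> aHom X W"
    using aHom_mult[OF rT(15) rF(14) rG(15) aHom_mult[OF rF(14) rG(13) rG(15) rG(16) rF(17)] rT(18)]
      aHom_mult[OF rT(15) rG(14) rG(15) rG(17) rT(19)] aHom_mult[OF rG(15) rG(13) rF(13) rF(18) rG(18)]
      aHom_mult[OF rG(15) rG(13) rT(15) aHom_mult[OF rG(13) rF(14) rT(15) rT(16) rF(19)] rG(18)]
      aHom_mult[OF rG(15) rG(14) rT(15) rT(17) rG(19)] aHom_mult[OF rF(13) rG(13) rG(15) rG(16) rF(16)]
      aHom_add rT(15) rG(15) by blast+
  moreover have "r * r' * (?g * ?f) = ar X (Idm C X) X"
    "(?k1 * q * r' + ?k2 * q') * (?g * j * ?l1 + j' * ?l2) = ar T (Idm C T) T"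
    "r * r' * (?g * j * ?l1 + j' * ?l2) = 0" "(?k1 * q * r' + ?k2 * q') * (?g * ?f) = 0"
    by (simp_all add: algebra_simps rT(1-12) rT' rT(20) rF(1-12) rG(1-12)
           rT(1-12)[THEN mult_ext] rF(1-12)[THEN mult_ext] rG(1-12)[THEN mult_ext])
  ultimately have "ebip X T W (ar X (g \<cdot> f) W) (?g * j * ?l1 + j' * ?l2) (r * r') (?k1 * q * r' + ?k2 * q')"
    unfolding ebip_def gf using rF(13) rG(15) rT(15) by (simp add: gf mult.assoc)
  moreover have "g \<cdot> f \<in> Hom C X W" using Cmp_in f g split_mono_hom by blast
  ultimately show ?thesis by (rule split_mono_of_ebip)
qed

text \<open>\<open>c\<close> is the diagonal matrix with entries \<open>a\<close> and
  \<open>b\<close>, and its complement is the sum of the two complements. The four equations say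
  that injections and projections commute with \<open>c\<close>, as needed for direct sums of
  sequences.\<close>

lemma split_mono_sum:
  assumes S: "is_biproduct C X Y S i j p q" and S': "is_biproduct C X' Y' S' i' j' p' q'"
    and a: "split_mono C X X' a" and b: "split_mono C Y Y' b"
  defines "c \<equiv> (i' \<cdot> a \<cdot> p) \<oplus> (j' \<cdot> b \<cdot> q)"
  shows "split_mono C S S' c" "c \<cdot> i = i' \<cdot> a" "c \<cdot> j = j' \<cdot> b" "p' \<cdot> c = a \<cdot> p" "q' \<cdot> c = b \<cdot> q"
proof -
  obtain Z jA r q1 where A: "ebip X Z X' (ar X a X') jA r q1" using split_monoE[OF a] .
  obtain Z2 jB s q2 where B: "ebip Y Z2 Y' (ar Y b Y') jB s q2" using split_monoE[OF b] .
  note rA = ebip_rules[OF A] and rB = ebip_rules[OF B]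
  obtain T k1 k2 l1 l2 where "is_biproduct C Z Z2 T k1 k2 l1 l2"
    using biproduct_ex[OF rA(14) rB(14)] by blast
  note rT = ebip_rules[OF is_biproduct_ebip[OF this]]
  note rS = ebip_rules[OF is_biproduct_ebip[OF S]] and rS' = ebip_rules[OF is_biproduct_ebip[OF S']]
  have hS: "i \<in> Hom C X S" "j \<in> Hom C Y S" "p \<in> Hom C S X" "q \<in> Hom C S Y"
    using S by (auto simp: is_biproduct_def)
  have hS': "i' \<in> Hom C X' S'" "j' \<in> Hom C Y' S'" "p' \<in> Hom C S' X'" "q' \<in> Hom C S' Y'"
    using S' by (auto simp: is_biproduct_def)
  note ob = rS(13-15) rS'(13-15) and ha = split_mono_hom(1)[OF a] split_mono_hom(1)[OF b]
  let ?k1 = "ar Z k1 T" and ?k2 = "ar Z2 k2 T" and ?l1 = "ar T l1 Z" and ?l2 = "ar T l2 Z2"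
  let ?i = "ar X i S" and ?j = "ar Y j S" and ?p = "ar S p X" and ?q = "ar S q Y"
  let ?i' = "ar X' i' S'" and ?j' = "ar Y' j' S'" and ?p' = "ar S' p' X'" and ?q' = "ar S' q' Y'"
  let ?a = "ar X a X'" and ?b = "ar Y b Y'"
  have m: "a \<cdot> p \<in> Hom C S X'" "i' \<cdot> a \<cdot> p \<in> Hom C S S'" "b \<cdot> q \<in> Hom C S Y'" "j' \<cdot> b \<cdot> q \<in> Hom C S S'"
    "i' \<cdot> a \<in> Hom C X S'" "j' \<cdot> b \<in> Hom C Y S'"
    using ob hS hS' ha Cmp_in by blast+
  have c_in: "c \<in> Hom C S S'" unfolding c_def using m ob Add_in by blast
  have c: "ar S c S' = ?i' * (?a * ?p) + ?j' * (?b * ?q)"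
    unfolding c_def using ob hS hS' ha m by (simp add: ar_mult ar_add)
  have ci: "c \<cdot> i \<in> Hom C X S'" "c \<cdot> j \<in> Hom C Y S'" "p' \<cdot> c \<in> Hom C S X'" "q' \<cdot> c \<in> Hom C S Y'"
    using ob hS hS' c_in Cmp_in by blast+
  have ids: "?a * ar X (Idm C X) X = ?a" "?b * ar Y (Idm C Y) Y = ?b" "ar X' (Idm C X') X' * ?a = ?a"
     "ar Y' (Idm C Y') Y' * ?b = ?b"
    using ob ha by (simp_all add: ar_Idm_left ar_Idm_right ar_in)
  note rules = algebra_simps rS(1-12) rS'(1-12) rT(1-12) rA(1-12) rB(1-12) ids
    rS(1-12)[THEN mult_ext] rS'(1-12)[THEN mult_ext] rT(1-12)[THEN mult_ext] rA(1-12)[THEN mult_ext] rB(1-12)[THEN mult_ext]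
    ids[THEN mult_ext]
  have "ar S c S' * ?i = ?i' * ?a" "ar S c S' * ?j = ?j' * ?b" "?p' * ar S c S' = ?a * ?p" "?q' * ar S c S' = ?b * ?q"
    unfolding c by (simp_all add: rules)
  then show "c \<cdot> i = i' \<cdot> a" "c \<cdot> j = j' \<cdot> b" "p' \<cdot> c = a \<cdot> p" "q' \<cdot> c = b \<cdot> q"
    using ob hS hS' ha c_in m ci by (simp_all add: ar_mult ar_inj)
  \<comment> \<open>Inclusion of the complement, retraction of \<open>c\<close> and projection to
    the complement, each assembled diagonally from the data for \<open>a\<close> and
    \<open>b\<close>.\<close>
  let ?j'' = "?i' * (jA * ?l1) + ?j' * (jB * ?l2)" and ?r'' = "?i * (r * ?p') + ?j * (s * ?q')"
    and ?q'' = "?k1 * (q1 * ?p') + ?k2 * (q2 * ?q')"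
  have h: "?j'' \<in> aHom T S'" "?r'' \<in> aHom S' S" "?q'' \<in> aHom S' T"
  proof -
    note o = ob rT(13-15)
    show "?j'' \<in> aHom T S'"
      by (intro aHom_add o aHom_mult[OF rT(15) rS'(13,15) rS'(16)] aHom_mult[OF rT(15) rS'(14,15) rS'(17)]
        aHom_mult[OF rT(15) rT(13) rS'(13) rA(17) rT(18)] aHom_mult[OF rT(15) rT(14) rS'(14) rB(17) rT(19)])
    show "?r'' \<in> aHom S' S"
      by (intro aHom_add o aHom_mult[OF rS'(15) rS(13,15) rS(16)] aHom_mult[OF rS'(15) rS(14,15) rS(17)]
        aHom_mult[OF rS'(15) rS'(13) rS(13) rA(18) rS'(18)] aHom_mult[OF rS'(15) rS'(14) rS(14) rB(18) rS'(19)])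
    show "?q'' \<in> aHom S' T"
      by (intro aHom_add o aHom_mult[OF rS'(15) rT(13,15) rT(16)] aHom_mult[OF rS'(15) rT(14,15) rT(17)]
        aHom_mult[OF rS'(15) rS'(13) rT(13) rA(19) rS'(18)] aHom_mult[OF rS'(15) rS'(14) rT(14) rB(19) rS'(19)])
  qed
  have "?r'' * ar S c S' = ar S (Idm C S) S"
    unfolding c using rS(20) by (simp add: rules)
  moreover have "?q'' * ?j'' = ar T (Idm C T) T" using rT(20) by (simp add: rules)
  moreover have "?r'' * ?j'' = 0" "?q'' * ar S c S' = 0" unfolding c by (simp_all add: rules)
  moreover have "ar S c S' * ?r'' + ?j'' * ?q'' = ar S' (Idm C S') S'"
  proof -
    have "ar S c S' * ?r'' + ?j'' * ?q'' = ?i' * (?a * r + jA * q1) * ?p' + ?j' * (?b * s + jB * q2) * ?q'"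
      unfolding c by (simp add: rules)
    also have "\<dots> = ?i' * ?p' + ?j' * ?q'" unfolding rA(20) rB(20) using rS' by (simp add: mult.assoc)
    finally show ?thesis using rS'(20) by simp
  qed
  ultimately have "ebip S T S' (ar S c S') ?j'' ?r'' ?q''"
    unfolding ebip_def using h rT(15) ob ar_in[OF c_in] by blast
  then show "split_mono C S S' c" using c_in by (rule split_mono_of_ebip)
qed

end

section \<open>Componentwise additive structure on sequences\<close>

context additive_category
begin

lemma Cmp_Neg_left:
  assumes "X \<in> Ob C" "Y \<in> Ob C" "Z \<in> Ob C" "f \<in> Hom C X Y" "g \<in> Hom C Y Z"
  shows "Neg C g \<cdot> f = Neg C (g \<cdot> f)"
  using assms Cmp_Add_left[of X Y Z f g "Neg C g"]
  by (intro Neg_unique[of X Z]) (auto simp: Add_Neg Cmp_Zro_left Neg_in Cmp_in)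

lemma Cmp_Neg_right:
  assumes "X \<in> Ob C" "Y \<in> Ob C" "Z \<in> Ob C" "f \<in> Hom C X Y" "g \<in> Hom C Y Z"
  shows "g \<cdot> Neg C f = Neg C (g \<cdot> f)"
  using assms Cmp_Add_right[of X Y Z f "Neg C f" g]
  by (intro Neg_unique[of X Z]) (auto simp: Add_Neg Cmp_Zro_right Neg_in Cmp_in)

lemma ms_sel:
  "Idm (mor_sm C n) X = (\<lambda>i\<in>{1..n}. Idm C (mob X i))"
  "Cmp (mor_sm C n) g f = (\<lambda>i\<in>{1..n}. g i \<cdot> f i)"
  "Zro (mor_sm C n) X Y = (\<lambda>i\<in>{1..n}. Zro C (mob X i) (mob Y i))"
  "Add (mor_sm C n) f h = (\<lambda>i\<in>{1..n}. f i \<oplus> h i)"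
  "Neg (mor_sm C n) f = (\<lambda>i\<in>{1..n}. Neg C (f i))"
  by (simp_all add: mor_sm_def)

lemma ms_ob: "X \<in> Ob (mor_sm C n) \<Longrightarrow> i \<in> {1..n} \<Longrightarrow> mob X i \<in> Ob C"
  by (auto simp: mor_sm_def)

lemma ms_mar: "X \<in> Ob (mor_sm C n) \<Longrightarrow> i \<in> {1..<n} \<Longrightarrow> split_mono C (mob X i) (mob X (i + 1)) (mar X i)"
  by (simp add: mor_sm_def)

lemma ms_mar_in: "X \<in> Ob (mor_sm C n) \<Longrightarrow> i \<in> {1..<n} \<Longrightarrow> mar X i \<in> Hom C (mob X i) (mob X (i + 1))"
  using ms_mar split_mono_hom by blast

lemma ms_obI:
  assumes "\<And>i. i \<in> {1..n} \<Longrightarrow> O1 i \<in> Ob C" "\<And>i. i \<in> {1..<n} \<Longrightarrow> split_mono C (O1 i) (O1 (i + 1)) (A1 i)"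
  shows "MSeq (\<lambda>i\<in>{1..n}. O1 i) (\<lambda>i\<in>{1..<n}. A1 i) \<in> Ob (mor_sm C n)"
  using assms by (auto simp: mor_sm_def)

lemma ms_in: "f \<in> Hom (mor_sm C n) X Y \<Longrightarrow> i \<in> {1..n} \<Longrightarrow> f i \<in> Hom C (mob X i) (mob Y i)"
  by (auto simp: mor_sm_def)

lemma ms_comm: "f \<in> Hom (mor_sm C n) X Y \<Longrightarrow> i \<in> {1..<n} \<Longrightarrow> f (i + 1) \<cdot> mar X i = mar Y i \<cdot> f i"
  by (simp add: mor_sm_def)

lemma ms_extensional: "f \<in> Hom (mor_sm C n) X Y \<Longrightarrow> f \<in> extensional {1..n}"
  by (simp add: mor_sm_def PiE_def)

lemma ms_homI:
  assumes "\<And>i. i \<in> {1..n} \<Longrightarrow> f i \<in> Hom C (mob X i) (mob Y i)"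
    "\<And>i. i \<in> {1..<n} \<Longrightarrow> f (i + 1) \<cdot> mar X i = mar Y i \<cdot> f i"
  shows "(\<lambda>i\<in>{1..n}. f i) \<in> Hom (mor_sm C n) X Y"
  using assms by (simp add: mor_sm_def)

lemma ms_eqI: "f \<in> extensional {1..n} \<Longrightarrow> g \<in> extensional {1..n} \<Longrightarrow> (\<And>i. i \<in> {1..n} \<Longrightarrow> f i = g i) \<Longrightarrow> f = g"
  by (rule extensionalityI)

lemma preadditive_mor_sm: "preadditive_category (mor_sm C n)"
proof
  let ?M = "mor_sm C n"
  have suc: "i \<in> {1..n} \<and> i + 1 \<in> {1..n}" if "i \<in> {1..<n}" for i :: nat using that by auto
  note o = ms_ob[where n = n] and o1 = ms_ob[OF _ conjunct1[OF suc]] and o2 = ms_ob[OF _ conjunct2[OF suc]]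
    and h = ms_in[where n = n] and h1 = ms_in[OF _ conjunct1[OF suc]] and h2 = ms_in[OF _ conjunct2[OF suc]]
    and a = ms_mar_in[where n = n]
  show "Idm ?M X \<in> Hom ?M X X" if X: "X \<in> Ob ?M" for X
    unfolding ms_sel using X
    by (intro ms_homI) (auto simp: o Idm_in Idm_left[OF o1[OF X] o2[OF X] a[OF X], simplified]
      Idm_right[OF o1[OF X] o2[OF X] a[OF X], simplified])
  show "Cmp ?M g f \<in> Hom ?M X Z" if X: "X \<in> Ob ?M" and Y: "Y \<in> Ob ?M" and Z: "Z \<in> Ob ?M"
    and f: "f \<in> Hom ?M X Y" and g: "g \<in> Hom ?M Y Z" for X Y Z f g
    unfolding ms_sel
  proof (rule ms_homI)
    show "g i \<cdot> f i \<in> Hom C (mob X i) (mob Z i)" if i: "i \<in> {1..n}" for i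
      by (rule Cmp_in[OF o[OF X i] o[OF Y i] o[OF Z i] h[OF f i] h[OF g i]])
    show "(g (i + 1) \<cdot> f (i + 1)) \<cdot> mar X i = mar Z i \<cdot> g i \<cdot> f i" if i: "i \<in> {1..<n}" for i
      unfolding Cmp_assoc[OF o1[OF X i] o2[OF X i] o2[OF Y i] o2[OF Z i] a[OF X i] h2[OF f i] h2[OF g i]]
        ms_comm[OF f i] Cmp_assoc[OF o1[OF X i] o1[OF Y i] o2[OF Y i] o2[OF Z i] h1[OF f i] a[OF Y i] h2[OF g i], symmetric]
        ms_comm[OF g i] Cmp_assoc[OF o1[OF X i] o1[OF Y i] o1[OF Z i] o2[OF Z i] h1[OF f i] h1[OF g i] a[OF Z i]] ..
  qed
  show "Zro ?M X Y \<in> Hom ?M X Y" if X: "X \<in> Ob ?M" and Y: "Y \<in> Ob ?M" for X Y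
    unfolding ms_sel
  proof (rule ms_homI)
    show "Zro C (mob X i) (mob Y i) \<in> Hom C (mob X i) (mob Y i)" if i: "i \<in> {1..n}" for i
      by (rule Zro_in[OF o[OF X i] o[OF Y i]])
    show "Zro C (mob X (i + 1)) (mob Y (i + 1)) \<cdot> mar X i = mar Y i \<cdot> Zro C (mob X i) (mob Y i)" if i: "i \<in> {1..<n}" for i
      unfolding Cmp_Zro_left[OF o1[OF X i] o2[OF X i] o2[OF Y i] a[OF X i]]
        Cmp_Zro_right[OF o1[OF X i] o1[OF Y i] o2[OF Y i] a[OF Y i]] ..
  qed
  show "Add ?M f g \<in> Hom ?M X Y" if X: "X \<in> Ob ?M" and Y: "Y \<in> Ob ?M"
    and f: "f \<in> Hom ?M X Y" and g: "g \<in> Hom ?M X Y" for X Y f g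
    unfolding ms_sel
  proof (rule ms_homI)
    show "f i \<oplus> g i \<in> Hom C (mob X i) (mob Y i)" if i: "i \<in> {1..n}" for i
      by (rule Add_in[OF o[OF X i] o[OF Y i] h[OF f i] h[OF g i]])
    show "(f (i + 1) \<oplus> g (i + 1)) \<cdot> mar X i = mar Y i \<cdot> (f i \<oplus> g i)" if i: "i \<in> {1..<n}" for i
      unfolding Cmp_Add_left[OF o1[OF X i] o2[OF X i] o2[OF Y i] a[OF X i] h2[OF f i] h2[OF g i]]
        Cmp_Add_right[OF o1[OF X i] o1[OF Y i] o2[OF Y i] h1[OF f i] h1[OF g i] a[OF Y i]]
        ms_comm[OF f i] ms_comm[OF g i] ..
  qed
  show "Neg ?M f \<in> Hom ?M X Y" if X: "X \<in> Ob ?M" and Y: "Y \<in> Ob ?M" and f: "f \<in> Hom ?M X Y" for X Y f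
    unfolding ms_sel
  proof (rule ms_homI)
    show "Neg C (f i) \<in> Hom C (mob X i) (mob Y i)" if i: "i \<in> {1..n}" for i
      by (rule Neg_in[OF o[OF X i] o[OF Y i] h[OF f i]])
    show "Neg C (f (i + 1)) \<cdot> mar X i = mar Y i \<cdot> Neg C (f i)" if i: "i \<in> {1..<n}" for i
      unfolding Cmp_Neg_left[OF o1[OF X i] o2[OF X i] o2[OF Y i] a[OF X i] h2[OF f i]]
        Cmp_Neg_right[OF o1[OF X i] o1[OF Y i] o2[OF Y i] h1[OF f i] a[OF Y i]] ms_comm[OF f i] ..
  qed
  fix X Y assume X: "X \<in> Ob ?M" and Y: "Y \<in> Ob ?M"
  fix f assume f: "f \<in> Hom ?M X Y"
  note oX = o[OF X] and oY = o[OF Y] and hf = h[OF f] and ef = ms_extensional[OF f]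
  show "Idm ?M Y \<cdot>\<^bsub>?M\<^esub> f = f" "f \<cdot>\<^bsub>?M\<^esub> Idm ?M X = f" "f \<oplus>\<^bsub>?M\<^esub> Zro ?M X Y = f"
    "f \<oplus>\<^bsub>?M\<^esub> Neg ?M f = Zro ?M X Y"
    unfolding ms_sel
    by (rule ms_eqI[where n = n]; simp add: ef[unfolded One_nat_def] Idm_left[OF oX oY hf] Idm_right[OF oX oY hf] Add_Zro[OF oX oY hf] Add_Neg[OF oX oY hf])+
  fix g assume g: "g \<in> Hom ?M X Y"
  note hg = h[OF g]
  show "f \<oplus>\<^bsub>?M\<^esub> g = g \<oplus>\<^bsub>?M\<^esub> f"
    unfolding ms_sel by (rule ms_eqI[where n = n]) (simp_all add: Add_comm[OF oX oY hf hg])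
  fix k assume k: "k \<in> Hom ?M X Y"
  show "(f \<oplus>\<^bsub>?M\<^esub> g) \<oplus>\<^bsub>?M\<^esub> k = f \<oplus>\<^bsub>?M\<^esub> (g \<oplus>\<^bsub>?M\<^esub> k)"
    unfolding ms_sel by (rule ms_eqI[where n = n]) (simp_all add: Add_assoc[OF oX oY hf hg h[OF k]])
next
  let ?M = "mor_sm C n"
  note o = ms_ob[where n = n] and h = ms_in[where n = n]
  fix X Y Z f assume X: "X \<in> Ob ?M" and Y: "Y \<in> Ob ?M" and Z: "Z \<in> Ob ?M" and f: "f \<in> Hom ?M X Y"
  fix g assume g: "g \<in> Hom ?M Y Z"
  show "(k \<cdot>\<^bsub>?M\<^esub> g) \<cdot>\<^bsub>?M\<^esub> f = k \<cdot>\<^bsub>?M\<^esub> g \<cdot>\<^bsub>?M\<^esub> f" if W: "W \<in> Ob ?M" and k: "k \<in> Hom ?M Z W" for W k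
    unfolding ms_sel
    by (rule ms_eqI[where n = n]) (simp_all add: Cmp_assoc[OF o[OF X] o[OF Y] o[OF Z] o[OF W] h[OF f] h[OF g] h[OF k]])
  show "(g \<oplus>\<^bsub>?M\<^esub> k) \<cdot>\<^bsub>?M\<^esub> f = (g \<cdot>\<^bsub>?M\<^esub> f) \<oplus>\<^bsub>?M\<^esub> (k \<cdot>\<^bsub>?M\<^esub> f)" if k: "k \<in> Hom ?M Y Z" for k
    unfolding ms_sel
    by (rule ms_eqI[where n = n]) (simp_all add: Cmp_Add_left[OF o[OF X] o[OF Y] o[OF Z] h[OF f] h[OF g] h[OF k]])
  show "g \<cdot>\<^bsub>?M\<^esub> (f \<oplus>\<^bsub>?M\<^esub> k) = (g \<cdot>\<^bsub>?M\<^esub> f) \<oplus>\<^bsub>?M\<^esub> (g \<cdot>\<^bsub>?M\<^esub> k)" if k: "k \<in> Hom ?M X Y" for k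
    unfolding ms_sel
    by (rule ms_eqI[where n = n]) (simp_all add: Cmp_Add_right[OF o[OF X] o[OF Y] o[OF Z] h[OF f] h[OF k] h[OF g]])
qed

text \<open>Direct sums are chosen at each position; the diagonal maps of
  \<open>split_mono_sum\<close> connect them and are again split monomorphisms. The zero object is a
  constant sequence with zero arrows.\<close>

lemma additive_mor_sm: "additive_category (mor_sm C n)"
proof -
  let ?M = "mor_sm C n"
  interpret M: preadditive_category ?M by (rule preadditive_mor_sm)
  show ?thesis
  proof
    obtain O' where O': "is_zero_ob C O'" using zero_ob_ex by blast
    have O'_ob: "O' \<in> Ob C" using O' by (simp add: is_zero_ob_def)
    have into_O: "\<And>X f. X \<in> Ob C \<Longrightarrow> f \<in> Hom C X O' \<Longrightarrow> f = Zro C X O'"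
      and from_O: "\<And>X f. X \<in> Ob C \<Longrightarrow> f \<in> Hom C O' X \<Longrightarrow> f = Zro C O' X"
      using O' Zro_in unfolding is_zero_ob_def by metis+
    define Z where "Z = MSeq (\<lambda>i\<in>{1..n}. O') (\<lambda>i\<in>{1..<n}. Zro C O' O')"
    have Z: "Z \<in> Ob ?M" unfolding Z_def by (rule ms_obI) (simp_all add: O'_ob ebip_zero[OF _ O'])
    have mobZ: "mob Z i = O'" if "i \<in> {1..n}" for i using that by (simp add: Z_def)
    have "f = Zro ?M X Z" if X: "X \<in> Ob ?M" and f: "f \<in> Hom ?M X Z" for X f
    proof (rule ms_eqI[OF ms_extensional[OF f]])
      show "f i = Zro ?M X Z i" if i: "i \<in> {1..n}" for i
        using into_O[OF ms_ob[OF X i]] ms_in[OF f i] mobZ[OF i] i by (simp add: ms_sel)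
    qed (simp add: ms_sel)
    moreover have "f = Zro ?M Z X" if X: "X \<in> Ob ?M" and f: "f \<in> Hom ?M Z X" for X f
    proof (rule ms_eqI[OF ms_extensional[OF f]])
      show "f i = Zro ?M Z X i" if i: "i \<in> {1..n}" for i
        using from_O[OF ms_ob[OF X i]] ms_in[OF f i] mobZ[OF i] i by (simp add: ms_sel)
    qed (simp add: ms_sel)
    ultimately have "is_zero_ob ?M Z"
      unfolding is_zero_ob_def using Z M.Zro_in by metis
    then show "\<exists>Z. is_zero_ob ?M Z" by blast
  next
    fix X Y assume X: "X \<in> Ob ?M" and Y: "Y \<in> Ob ?M"
    have "\<forall>k\<in>{1..n}. \<exists>S i j p q. is_biproduct C (mob X k) (mob Y k) S i j p q"
      using biproduct_ex ms_ob[OF X] ms_ob[OF Y] by blast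
    then obtain S i j p q where b: "\<And>k. k \<in> {1..n} \<Longrightarrow> is_biproduct C (mob X k) (mob Y k) (S k) (i k) (j k) (p k) (q k)"
      by metis
    define c where "c k = (i (k + 1) \<cdot> mar X k \<cdot> p k) \<oplus> (j (k + 1) \<cdot> mar Y k \<cdot> q k)" for k
    have suc: "k \<in> {1..n} \<and> k + 1 \<in> {1..n}" if "k \<in> {1..<n}" for k :: nat using that by auto
    have c: "split_mono C (S k) (S (k + 1)) (c k)" "c k \<cdot> i k = i (k + 1) \<cdot> mar X k" "c k \<cdot> j k = j (k + 1) \<cdot> mar Y k"
      "p (k + 1) \<cdot> c k = mar X k \<cdot> p k" "q (k + 1) \<cdot> c k = mar Y k \<cdot> q k" if k: "k \<in> {1..<n}" for k
      unfolding c_def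
      by (rule split_mono_sum[OF b[OF conjunct1[OF suc[OF k]]] b[OF conjunct2[OF suc[OF k]]] ms_mar[OF X k] ms_mar[OF Y k]])+
    define T where "T = MSeq (\<lambda>k\<in>{1..n}. S k) (\<lambda>k\<in>{1..<n}. c k)"
    have bb: "S k \<in> Ob C" "i k \<in> Hom C (mob X k) (S k)" "j k \<in> Hom C (mob Y k) (S k)" "p k \<in> Hom C (S k) (mob X k)"
      "q k \<in> Hom C (S k) (mob Y k)"
      "p k \<cdot> i k = Idm C (mob X k)" "q k \<cdot> j k = Idm C (mob Y k)" "p k \<cdot> j k = Zro C (mob Y k) (mob X k)"
      "q k \<cdot> i k = Zro C (mob X k) (mob Y k)" "(i k \<cdot> p k) \<oplus> (j k \<cdot> q k) = Idm C (S k)"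
      if "k \<in> {1..n}" for k
      using b[OF that] by (auto simp: is_biproduct_def)
    have T: "T \<in> Ob ?M" unfolding T_def by (rule ms_obI) (use bb c in auto)
    have "is_biproduct ?M X Y T (\<lambda>k\<in>{1..n}. i k) (\<lambda>k\<in>{1..n}. j k) (\<lambda>k\<in>{1..n}. p k) (\<lambda>k\<in>{1..n}. q k)"
      unfolding is_biproduct_def
    proof (intro conjI X Y T)
      show "(\<lambda>k\<in>{1..n}. i k) \<in> Hom ?M X T" "(\<lambda>k\<in>{1..n}. j k) \<in> Hom ?M Y T"
        "(\<lambda>k\<in>{1..n}. p k) \<in> Hom ?M T X" "(\<lambda>k\<in>{1..n}. q k) \<in> Hom ?M T Y"
        by (rule ms_homI; use bb c in \<open>simp add: T_def\<close>)+
    qed (unfold ms_sel, (rule ms_eqI[where n = n]; use bb in \<open>simp add: T_def\<close>)+)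
    then show "\<exists>S i j p q. is_biproduct ?M X Y S i j p q" by blast
  qed
qed

end

section \<open>Componentwise contractibility\<close>

definition component :: "nat \<Rightarrow> (('o, 'm) mseq, nat \<Rightarrow> 'm) cplx \<Rightarrow> ('o, 'm) cplx" where
  "component k W = Cplx (\<lambda>m. mob (cob W m) k) (\<lambda>m. cdf W m k)"

lemma cob_component [simp]: "cob (component k W) m = mob (cob W m) k"
  and cdf_component [simp]: "cdf (component k W) m = cdf W m k"
  by (simp_all add: component_def)

context preadditive_category
begin

lemma contraction_iff:
  assumes X: "X \<in> complexes C" and h: "garr C (cob X) (-1) h (cob X)"
  shows "gid C (cob X) = df C X * arr C (cob X) (-1) h (cob X) + arr C (cob X) (-1) h (cob X) * df C X
    \<longleftrightarrow> (\<forall>n. Idm C (cob X n) = (cdf X (n - 1) \<cdot> h n) \<oplus> (h (n + 1) \<cdot> cdf X n))"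
proof -
  have dX: "garr C (cob X) 1 (cdf X) (cob X)" using X by (simp add: complexes_iff)
  have dh: "garr C (cob X) 0 (\<lambda>n. cdf X (n - 1) \<cdot> h n) (cob X)"
    using garr_mult[OF dX h] by simp
  have hd: "garr C (cob X) 0 (\<lambda>n. h (n + 1) \<cdot> cdf X n) (cob X)"
    using garr_mult[OF h dX] by simp
  have "df C X * arr C (cob X) (-1) h (cob X) + arr C (cob X) (-1) h (cob X) * df C X
    = arr C (cob X) 0 (\<lambda>n. (cdf X (n - 1) \<cdot> h n) \<oplus> (h (n + 1) \<cdot> cdf X n)) (cob X)"
    using arr_mult[OF dX h] arr_mult[OF h dX] arr_add[OF dh hd] by (simp add: df_def)
  then show ?thesis
    using arr_inj[OF garr_Idm garr_add[OF dh hd]] complexes_ob[OF X] unfolding gid_def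
    by (metis (no_types, lifting) ext)
qed

lemma contr_iff:
  assumes X: "X \<in> complexes C"
  shows "contr C X \<longleftrightarrow> (\<exists>h. \<forall>n. h n \<in> Hom C (cob X n) (cob X (n - 1)) \<and>
    Idm C (cob X n) = (cdf X (n - 1) \<cdot> h n) \<oplus> (h (n + 1) \<cdot> cdf X n))"
proof -
  have g: "garr C (cob X) (-1) h (cob X) \<longleftrightarrow> (\<forall>n. h n \<in> Hom C (cob X n) (cob X (n - 1)))" for h
    using complexes_ob[OF X] by (simp add: garr_def preadditive_category_axioms)
  have "contr C X \<longleftrightarrow> (\<exists>h. garr C (cob X) (-1) h (cob X) \<and>
      gid C (cob X) = df C X * arr C (cob X) (-1) h (cob X) + arr C (cob X) (-1) h (cob X) * df C X)"
    unfolding contr_def nul_def gHom_def by blast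
  also have "\<dots> \<longleftrightarrow> (\<exists>h. garr C (cob X) (-1) h (cob X) \<and>
      (\<forall>n. Idm C (cob X n) = (cdf X (n - 1) \<cdot> h n) \<oplus> (h (n + 1) \<cdot> cdf X n)))"
    by (intro iff_exI conj_cong refl contraction_iff[OF X])
  finally show ?thesis unfolding g by (simp only: all_conj_distrib)
qed

text \<open>A contraction extends along a degreewise split monomorphism into a contractible complex:
  first through the degreewise retraction, then correcting by a contraction of the target, which
  does not disturb the values on the subcomplex.\<close>

lemma extend_contraction:
  assumes X: "X \<in> complexes C" and Y: "Y \<in> complexes C" and a: "a \<in> cmap C X Y"
    and r: "r \<in> gHom C (cob Y) 0 (cob X)" "r * a = gid C (cob X)"
    and h: "h \<in> gHom C (cob X) (-1) (cob X)" "gid C (cob X) = df C X * h + h * df C X"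
    and c: "contr C Y"
  obtains k where "k \<in> gHom C (cob Y) (-1) (cob Y)" "gid C (cob Y) = df C Y * k + k * df C Y"
    "k * a = a * h"
proof -
  obtain c where c: "c \<in> gHom C (cob Y) (-1) (cob Y)" "gid C (cob Y) = df C Y * c + c * df C Y"
    using c by (auto simp: contr_def nul_def)
  define l where "l = a * h * r"
  \<comment> \<open>The failure of \<open>l\<close> to be a contraction. It is a chain map that
    vanishes after \<open>a\<close>, so \<open>c * g\<close>, whose boundary is \<open>g\<close>,
    repairs \<open>l\<close> without affecting the equation \<open>l * a = a * h\<close>.\<close>
  define g where "g = gid C (cob Y) - (df C Y * l + l * df C Y)"
  note ai = cmap_in[OF a] and ob = complexes_ob[OF Y]
  have l: "l \<in> gHom C (cob Y) (-1) (cob Y)"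
    unfolding l_def by (rule gHom_mult[OF gHom_mult[OF ai h(1) refl] r(1)]) simp
  have la: "l * a = a * h"
    using r(2) gid_right[OF h(1)] by (simp add: l_def mult.assoc)
  have g_cmap: "g \<in> cmap C Y Y"
    unfolding g_def by (intro cmap_minus cmap_gid Y nul_cmap[OF Y Y] nulI[OF l refl])
  have "g * a = a - (df C Y * (l * a) + l * (df C Y * a))"
    unfolding g_def using gid_left[OF ai] by (simp add: algebra_simps)
  also have "\<dots> = a - (df C Y * a * h + (l * a) * df C X)"
    by (simp add: la cmap_df[OF a] mult.assoc[symmetric])
  also have "\<dots> = a - a * gid C (cob X)"
    by (simp add: la cmap_df[OF a] h(2) algebra_simps)
  finally have ga: "g * a = 0" using gid_right[OF ai] by simp
  show ?thesis
  proof (rule that)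
    show "l + c * g \<in> gHom C (cob Y) (-1) (cob Y)"
      using gHom_mult[OF c(1) cmap_in[OF g_cmap]] by (intro gHom_add l) simp
    have "df C Y * (l + c * g) + (l + c * g) * df C Y = df C Y * l + l * df C Y + (df C Y * c + c * df C Y) * g"
      by (simp add: algebra_simps cmap_df[OF g_cmap, symmetric])
    also have "\<dots> = gid C (cob Y)"
      unfolding c(2)[symmetric] gid_left[OF cmap_in[OF g_cmap]] by (simp add: g_def)
    finally show "gid C (cob Y) = df C Y * (l + c * g) + (l + c * g) * df C Y" ..
    show "(l + c * g) * a = a * h" by (simp add: algebra_simps la ga)
  qed
qed

end

context additive_category
begin

lemma component_complexes:
  assumes W: "W \<in> complexes (mor_sm C n)" and k: "k \<in> {1..n}"
  shows "component k W \<in> complexes C"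
proof -
  have ob: "cob W m \<in> Ob (mor_sm C n)" and d: "cdf W m \<in> Hom (mor_sm C n) (cob W m) (cob W (m + 1))"
    and dd: "cdf W (m + 1) \<cdot>\<^bsub>mor_sm C n\<^esub> cdf W m = Zro (mor_sm C n) (cob W m) (cob W (m + 2))" for m
    using W by (auto simp: complexes_def)
  have "cdf W (m + 1) k \<cdot> cdf W m k = Zro C (mob (cob W m) k) (mob (cob W (m + 2)) k)" for m
    using fun_cong[OF dd[of m], of k] k by (simp add: ms_sel)
  then show ?thesis
    using ms_ob[OF ob k] ms_in[OF d k] by (simp add: complexes_def)
qed

lemma contr_component:
  assumes W: "W \<in> complexes (mor_sm C n)" and k: "k \<in> {1..n}" and c: "contr (mor_sm C n) W"
  shows "contr C (component k W)"
proof -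
  interpret M: additive_category "mor_sm C n" by (rule additive_mor_sm)
  obtain h where h: "\<And>m. h m \<in> Hom (mor_sm C n) (cob W m) (cob W (m - 1))"
    "\<And>m. Idm (mor_sm C n) (cob W m) =
       (cdf W (m - 1) \<cdot>\<^bsub>mor_sm C n\<^esub> h m) \<oplus>\<^bsub>mor_sm C n\<^esub> (h (m + 1) \<cdot>\<^bsub>mor_sm C n\<^esub> cdf W m)"
    using c M.contr_iff[OF W] by blast
  have "Idm C (mob (cob W m) k) = (cdf W (m - 1) k \<cdot> h m k) \<oplus> (h (m + 1) k \<cdot> cdf W m k)" for m
    using fun_cong[OF h(2)[of m], of k] k by (simp add: ms_sel)
  then show ?thesis
    unfolding contr_iff[OF component_complexes[OF W k]] using ms_in[OF h(1) k]
    by (intro exI[of _ "\<lambda>m. h m k"]) simp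
qed

text \<open>Arbitrary contractions of the components need not commute with the structure maps. They
  are chosen successively along the sequence, each extending the previous one, so that together they
  form morphisms of sequences.\<close>

lemma contr_of_components:
  assumes W: "W \<in> complexes (mor_sm C n)" and c: "\<And>k. k \<in> {1..n} \<Longrightarrow> contr C (component k W)"
  shows "contr (mor_sm C n) W"
proof -
  interpret M: additive_category "mor_sm C n" by (rule additive_mor_sm)
  let ?X = "\<lambda>k. component k W" and ?G = "\<lambda>k. cob (component k W)"
  define A where "A k = mp C (?X k) (?X (k + 1)) (\<lambda>m. mar (cob W m) k)" for k
  have ob: "cob W m \<in> Ob (mor_sm C n)" and d: "cdf W m \<in> Hom (mor_sm C n) (cob W m) (cob W (m + 1))" for m
    using W by (auto simp: complexes_def)
  have cx: "?X k \<in> complexes C" if "k \<in> {1..n}" for k using component_complexes[OF W that] .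
  have gA: "garr C (?G k) 0 (\<lambda>m. mar (cob W m) k) (?G (k + 1))" if k: "k \<in> {1..<n}" for k
    using ms_mar_in[OF ob k] cx[of k] cx[of "k + 1"] k complexes_ob
    by (fastforce simp: garr_def preadditive_category_axioms)
  have A: "A k \<in> cmap C (?X k) (?X (k + 1))" if k: "k \<in> {1..<n}" for k
    unfolding A_def
    using ms_mar_in[OF ob k] ms_comm[OF d k] cx[of k] cx[of "k + 1"] k
    by (intro chain_maps_mp) (auto simp: chain_maps_def)
  \<comment> \<open>These retractions are chosen degree by degree and need not commute with the
    differentials; \<open>extend_contraction\<close> asks for no more.\<close>
  have retr: "\<exists>r\<in>gHom C (?G (k + 1)) 0 (?G k). r * A k = gid C (?G k)" if k: "k \<in> {1..<n}" for k
  proof -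
    have "\<exists>r. r \<in> Hom C (mob (cob W m) (k + 1)) (mob (cob W m) k) \<and> r \<cdot> mar (cob W m) k = Idm C (mob (cob W m) k)" for m
    proof -
      obtain Z j p q where "ebip (mob (cob W m) k) Z (mob (cob W m) (k + 1))
         (ar (mob (cob W m) k) (mar (cob W m) k) (mob (cob W m) (k + 1))) j p q"
        using split_monoE[OF ms_mar[OF ob k]] .
      from ebipE[OF this] obtain i' p' where i': "ar (mob (cob W m) k) (mar (cob W m) k) (mob (cob W m) (k + 1))
          = ar (mob (cob W m) k) i' (mob (cob W m) (k + 1))" "i' \<in> Hom C (mob (cob W m) k) (mob (cob W m) (k + 1))"
        and p': "p' \<in> Hom C (mob (cob W m) (k + 1)) (mob (cob W m) k)" "p' \<cdot> i' = Idm C (mob (cob W m) k)"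
        unfolding is_biproduct_def by metis
      have "i' = mar (cob W m) k"
        using i' ms_mar[OF ob k] ar_inj split_mono_hom by metis
      then show ?thesis using p' by blast
    qed
    then obtain r where r: "\<And>m. r m \<in> Hom C (mob (cob W m) (k + 1)) (mob (cob W m) k)"
      "\<And>m. r m \<cdot> mar (cob W m) k = Idm C (mob (cob W m) k)" by metis
    have gr: "garr C (?G (k + 1)) 0 r (?G k)"
      using r gA[OF k] by (simp add: garr_def)
    show ?thesis
      by (rule bexI[OF _ gHomI[OF gr]]) (use arr_mult[OF gr gA[OF k]] r(2) in \<open>simp add: A_def mp_def gid_def\<close>)
  qed
  \<comment> \<open>The second conjunct is the condition that the family \<open>H\<close> commutes
    with the structure maps, which later makes its values morphisms of
    \<open>mor_sm C n\<close>.\<close>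
  have "\<exists>H. (\<forall>k\<in>{1..m}. H k \<in> gHom C (?G k) (-1) (?G k) \<and> gid C (?G k) = df C (?X k) * H k + H k * df C (?X k)) \<and>
      (\<forall>k\<in>{1..<m}. H (k + 1) * A k = A k * H k)" if "m \<le> n" for m
    using that
  proof (induction m)
    case 0 show ?case by simp
  next
    case (Suc m)
    obtain H where H: "\<And>k. k \<in> {1..m} \<Longrightarrow> H k \<in> gHom C (?G k) (-1) (?G k) \<and>
        gid C (?G k) = df C (?X k) * H k + H k * df C (?X k)"
      "\<And>k. k \<in> {1..<m} \<Longrightarrow> H (k + 1) * A k = A k * H k" using Suc.IH[OF Suc_leD[OF Suc.prems]] by blast
    have Sm: "Suc m \<in> {1..n}" using Suc.prems by simp
    obtain k where k: "k \<in> gHom C (?G (Suc m)) (-1) (?G (Suc m))"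
      "gid C (?G (Suc m)) = df C (?X (Suc m)) * k + k * df C (?X (Suc m))" "m \<ge> 1 \<Longrightarrow> k * A m = A m * H m"
    proof (cases "m \<ge> 1")
      case True
      then have m: "m \<in> {1..<n}" "m \<in> {1..n}" "m \<in> {1..m}" using Suc.prems by auto
      obtain r where r: "r \<in> gHom C (?G (m + 1)) 0 (?G m)" "r * A m = gid C (?G m)" using retr[OF m(1)] by blast
      obtain k where "k \<in> gHom C (?G (m + 1)) (-1) (?G (m + 1))"
        "gid C (?G (m + 1)) = df C (?X (m + 1)) * k + k * df C (?X (m + 1))" "k * A m = A m * H m"
        using extend_contraction[OF cx[OF m(2)] _ A[OF m(1)] r _ _ c] H(1)[OF m(3)] Sm cx by auto
      then show ?thesis using that by simp
    next
      case False
      \<comment> \<open>For the first component there is nothing to extend, and any contraction will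
        do.\<close>
      then show ?thesis using that c[OF Sm] by (auto simp: contr_def nul_def)
    qed
    show ?case
    proof (rule exI[of _ "H(Suc m := k)"], intro conjI ballI)
      fix l assume "l \<in> {1..Suc m}"
      then consider "l = Suc m" | "l \<in> {1..m}" "l \<noteq> Suc m" by fastforce
      then show "(H(Suc m := k)) l \<in> gHom C (?G l) (-1) (?G l)"
        "gid C (?G l) = df C (?X l) * (H(Suc m := k)) l + (H(Suc m := k)) l * df C (?X l)"
        using k H by (cases; simp)+
    next
      fix l assume "l \<in> {1..<Suc m}"
      then consider "l = m" "m \<ge> 1" | "l \<in> {1..<m}" by fastforce
      then show "(H(Suc m := k)) (l + 1) * A l = A l * (H(Suc m := k)) l"
        using k H by (cases; simp)
    qed
  qed
  from this[of n] obtain H where H: "\<And>k. k \<in> {1..n} \<Longrightarrow> H k \<in> gHom C (?G k) (-1) (?G k)"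
    "\<And>k. k \<in> {1..n} \<Longrightarrow> gid C (?G k) = df C (?X k) * H k + H k * df C (?X k)"
    "\<And>k. k \<in> {1..<n} \<Longrightarrow> H (k + 1) * A k = A k * H k" by blast
  have "\<forall>k\<in>{1..n}. \<exists>f. garr C (?G k) (-1) f (?G k) \<and> H k = arr C (?G k) (-1) f (?G k)"
    using H(1) unfolding gHom_def by blast
  then obtain f where f: "\<And>k. k \<in> {1..n} \<Longrightarrow> garr C (?G k) (-1) (f k) (?G k)"
    "\<And>k. k \<in> {1..n} \<Longrightarrow> H k = arr C (?G k) (-1) (f k) (?G k)" by metis
  have fin: "f k m \<in> Hom C (mob (cob W m) k) (mob (cob W (m - 1)) k)" if "k \<in> {1..n}" for k m
    using f(1)[OF that] by (simp add: garr_def)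
  have fd: "Idm C (mob (cob W m) k) = (cdf W (m - 1) k \<cdot> f k m) \<oplus> (f k (m + 1) \<cdot> cdf W m k)" if k: "k \<in> {1..n}" for k m
    using H(2)[OF k] contraction_iff[OF cx[OF k] f(1)[OF k]] f(2)[OF k] by simp
  have fA: "f (k + 1) m \<cdot> mar (cob W m) k = mar (cob W (m - 1)) k \<cdot> f k m" if k: "k \<in> {1..<n}" for k m
  proof -
    have k': "k \<in> {1..n}" "k + 1 \<in> {1..n}" using k by auto
    have "arr C (?G k) (-1) (\<lambda>m. f (k + 1) m \<cdot> mar (cob W m) k) (?G (k + 1))
        = arr C (?G k) (-1) (\<lambda>m. mar (cob W (m - 1)) k \<cdot> f k m) (?G (k + 1))"
      using H(3)[OF k] arr_mult[OF f(1)[OF k'(2)] gA[OF k]] arr_mult[OF gA[OF k] f(1)[OF k'(1)]] f(2)[OF k'(1)] f(2)[OF k'(2)]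
      by (simp add: A_def mp_def)
    from arr_inj[OF _ _ this] show ?thesis
      using garr_mult[OF f(1)[OF k'(2)] gA[OF k]] garr_mult[OF gA[OF k] f(1)[OF k'(1)]] by (simp add: fun_eq_iff)
  qed
  show ?thesis
    unfolding M.contr_iff[OF W]
  proof (rule exI[of _ "\<lambda>m. \<lambda>k\<in>{1..n}. f k m"], intro allI conjI)
    fix m
    show "(\<lambda>k\<in>{1..n}. f k m) \<in> Hom (mor_sm C n) (cob W m) (cob W (m - 1))"
      by (rule ms_homI) (use fin fA in auto)
    show "Idm (mor_sm C n) (cob W m) = (cdf W (m - 1) \<cdot>\<^bsub>mor_sm C n\<^esub> (\<lambda>k\<in>{1..n}. f k m)) \<oplus>\<^bsub>mor_sm C n\<^esub>
        ((\<lambda>k\<in>{1..n}. f k (m + 1)) \<cdot>\<^bsub>mor_sm C n\<^esub> cdf W m)"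
      unfolding ms_sel by (rule ms_eqI[where n = n]) (use fd in simp_all)
  qed
qed

lemma contr_mor_sm_iff:
  assumes W: "W \<in> complexes (mor_sm C n)"
  shows "contr (mor_sm C n) W \<longleftrightarrow> (\<forall>k\<in>{1..n}. contr C (component k W))"
  using contr_of_components[OF W] contr_component[OF W] by blast

text \<open>A common form for all kernels that occur: every class E and every kernel of a collapse
  or truncation is determined by a set of positions at which the component is contractible.\<close>

definition KerPt :: "nat \<Rightarrow> nat set \<Rightarrow> (('o, 'm) mseq, nat \<Rightarrow> 'm) cplx set" where
  "KerPt n S = {W \<in> complexes (mor_sm C n). \<forall>k\<in>S. contr C (component k W)}"

lemma D_restrict_complexes:
  assumes W: "W \<in> complexes (mor_sm C n)" and st: "1 \<le> s" "s \<le> t" "t \<le> n"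
  shows "D_restrict s t W \<in> complexes (mor_sm C (t - s + 1))"
proof -
  let ?l = "t - s + 1"
  have ob: "cob W m \<in> Ob (mor_sm C n)" and d: "cdf W m \<in> Hom (mor_sm C n) (cob W m) (cob W (m + 1))"
    and dd: "cdf W (m + 1) \<cdot>\<^bsub>mor_sm C n\<^esub> cdf W m = Zro (mor_sm C n) (cob W m) (cob W (m + 2))" for m
    using W by (auto simp: complexes_def)
  have idx: "s + k - 1 \<in> {1..n}" if "k \<in> {1..?l}" for k using that st by auto
  have idx': "s + k - 1 \<in> {1..<n}" "s + (k + 1) - 1 = s + k - 1 + 1" if "k \<in> {1..<?l}" for k using that st by auto
  have "seq_restrict s t (cob W m) \<in> Ob (mor_sm C ?l)" for m
    unfolding seq_restrict_def
    by (rule ms_obI) (use ms_ob[OF ob idx] ms_mar[OF ob idx'(1)] idx'(2) in auto)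
  moreover have "tuple_restrict s t (cdf W m) \<in> Hom (mor_sm C ?l) (seq_restrict s t (cob W m)) (seq_restrict s t (cob W (m + 1)))" for m
    unfolding tuple_restrict_def
  proof (rule ms_homI)
    show "cdf W m (s + k - 1) \<in> Hom C (mob (seq_restrict s t (cob W m)) k) (mob (seq_restrict s t (cob W (m + 1))) k)"
      if "k \<in> {1..?l}" for k
      using ms_in[OF d idx[OF that]] that by (simp add: seq_restrict_def)
    show "cdf W m (s + (k + 1) - 1) \<cdot> mar (seq_restrict s t (cob W m)) k = mar (seq_restrict s t (cob W (m + 1))) k \<cdot> cdf W m (s + k - 1)"
      if "k \<in> {1..<?l}" for k
      using ms_comm[OF d idx'(1)[OF that]] that idx'(2)[OF that] by (simp add: seq_restrict_def)
  qed
  moreover have "tuple_restrict s t (cdf W (m + 1)) \<cdot>\<^bsub>mor_sm C ?l\<^esub> tuple_restrict s t (cdf W m)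
     = Zro (mor_sm C ?l) (seq_restrict s t (cob W m)) (seq_restrict s t (cob W (m + 2)))" for m
    unfolding ms_sel
  proof (rule ms_eqI[where n = ?l])
    show "(\<lambda>i\<in>{1..?l}. tuple_restrict s t (cdf W (m + 1)) i \<cdot> tuple_restrict s t (cdf W m) i) k =
      (\<lambda>i\<in>{1..?l}. Zro C (mob (seq_restrict s t (cob W m)) i) (mob (seq_restrict s t (cob W (m + 2))) i)) k"
      if k: "k \<in> {1..?l}" for k
      using fun_cong[OF dd[of m], of "s + k - 1"] k idx[OF k] by (simp add: ms_sel tuple_restrict_def seq_restrict_def)
  qed simp_all
  ultimately show ?thesis by (simp add: complexes_def D_restrict_def)
qed

text \<open>The restricted sequence vanishes in its homotopy category exactly if it is contractible,
  and this is decided by its components, which are the components of \<open>W\<close> at the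
  positions \<open>s + k - 1\<close>.\<close>

lemma Ker_D_eq:
  assumes st: "1 \<le> s" "s \<le> t" "t \<le> N - 1"
  shows "Ker_D C N s t = KerPt (N - 1) {s..t}"
proof -
  interpret M: additive_category "mor_sm C (N - 1)" by (rule additive_mor_sm)
  interpret L: additive_category "mor_sm C (t - s + 1)" by (rule additive_mor_sm)
  have "is_zero_ob (K (mor_sm C (t - s + 1))) (D_restrict s t W) \<longleftrightarrow> (\<forall>k\<in>{s..t}. contr C (component k W))"
    if W: "W \<in> complexes (mor_sm C (N - 1))" for W
  proof -
    note D = D_restrict_complexes[OF W st]
    have "component k (D_restrict s t W) = component (s + k - 1) W" if "k \<in> {1..t - s + 1}" for k
      using that by (simp add: component_def D_restrict_def seq_restrict_def tuple_restrict_def)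
    then have "contr (mor_sm C (t - s + 1)) (D_restrict s t W) \<longleftrightarrow>
        (\<forall>k\<in>{1..t - s + 1}. contr C (component (s + k - 1) W))"
      by (simp add: contr_mor_sm_iff[OF D] del: One_nat_def)
    also have "\<dots> \<longleftrightarrow> (\<forall>k\<in>(\<lambda>k. s + k - 1) ` {1..t - s + 1}. contr C (component k W))" by blast
    also have "(\<lambda>k. s + k - 1) ` {1..t - s + 1} = {s..t}"
    proof
      show "{s..t} \<subseteq> (\<lambda>k. s + k - 1) ` {1..t - s + 1}"
        by (rule subsetI, rule_tac x = "x - s + 1" in image_eqI) (use st in auto)
    qed (use st in auto)
    finally show ?thesis unfolding L.K_zero_iff using D by blast
  qed
  then show ?thesis unfolding Ker_D_def KerPt_def M.K_sel(1) by blast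
qed

end

section \<open>Collapsing and truncating sequences\<close>

primrec steps :: "('o, 'm, 'z) preadd_scheme \<Rightarrow> ('o, 'm) mseq \<Rightarrow> nat \<Rightarrow> nat \<Rightarrow> 'm" where
  "steps C X a 0 = Idm C (mob X a)"
| "steps C X a (Suc k) = mar X (a + k) \<cdot>\<^bsub>C\<^esub> steps C X a k"

text \<open>For \<open>b < a\<close> the value is junk, namely the identity of \<open>X a\<close>.\<close>

definition path :: "('o, 'm, 'z) preadd_scheme \<Rightarrow> ('o, 'm) mseq \<Rightarrow> nat \<Rightarrow> nat \<Rightarrow> 'm" where
  "path C X a b = steps C X a (b - a)"

lemma path_refl: "path C X a a = Idm C (mob X a)"
  by (simp add: path_def)

lemma path_Suc: "a \<le> b \<Longrightarrow> path C X a (Suc b) = mar X b \<cdot>\<^bsub>C\<^esub> path C X a b"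
  by (simp add: path_def Suc_diff_le)

context additive_category
begin

lemma split_mono_path:
  assumes X: "X \<in> Ob (mor_sm C n)" and a: "1 \<le> a" and ab: "a \<le> b" and b: "b \<le> n"
  shows "split_mono C (mob X a) (mob X b) (path C X a b)"
  using ab b
proof (induction b rule: dec_induct)
  case base
  then show ?case using ms_ob[OF X, of a] a by (simp add: path_refl split_mono_Idm)
next
  case (step b)
  then show ?case
    using split_mono_Cmp[OF _ ms_mar[OF X, of b]] a by (simp add: path_Suc)
qed

lemma path_in:
  assumes "X \<in> Ob (mor_sm C n)" "1 \<le> a" "a \<le> b" "b \<le> n"
  shows "path C X a b \<in> Hom C (mob X a) (mob X b)"
  using split_mono_hom(1)[OF split_mono_path[OF assms]] .

lemma path_one:
  assumes X: "X \<in> Ob (mor_sm C n)" and a: "a \<in> {1..<n}"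
  shows "path C X a (a + 1) = mar X a"
  using Idm_right[OF _ _ ms_mar_in[OF X a]] ms_ob[OF X, of a] ms_ob[OF X, of "a + 1"] a
  by (simp add: path_Suc path_refl)

lemma path_trans:
  assumes X: "X \<in> Ob (mor_sm C n)" and a: "1 \<le> a" "a \<le> b" and bc: "b \<le> c" and c: "c \<le> n"
  shows "path C X b c \<cdot> path C X a b = path C X a c"
  using bc c
proof (induction c rule: dec_induct)
  case base
  then show ?case
    using Idm_left[OF _ _ path_in[OF X a base]] ms_ob[OF X, of a] ms_ob[OF X, of b] a by (simp add: path_refl)
next
  case (step c)
  have "(mar X c \<cdot> path C X b c) \<cdot> path C X a b = mar X c \<cdot> path C X b c \<cdot> path C X a b"
    using step.hyps step.prems a path_in[OF X] ms_mar_in[OF X, of c]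
    by (intro Cmp_assoc[of "mob X a" "mob X b" "mob X c" "mob X (c + 1)"]) (auto intro: ms_ob[OF X])
  then show ?case using step a by (simp add: path_Suc)
qed

lemma path_natural:
  assumes X: "X \<in> Ob (mor_sm C n)" and Y: "Y \<in> Ob (mor_sm C n)" and f: "f \<in> Hom (mor_sm C n) X Y"
    and a: "1 \<le> a" and ab: "a \<le> b" and b: "b \<le> n"
  shows "f b \<cdot> path C X a b = path C Y a b \<cdot> f a"
  using ab b
proof (induction b rule: dec_induct)
  case base
  then have i: "a \<in> {1..n}" using a by simp
  show ?case
    using Idm_left[OF ms_ob[OF X i] ms_ob[OF Y i] ms_in[OF f i]] Idm_right[OF ms_ob[OF X i] ms_ob[OF Y i] ms_in[OF f i]]
    by (simp add: path_refl)
next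
  case (step b)
  then have i: "a \<in> {1..n}" "b \<in> {1..n}" "b + 1 \<in> {1..n}" "b \<in> {1..<n}" using a by auto
  note oX = ms_ob[OF X] and oY = ms_ob[OF Y]
  have p: "path C X a b \<in> Hom C (mob X a) (mob X b)" "path C Y a b \<in> Hom C (mob Y a) (mob Y b)"
    using path_in[OF X a step.hyps(1)] path_in[OF Y a step.hyps(1)] i by auto
  have "f (b + 1) \<cdot> mar X b \<cdot> path C X a b = (f (b + 1) \<cdot> mar X b) \<cdot> path C X a b"
    by (rule Cmp_assoc[symmetric, OF oX[OF i(1)] oX[OF i(2)] oX[OF i(3)] oY[OF i(3)] p(1) ms_mar_in[OF X i(4)] ms_in[OF f i(3)]])
  also have "\<dots> = mar Y b \<cdot> f b \<cdot> path C X a b"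
    unfolding ms_comm[OF f i(4)]
    by (rule Cmp_assoc[OF oX[OF i(1)] oX[OF i(2)] oY[OF i(2)] oY[OF i(3)] p(1) ms_in[OF f i(2)] ms_mar_in[OF Y i(4)]])
  also have "\<dots> = mar Y b \<cdot> path C Y a b \<cdot> f a" using step by simp
  also have "\<dots> = (mar Y b \<cdot> path C Y a b) \<cdot> f a"
    by (rule Cmp_assoc[symmetric, OF oX[OF i(1)] oY[OF i(1)] oY[OF i(2)] oY[OF i(3)] ms_in[OF f i(1)] p(2) ms_mar_in[OF Y i(4)]])
  finally show ?case using step.hyps by (simp add: path_Suc)
qed

end

section \<open>Collapsing along a monotone idempotent map of positions\<close>

locale collapse = additive_category +
  fixes n :: nat and \<sigma> :: "nat \<Rightarrow> nat"
  assumes \<sigma>_in: "i \<in> {1..n} \<Longrightarrow> \<sigma> i \<in> {1..n}"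
    and \<sigma>_mono: "\<lbrakk>i \<in> {1..n}; j \<in> {1..n}; i \<le> j\<rbrakk> \<Longrightarrow> \<sigma> i \<le> \<sigma> j"
    and \<sigma>_idem: "i \<in> {1..n} \<Longrightarrow> \<sigma> (\<sigma> i) = \<sigma> i"
begin

text \<open>A sequence is a functor on the ordered set \<open>{1..n}\<close>, and this is
  precomposition with \<open>\<sigma>\<close>. Its arrows are composites of split monomorphisms, or
  identities where \<open>\<sigma>\<close> is constant.\<close>

definition colO :: "('a, 'b) mseq \<Rightarrow> ('a, 'b) mseq" where
  "colO X = MSeq (\<lambda>i\<in>{1..n}. mob X (\<sigma> i)) (\<lambda>i\<in>{1..<n}. path C X (\<sigma> i) (\<sigma> (i + 1)))"

definition colM :: "(nat \<Rightarrow> 'b) \<Rightarrow> (nat \<Rightarrow> 'b)" where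
  "colM f = (\<lambda>i\<in>{1..n}. f (\<sigma> i))"

lemma \<sigma>_bounds: "i \<in> {1..n} \<Longrightarrow> 1 \<le> \<sigma> i" "i \<in> {1..n} \<Longrightarrow> \<sigma> i \<le> n"
  using \<sigma>_in by auto

lemma suc_in: "i \<in> {1..<n} \<Longrightarrow> i \<in> {1..n}" "i \<in> {1..<n} \<Longrightarrow> i + 1 \<in> {1..n}"
  by auto

lemma \<sigma>_suc: "i \<in> {1..<n} \<Longrightarrow> \<sigma> i \<le> \<sigma> (i + 1)"
  by (rule \<sigma>_mono) auto

lemma mob_colO: "i \<in> {1..n} \<Longrightarrow> mob (colO X) i = mob X (\<sigma> i)"
  and mar_colO: "i \<in> {1..<n} \<Longrightarrow> mar (colO X) i = path C X (\<sigma> i) (\<sigma> (i + 1))"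
  by (simp_all add: colO_def)

lemma colO_in: assumes X: "X \<in> Ob (mor_sm C n)" shows "colO X \<in> Ob (mor_sm C n)"
  unfolding colO_def
  by (rule ms_obI) (use ms_ob[OF X \<sigma>_in] split_mono_path[OF X \<sigma>_bounds(1)[OF suc_in(1)] \<sigma>_suc \<sigma>_bounds(2)[OF suc_in(2)]] in auto)

text \<open>With \<open>path_trans\<close> the composites of a collapsed sequence telescope. This
  yields strict idempotence, and it makes the natural transformations equal to identities on
  collapsed sequences.\<close>

lemma path_colO:
  assumes X: "X \<in> Ob (mor_sm C n)" and a: "1 \<le> a" and ab: "a \<le> b" and b: "b \<le> n"
  shows "path C (colO X) a b = path C X (\<sigma> a) (\<sigma> b)"
  using ab b
proof (induction b rule: dec_induct)
  case base
  then show ?case using a by (simp add: path_refl mob_colO)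
next
  case (step b)
  then have i: "a \<in> {1..n}" "b \<in> {1..n}" "b + 1 \<in> {1..n}" "b \<in> {1..<n}" using a by auto
  have "path C (colO X) a (Suc b) = path C X (\<sigma> b) (\<sigma> (b + 1)) \<cdot> path C X (\<sigma> a) (\<sigma> b)"
    using step mar_colO[OF i(4)] by (simp add: path_Suc)
  also have "\<dots> = path C X (\<sigma> a) (\<sigma> (b + 1))"
    by (rule path_trans[OF X \<sigma>_bounds(1)[OF i(1)] \<sigma>_mono[OF i(1,2) step.hyps(1)] \<sigma>_suc[OF i(4)] \<sigma>_bounds(2)[OF i(3)]])
  finally show ?case by simp
qed

lemma mseq_eqI:
  assumes "X \<in> Ob (mor_sm C n)" "Y \<in> Ob (mor_sm C n)"
    and "\<And>i. i \<in> {1..n} \<Longrightarrow> mob X i = mob Y i" "\<And>i. i \<in> {1..<n} \<Longrightarrow> mar X i = mar Y i"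
  shows "X = Y"
proof -
  have "mob X = mob Y"
    using assms(1,2) by (intro extensionalityI[OF _ _ assms(3)]) (auto simp: mor_sm_def PiE_def)
  moreover have "mar X = mar Y"
    using assms(1,2) by (intro extensionalityI[OF _ _ assms(4)]) (auto simp: mor_sm_def)
  ultimately show ?thesis by (cases X; cases Y) simp
qed

lemma idempotent: "idempotent_functor (mor_sm C n) colO colM"
proof -
  let ?M = "mor_sm C n"
  interpret M: additive_category ?M by (rule additive_mor_sm)
  show ?thesis
  proof
    show "colO X \<in> Ob ?M" if "X \<in> Ob ?M" for X using colO_in[OF that] .
    show "colM f \<in> Hom ?M (colO X) (colO Y)" if X: "X \<in> Ob ?M" and Y: "Y \<in> Ob ?M" and f: "f \<in> Hom ?M X Y" for X Y f
      unfolding colM_def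
    proof (rule ms_homI)
      show "f (\<sigma> i) \<in> Hom C (mob (colO X) i) (mob (colO Y) i)" if "i \<in> {1..n}" for i
        using ms_in[OF f \<sigma>_in[OF that]] that by (simp add: mob_colO)
      show "f (\<sigma> (i + 1)) \<cdot> mar (colO X) i = mar (colO Y) i \<cdot> f (\<sigma> i)" if i: "i \<in> {1..<n}" for i
        unfolding mar_colO[OF i]
        by (rule path_natural[OF X Y f \<sigma>_bounds(1)[OF suc_in(1)[OF i]] \<sigma>_suc[OF i] \<sigma>_bounds(2)[OF suc_in(2)[OF i]]])
    qed
    show "colM (Idm ?M X) = Idm ?M (colO X)" for X
      unfolding colM_def ms_sel by (rule ms_eqI[where n = n]) (use \<sigma>_in in \<open>auto simp: mob_colO\<close>)
    show "colM (g \<cdot>\<^bsub>?M\<^esub> f) = colM g \<cdot>\<^bsub>?M\<^esub> colM f" for f g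
      unfolding colM_def ms_sel by (rule ms_eqI[where n = n]) (use \<sigma>_in in auto)
    show "colM (f \<oplus>\<^bsub>?M\<^esub> g) = colM f \<oplus>\<^bsub>?M\<^esub> colM g" for f g
      unfolding colM_def ms_sel by (rule ms_eqI[where n = n]) (use \<sigma>_in in auto)
    show "colO (colO X) = colO X" if X: "X \<in> Ob ?M" for X
    proof (rule mseq_eqI[OF colO_in[OF colO_in[OF X]] colO_in[OF X]])
      show "mob (colO (colO X)) i = mob (colO X) i" if "i \<in> {1..n}" for i
        using that \<sigma>_in by (simp add: mob_colO \<sigma>_idem del: atLeastAtMost_iff)
      show "mar (colO (colO X)) i = mar (colO X) i" if i: "i \<in> {1..<n}" for i
        unfolding mar_colO[OF i]
          path_colO[OF X \<sigma>_bounds(1)[OF suc_in(1)[OF i]] \<sigma>_suc[OF i] \<sigma>_bounds(2)[OF suc_in(2)[OF i]]]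
          \<sigma>_idem[OF suc_in(1)[OF i]] \<sigma>_idem[OF suc_in(2)[OF i]] ..
    qed
  qed
qed

text \<open>If \<open>\<sigma>\<close> moves positions down, the sequence maps from the entry at
  \<open>\<sigma> i\<close> to the entry at \<open>i\<close>. Collapsing this map gives the path
  from \<open>\<sigma> i\<close> to itself, by idempotence of \<open>\<sigma>\<close>.\<close>

lemma coreflection:
  assumes le: "\<And>i. i \<in> {1..n} \<Longrightarrow> \<sigma> i \<le> i"
  shows "coreflection (mor_sm C n) colO colM (\<lambda>X. \<lambda>i\<in>{1..n}. path C X (\<sigma> i) i)"
proof -
  let ?M = "mor_sm C n" and ?u = "\<lambda>X. \<lambda>i\<in>{1..n}. path C X (\<sigma> i) i"
  interpret M: idempotent_functor ?M colO colM by (rule idempotent)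
  show ?thesis
  proof
    show "?u X \<in> Hom ?M (colO X) X" if X: "X \<in> Ob ?M" for X
    proof (rule ms_homI)
      show "path C X (\<sigma> i) i \<in> Hom C (mob (colO X) i) (mob X i)" if "i \<in> {1..n}" for i
        using path_in[OF X \<sigma>_bounds(1) le] that by (simp add: mob_colO)
      show "path C X (\<sigma> (i + 1)) (i + 1) \<cdot> mar (colO X) i = mar X i \<cdot> path C X (\<sigma> i) i" if i: "i \<in> {1..<n}" for i
      proof -
        note i' = suc_in[OF i]
        have "path C X (\<sigma> (i + 1)) (i + 1) \<cdot> mar (colO X) i = path C X (\<sigma> i) (i + 1)"
          unfolding mar_colO[OF i]
          by (rule path_trans[OF X \<sigma>_bounds(1)[OF i'(1)] \<sigma>_suc[OF i] le[OF i'(2)]]) (use i in simp)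
        then show ?thesis using le[OF i'(1)] by (simp add: path_Suc)
      qed
    qed
    show "f \<cdot>\<^bsub>?M\<^esub> ?u X = ?u Y \<cdot>\<^bsub>?M\<^esub> colM f" if X: "X \<in> Ob ?M" and Y: "Y \<in> Ob ?M" and f: "f \<in> Hom ?M X Y" for X Y f
      unfolding ms_sel colM_def
      by (rule ms_eqI[where n = n]) (use path_natural[OF X Y f \<sigma>_bounds(1) le] in simp_all)
    show "?u (colO X) = Idm ?M (colO X)" if X: "X \<in> Ob ?M" for X
      unfolding ms_sel
      by (rule ms_eqI[where n = n])
        (use path_colO[OF X \<sigma>_bounds(1) le] \<sigma>_idem in \<open>simp_all add: path_refl mob_colO\<close>)
    show "colM (?u X) = Idm ?M (colO X)" if X: "X \<in> Ob ?M" for X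
      unfolding ms_sel colM_def
      by (rule ms_eqI[where n = n])
        (use \<sigma>_in in \<open>auto simp: path_refl mob_colO \<sigma>_idem simp del: atLeastAtMost_iff\<close>)
  qed
qed

lemma reflection:
  assumes ge: "\<And>i. i \<in> {1..n} \<Longrightarrow> i \<le> \<sigma> i"
  shows "reflection (mor_sm C n) colO colM (\<lambda>X. \<lambda>i\<in>{1..n}. path C X i (\<sigma> i))"
proof -
  let ?M = "mor_sm C n" and ?v = "\<lambda>X. \<lambda>i\<in>{1..n}. path C X i (\<sigma> i)"
  interpret M: idempotent_functor ?M colO colM by (rule idempotent)
  show ?thesis
  proof
    show "?v X \<in> Hom ?M X (colO X)" if X: "X \<in> Ob ?M" for X
    proof (rule ms_homI)
      show "path C X i (\<sigma> i) \<in> Hom C (mob X i) (mob (colO X) i)" if "i \<in> {1..n}" for i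
        using path_in[OF X _ ge \<sigma>_bounds(2)] that by (simp add: mob_colO)
      show "path C X (i + 1) (\<sigma> (i + 1)) \<cdot> mar X i = mar (colO X) i \<cdot> path C X i (\<sigma> i)" if i: "i \<in> {1..<n}" for i
      proof -
        note i' = suc_in[OF i]
        have "mar (colO X) i \<cdot> path C X i (\<sigma> i) = path C X i (\<sigma> (i + 1))"
          unfolding mar_colO[OF i]
          by (rule path_trans[OF X _ ge[OF i'(1)] \<sigma>_suc[OF i] \<sigma>_bounds(2)[OF i'(2)]]) (use i in simp)
        moreover have "path C X (i + 1) (\<sigma> (i + 1)) \<cdot> path C X i (i + 1) = path C X i (\<sigma> (i + 1))"
          by (rule path_trans[OF X _ _ ge[OF i'(2)] \<sigma>_bounds(2)[OF i'(2)]]) (use i in auto)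
        ultimately show ?thesis using path_one[OF X i] by simp
      qed
    qed
    show "colM f \<cdot>\<^bsub>?M\<^esub> ?v X = ?v Y \<cdot>\<^bsub>?M\<^esub> f" if X: "X \<in> Ob ?M" and Y: "Y \<in> Ob ?M" and f: "f \<in> Hom ?M X Y" for X Y f
      unfolding ms_sel colM_def
      by (rule ms_eqI[where n = n]) (use path_natural[OF X Y f _ ge \<sigma>_bounds(2)] in simp_all)
    show "?v (colO X) = Idm ?M (colO X)" if X: "X \<in> Ob ?M" for X
      unfolding ms_sel
      by (rule ms_eqI[where n = n])
        (use path_colO[OF X _ ge \<sigma>_bounds(2)] \<sigma>_idem in \<open>simp_all add: path_refl mob_colO\<close>)
    show "colM (?v X) = Idm ?M (colO X)" if X: "X \<in> Ob ?M" for X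
      unfolding ms_sel colM_def
      by (rule ms_eqI[where n = n])
        (use \<sigma>_in in \<open>auto simp: path_refl mob_colO \<sigma>_idem simp del: atLeastAtMost_iff\<close>)
  qed
qed

text \<open>The component of the collapsed complex at \<open>k\<close> is the component of
  \<open>W\<close> at \<open>\<sigma> k\<close>, so contractibility is tested precisely at the
  values of \<open>\<sigma>\<close>.\<close>

lemma Kernel_eq: "idempotent_functor.Kernel (mor_sm C n) colO colM = KerPt n (\<sigma> ` {1..n})"
proof -
  interpret M: idempotent_functor "mor_sm C n" colO colM by (rule idempotent)
  have "contr (mor_sm C n) (M.R W) \<longleftrightarrow> (\<forall>k\<in>\<sigma> ` {1..n}. contr C (component k W))" if W: "W \<in> complexes (mor_sm C n)" for W
  proof -
    have "component k (M.R W) = component (\<sigma> k) W" if "k \<in> {1..n}" for k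
      using that by (simp add: component_def M.R_def mob_colO colM_def)
    then show ?thesis by (simp add: contr_mor_sm_iff[OF M.R_complexes[OF W]])
  qed
  then show ?thesis by (auto simp: M.Kernel_def KerPt_def)
qed

text \<open>If \<open>\<sigma>\<close> collapses exactly the block \<open>{s..t}\<close>, the sequences fixed by the functor are those that
  are constant on the block.\<close>

lemma Image_eq:
  assumes s: "1 \<le> s" and c: "c \<in> {s..t}" and t: "t \<le> n"
    and block: "\<And>i. i \<in> {1..n} \<Longrightarrow> \<sigma> i = (if i \<in> {s..t} then c else i)" and n: "n = N - 1"
  shows "idempotent_functor.Image (mor_sm C n) colO colM = F_int C N s t"
proof -
  let ?M = "mor_sm C n"
  interpret M: idempotent_functor ?M colO colM by (rule idempotent)
  define strict where "strict Y \<longleftrightarrow>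
     (\<forall>m. \<forall>i\<in>{s..<t}. mob (cob Y m) (i + 1) = mob (cob Y m) i \<and> mar (cob Y m) i = Idm C (mob (cob Y m) i))"
    for Y :: "(('a, 'b) mseq, nat \<Rightarrow> 'b) cplx"
  have in_n: "i \<in> {1..n}" if "i \<in> {s..t}" for i using that s t by auto
  have R_strict: "strict (M.R Y)" if Y: "Y \<in> complexes ?M" for Y
    unfolding strict_def
  proof (intro allI ballI)
    fix m i assume i: "i \<in> {s..<t}"
    then have i': "i \<in> {1..<n}" "i \<in> {1..n}" "i + 1 \<in> {1..n}" "i \<in> {s..t}" "i + 1 \<in> {s..t}" using s t by auto
    then have "\<sigma> i = c" "\<sigma> (i + 1) = c" using block by (auto simp del: atLeastAtMost_iff)
    then show "mob (cob (M.R Y) m) (i + 1) = mob (cob (M.R Y) m) i \<and> mar (cob (M.R Y) m) i = Idm C (mob (cob (M.R Y) m) i)"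
      using mob_colO[OF i'(2)] mob_colO[OF i'(3)] mar_colO[OF i'(1)] by (simp add: path_refl)
  qed
  have R_id: "M.R Y = Y" if Y: "Y \<in> complexes ?M" and st: "strict Y" for Y
  proof -
    have ob: "cob Y m \<in> Ob ?M" and d: "cdf Y m \<in> Hom ?M (cob Y m) (cob Y (m + 1))" for m
      using Y by (auto simp: complexes_def)
    have block_path: "mob (cob Y m) b = mob (cob Y m) a \<and> path C (cob Y m) a b = Idm C (mob (cob Y m) a)"
      if a: "s \<le> a" and ab: "a \<le> b" and b: "b \<le> t" for a b m
      using ab b
    proof (induction b rule: dec_induct)
      case base show ?case by (simp add: path_refl)
    next
      case (step b)
      then have "b \<in> {s..<t}" using a by auto
      then have "mob (cob Y m) (b + 1) = mob (cob Y m) b" "mar (cob Y m) b = Idm C (mob (cob Y m) b)"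
        using st by (auto simp: strict_def)
      moreover have "mob (cob Y m) a \<in> Ob C" by (rule ms_ob[OF ob]) (use a s t step in auto)
      ultimately show ?case using step by (simp add: path_Suc Idm_Idm)
    qed
    have mob_eq: "mob (cob Y m) b = mob (cob Y m) a" if "a \<in> {s..t}" "b \<in> {s..t}" for a b m
      using block_path[of a b m] block_path[of b a m] that by (cases "a \<le> b") auto
    \<comment> \<open>Differentials commute with the paths inside the block, which are identities,
      so they agree at all positions of the block.\<close>
    have d_eq: "cdf Y m b = cdf Y m a" if "a \<in> {s..t}" "b \<in> {s..t}" for a b m
    proof -
      have le: "cdf Y m b = cdf Y m a" if a: "a \<in> {s..t}" and b: "b \<in> {s..t}" and ab: "a \<le> b" for a b
      proof -
        have p: "path C (cob Y m) a b = Idm C (mob (cob Y m) a)" for m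
          using block_path[of a b m] a b ab by auto
        have "cdf Y m b \<cdot> path C (cob Y m) a b = path C (cob Y (m + 1)) a b \<cdot> cdf Y m a"
          by (rule path_natural[OF ob ob d]) (use a b ab s t in auto)
        moreover have "cdf Y m b \<in> Hom C (mob (cob Y m) a) (mob (cob Y (m + 1)) a)"
          using ms_in[OF d in_n[OF b]] mob_eq[OF a b] by simp
        ultimately show ?thesis
          unfolding p using Idm_left[OF ms_ob[OF ob in_n[OF a]] ms_ob[OF ob in_n[OF a]] ms_in[OF d in_n[OF a]]]
            Idm_right[OF ms_ob[OF ob in_n[OF a]] ms_ob[OF ob in_n[OF a]]] by simp
      qed
      show ?thesis using le[OF that] le[OF that(2,1)] by (cases "a \<le> b") auto
    qed
    have "colO (cob Y m) = cob Y m" for m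
    proof (rule mseq_eqI[OF colO_in[OF ob] ob])
      show "mob (colO (cob Y m)) i = mob (cob Y m) i" if i: "i \<in> {1..n}" for i
        using block[OF i] mob_eq[OF _ c, of i] mob_colO[OF i] by (simp del: atLeastAtMost_iff)
      show "mar (colO (cob Y m)) i = mar (cob Y m) i" if i: "i \<in> {1..<n}" for i
      proof -
        note i' = suc_in[OF i]
        have p: "path C (cob Y m) i (i + 1) = mar (cob Y m) i" by (rule path_one[OF ob i])
        note ii = ms_ob[OF ob i'(1)] ms_ob[OF ob i'(2)] ms_mar_in[OF ob i]
        \<comment> \<open>The arrow from \<open>i\<close> to \<open>i + 1\<close> lies inside the
          block, enters it, leaves it or misses it. At the two borders the collapsed arrow also runs
          through part of the block, between \<open>c\<close> and the border, but that part is an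
          identity.\<close>
        consider (both) "i \<in> {s..t}" "i + 1 \<in> {s..t}" | (enter) "i \<notin> {s..t}" "i + 1 = s"
          | (leave) "i = t" "i + 1 \<notin> {s..t}" | (out) "i \<notin> {s..t}" "i + 1 \<notin> {s..t}"
          using c by fastforce
        then show ?thesis
        proof cases
          case both
          then have "mar (cob Y m) i = Idm C (mob (cob Y m) i)" using st by (auto simp: strict_def)
          then show ?thesis
            using both block[OF i'(1)] block[OF i'(2)] mob_eq[OF c both(1)] mar_colO[OF i] by (simp add: path_refl)
        next
          case enter
          have "path C (cob Y m) i c = path C (cob Y m) (i + 1) c \<cdot> path C (cob Y m) i (i + 1)"
            by (rule path_trans[OF ob, symmetric]) (use i c t enter in auto)
          also have "\<dots> = mar (cob Y m) i"
            unfolding p using block_path[of "i + 1" c m] enter c Idm_left[OF ii] by simp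
          finally show ?thesis using enter c block[OF i'(1)] block[OF i'(2)] mar_colO[OF i] by auto
        next
          case leave
          have pc: "path C (cob Y m) c t = Idm C (mob (cob Y m) t)" using block_path[of c t m] c by auto
          have "path C (cob Y m) c (i + 1) = path C (cob Y m) t (i + 1) \<cdot> path C (cob Y m) c t"
            by (rule path_trans[OF ob, symmetric]) (use i c s leave in auto)
          also have "\<dots> = mar (cob Y m) i"
            unfolding pc using p leave Idm_right[OF ii] by simp
          finally show ?thesis using leave c block[OF i'(1)] block[OF i'(2)] mar_colO[OF i] by auto
        next
          case out
          then show ?thesis using p block[OF i'(1)] block[OF i'(2)] mar_colO[OF i] by auto
        qed
      qed
    qed
    moreover have "colM (cdf Y m) = cdf Y m" for m
    proof (rule ms_eqI[OF _ ms_extensional[OF d]])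
      show "colM (cdf Y m) i = cdf Y m i" if i: "i \<in> {1..n}" for i
        using block[OF i] d_eq[OF _ c, of i] i by (auto simp: colM_def simp del: atLeastAtMost_iff)
    qed (simp add: colM_def)
    ultimately show ?thesis by (cases Y) (simp add: M.R_def)
  qed
  \<comment> \<open>Collapsed complexes are strict, and strict ones are their own collapse, so being
    homotopy equivalent to either kind is the same.\<close>
  have "(\<exists>Y\<in>complexes ?M. heq ?M X (M.R Y)) \<longleftrightarrow> (\<exists>Y\<in>complexes ?M. heq ?M X Y \<and> strict Y)" for X
    using R_strict R_id M.R_complexes by metis
  then show ?thesis
    unfolding M.Image_def F_int_def n[symmetric] M.K_sel(1) strict_def[symmetric]
    by (auto simp: M.K_isomorphic_iff)
qed

end

text \<open>Contractibility of the cone makes both \<open>J\<close> and \<open>P\<close>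
  null-homotopic, which yields a homotopy section \<open>r\<close> and a homotopy retraction
  \<open>l\<close> of \<open>a\<close>.\<close>

lemma (in mapping_cone) heq_of_contr_cone:
  assumes "contr C M" shows "heq C X Y"
proof -
  have "nul C Y M J" using contr_orth_right[OF assms] J_cmap by (simp add: orth_def)
  then obtain r where r: "r \<in> cmap C Y X" "nul C Y Y (a * r - gid C (cob Y))"
    using section_of_nul_J by blast
  have "nul C M (shift_cplx C X) P" using contr_orth_left[OF assms] P_cmap by (simp add: orth_def)
  then obtain l where l: "l \<in> cmap C Y X" "nul C X X (l * a - gid C (cob X))"
    using retraction_of_nul_P by blast
  \<comment> \<open>The difference expands to \<open>r - l\<close>: left and right inverse agree up
    to homotopy, so \<open>r\<close> inverts \<open>a\<close> on both sides.\<close>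
  have "nul C Y X (l * (a * r - gid C (cob Y)) - (l * a - gid C (cob X)) * r)"
    using nul_left[OF l(1) r(2)] nul_right[OF r(1) l(2)] by (rule nul_minus)
  then have "nul C X X ((r - l) * a + (l * a - gid C (cob X)))"
    using gid_right[OF cmap_in[OF l(1)]] gid_left[OF cmap_in[OF r(1)]]
    by (intro nul_add nul_right[OF a] l(2)) (simp add: algebra_simps)
  then have "nul C X X (r * a - gid C (cob X))" by (simp add: algebra_simps)
  then show ?thesis unfolding heq_def using a r by blast
qed

section \<open>Replacing an initial segment by zero\<close>

locale truncation = additive_category +
  fixes n s :: nat and O' :: 'a
  assumes O': "is_zero_ob C O'" and s: "1 \<le> s" "s < n"
begin

text \<open>The zeros stand at the beginning because zero embeds as a summand into every object,
  whereas only zero objects embed as summands into zero. One fixed zero object \<open>O'\<close> is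
  used at all positions, so that truncating twice is literally truncating once.\<close>

definition tO :: "('a, 'b) mseq \<Rightarrow> ('a, 'b) mseq" where
  "tO X = MSeq (\<lambda>i\<in>{1..n}. if i \<le> s then O' else mob X i)
     (\<lambda>i\<in>{1..<n}. if i \<le> s then Zro C O' (if i + 1 \<le> s then O' else mob X (i + 1)) else mar X i)"

definition tM :: "(nat \<Rightarrow> 'b) \<Rightarrow> (nat \<Rightarrow> 'b)" where
  "tM f = (\<lambda>i\<in>{1..n}. if i \<le> s then Zro C O' O' else f i)"

definition tu :: "('a, 'b) mseq \<Rightarrow> (nat \<Rightarrow> 'b)" where
  "tu X = (\<lambda>i\<in>{1..n}. if i \<le> s then Zro C O' (mob X i) else Idm C (mob X i))"

lemma O'_ob: "O' \<in> Ob C"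
  using O' by (simp add: is_zero_ob_def)

lemma Idm_O': "Idm C O' = Zro C O' O'"
  using O' O'_ob Idm_in Zro_in unfolding is_zero_ob_def by metis

lemma mob_tO: "i \<in> {1..n} \<Longrightarrow> mob (tO X) i = (if i \<le> s then O' else mob X i)"
  and mar_tO: "i \<in> {1..<n} \<Longrightarrow> mar (tO X) i = (if i \<le> s then Zro C O' (if i + 1 \<le> s then O' else mob X (i + 1)) else mar X i)"
  by (simp_all add: tO_def)

lemma tO_in: assumes X: "X \<in> Ob (mor_sm C n)" shows "tO X \<in> Ob (mor_sm C n)"
  unfolding tO_def
proof (rule ms_obI)
  show "(if i \<le> s then O' else mob X i) \<in> Ob C" if "i \<in> {1..n}" for i
    using ms_ob[OF X that] O'_ob by simp
  show "split_mono C (if i \<le> s then O' else mob X i) (if i + 1 \<le> s then O' else mob X (i + 1))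
      (if i \<le> s then Zro C O' (if i + 1 \<le> s then O' else mob X (i + 1)) else mar X i)" if i: "i \<in> {1..<n}" for i
    using ms_mar[OF X i] ms_ob[OF X, of "i + 1"] i O'_ob ebip_zero[OF _ O'] by auto
qed

lemma coreflection: "coreflection (mor_sm C n) tO tM tu"
proof -
  let ?M = "mor_sm C n"
  interpret M: additive_category ?M by (rule additive_mor_sm)
  have ob: "mob X i \<in> Ob C" "mob X (i + 1) \<in> Ob C" if "X \<in> Ob ?M" "i \<in> {1..<n}" for X i
    using ms_ob[OF that(1), of i] ms_ob[OF that(1), of "i + 1"] that(2) by auto
  have zz: "Zro C O' O' \<cdot> Zro C O' O' = Zro C O' O'" "Zro C O' O' \<oplus> Zro C O' O' = Zro C O' O'"
    using O'_ob Zro_in[of O' O'] Cmp_Zro_left[of O' O' O'] Add_Zro[of O' O'] by simp_all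
  note z = O'_ob Zro_in Idm_in Cmp_Zro_left Cmp_Zro_right Idm_O' zz
  show ?thesis
  proof
    show "tO X \<in> Ob ?M" if "X \<in> Ob ?M" for X using tO_in[OF that] .
    show "tM f \<in> Hom ?M (tO X) (tO Y)" if X: "X \<in> Ob ?M" and Y: "Y \<in> Ob ?M" and f: "f \<in> Hom ?M X Y" for X Y f
      unfolding tM_def
    proof (rule ms_homI)
      show "(if i \<le> s then Zro C O' O' else f i) \<in> Hom C (mob (tO X) i) (mob (tO Y) i)" if "i \<in> {1..n}" for i
        using ms_in[OF f that] by (simp add: mob_tO[OF that] z)
      show "(if i + 1 \<le> s then Zro C O' O' else f (i + 1)) \<cdot> mar (tO X) i
          = mar (tO Y) i \<cdot> (if i \<le> s then Zro C O' O' else f i)" if i: "i \<in> {1..<n}" for i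
      proof -
        have "f (i + 1) \<in> Hom C (mob X (i + 1)) (mob Y (i + 1))" using ms_in[OF f, of "i + 1"] i by auto
        then show ?thesis
          using ms_comm[OF f i] ob[OF X i] ob[OF Y i] by (auto simp: mar_tO[OF i] z)
      qed
    qed
    show "tM (Idm ?M X) = Idm ?M (tO X)" for X
      unfolding tM_def ms_sel by (rule ms_eqI[where n = n]) (auto simp: mob_tO Idm_O')
    show "tM (g \<cdot>\<^bsub>?M\<^esub> f) = tM g \<cdot>\<^bsub>?M\<^esub> tM f" for f g
      unfolding tM_def ms_sel by (rule ms_eqI[where n = n]) (auto simp: z)
    show "tM (f \<oplus>\<^bsub>?M\<^esub> g) = tM f \<oplus>\<^bsub>?M\<^esub> tM g" for f g
      unfolding tM_def ms_sel by (rule ms_eqI[where n = n]) (auto simp: z Add_Zro)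
    show "tO (tO X) = tO X" for X
      unfolding tO_def by (auto intro!: ext)
    show "tu X \<in> Hom ?M (tO X) X" if X: "X \<in> Ob ?M" for X
      unfolding tu_def
    proof (rule ms_homI)
      show "(if i \<le> s then Zro C O' (mob X i) else Idm C (mob X i)) \<in> Hom C (mob (tO X) i) (mob X i)" if "i \<in> {1..n}" for i
        using ms_ob[OF X that] by (simp add: mob_tO[OF that] z)
      show "(if i + 1 \<le> s then Zro C O' (mob X (i + 1)) else Idm C (mob X (i + 1))) \<cdot> mar (tO X) i
          = mar X i \<cdot> (if i \<le> s then Zro C O' (mob X i) else Idm C (mob X i))" if i: "i \<in> {1..<n}" for i
        using ob[OF X i] ms_mar_in[OF X i] Idm_left[of "mob X i" "mob X (i + 1)" "mar X i"]
          Idm_right[of "mob X i" "mob X (i + 1)" "mar X i"]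
        by (auto simp: mar_tO[OF i] z)
    qed
    show "f \<cdot>\<^bsub>?M\<^esub> tu X = tu Y \<cdot>\<^bsub>?M\<^esub> tM f" if X: "X \<in> Ob ?M" and Y: "Y \<in> Ob ?M" and f: "f \<in> Hom ?M X Y" for X Y f
      unfolding ms_sel
    proof (rule ms_eqI[where n = n])
      show "(\<lambda>i\<in>{1..n}. f i \<cdot> tu X i) i = (\<lambda>i\<in>{1..n}. tu Y i \<cdot> tM f i) i" if i: "i \<in> {1..n}" for i
        using i ms_ob[OF X i] ms_ob[OF Y i] ms_in[OF f i] Idm_left[OF _ _ ms_in[OF f i]] Idm_right[OF _ _ ms_in[OF f i]]
        by (auto simp: tu_def tM_def z)
    qed simp_all
    show "tu (tO X) = Idm ?M (tO X)" if X: "X \<in> Ob ?M" for X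
      unfolding ms_sel tu_def by (rule ms_eqI[where n = n]) (auto simp: mob_tO Idm_O')
    show "tM (tu X) = Idm ?M (tO X)" if X: "X \<in> Ob ?M" for X
      unfolding ms_sel tu_def tM_def by (rule ms_eqI[where n = n]) (auto simp: mob_tO Idm_O')
  qed
qed

lemma component_R:
  assumes W: "W \<in> complexes (mor_sm C n)" and k: "k \<in> {1..n}"
  shows "s < k \<Longrightarrow> component k (idempotent_functor.R tO tM W) = component k W"
    and "k \<le> s \<Longrightarrow> contr C (component k (idempotent_functor.R tO tM W))"
proof -
  interpret M: coreflection "mor_sm C n" tO tM tu by (rule coreflection)
  show "component k (M.R W) = component k W" if "s < k"
    using that k by (simp add: component_def M.R_def mob_tO tM_def)
  assume ks: "k \<le> s"
  have "component k (M.R W) = Cplx (\<lambda>_. O') (\<lambda>_. Zro C O' O')"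
    using ks k by (simp add: component_def M.R_def mob_tO tM_def)
  then have "gid C (cob (component k (M.R W))) = 0"
    using arr_Zro[of "\<lambda>_. O'" "\<lambda>_. O'" 0] O'_ob by (simp add: gid_def Idm_O')
  then show "contr C (component k (M.R W))"
    unfolding contr_def using nul_0 component_complexes[OF M.R_complexes[OF W] k] by simp
qed

lemma Kernel_eq: "idempotent_functor.Kernel (mor_sm C n) tO tM = KerPt n {s + 1..n}"
proof -
  interpret M: coreflection "mor_sm C n" tO tM tu by (rule coreflection)
  have "contr (mor_sm C n) (M.R W) \<longleftrightarrow> (\<forall>k\<in>{s + 1..n}. contr C (component k W))" if W: "W \<in> complexes (mor_sm C n)" for W
  proof -
    have "contr C (component k (M.R W)) \<longleftrightarrow> (s < k \<longrightarrow> contr C (component k W))" if k: "k \<in> {1..n}" for k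
      using component_R[OF W k] by (cases "s < k") auto
    then have "(\<forall>k\<in>{1..n}. contr C (component k (M.R W))) \<longleftrightarrow> (\<forall>k\<in>{1..n}. s < k \<longrightarrow> contr C (component k W))"
      by blast
    also have "\<dots> \<longleftrightarrow> (\<forall>k\<in>{s + 1..n}. contr C (component k W))" by auto
    finally show ?thesis by (simp only: contr_mor_sm_iff[OF M.R_complexes[OF W]])
  qed
  then show ?thesis by (auto simp: M.Kernel_def KerPt_def)
qed

text \<open>Suppose the first \<open>s\<close> components of \<open>X\<close> are contractible. The
  cone of the map from the truncation to \<open>X\<close> then has contractible components up to
  \<open>s\<close>, and beyond \<open>s\<close> because it lies in the kernel. So it is
  contractible, and the map is a homotopy equivalence.\<close>

lemma Image_eq: "idempotent_functor.Image (mor_sm C n) tO tM = KerPt n {1..s}"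
proof -
  let ?M = "mor_sm C n"
  interpret M: coreflection ?M tO tM tu by (rule coreflection)
  \<comment> \<open>Collapsing onto the first \<open>s\<close> positions has
    \<open>KerPt n {1..s}\<close> as its kernel. Hence this class is triangulated, in particular
    closed under isomorphism and cones.\<close>
  interpret c: collapse C n "\<lambda>i. min i s" by unfold_locales (use s in auto)
  interpret m: coreflection ?M c.colO c.colM "\<lambda>X. \<lambda>i\<in>{1..n}. path C X (min i s) i"
    by (rule c.coreflection) simp
  have "(\<lambda>i. min i s) ` {1..n} = {1..s}"
  proof
    show "{1..s} \<subseteq> (\<lambda>i. min i s) ` {1..n}"
      by (rule subsetI, rule_tac x = x in image_eqI) (use s in auto)
  qed (use s in auto)
  then have tri: "triangulated_subcat (K ?M) (KerPt n {1..s})"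
    using m.coreflection_stable(3) c.Kernel_eq by simp
  have R_ker: "M.R W \<in> KerPt n {1..s}" if W: "W \<in> complexes ?M" for W
    using component_R(2)[OF W] M.R_complexes[OF W] s by (auto simp: KerPt_def)
  show ?thesis
  proof
    show "M.Image \<subseteq> KerPt n {1..s}"
    proof
      fix X assume "X \<in> M.Image"
      then obtain Y where X: "X \<in> complexes ?M" and Y: "Y \<in> complexes ?M" "heq ?M X (M.R Y)"
        by (auto simp: M.Image_def)
      then have "isomorphic (K ?M) (M.R Y) X"
        using M.K_isomorphic_iff[OF M.R_complexes[OF Y(1)] X] M.heq_sym by blast
      then show "X \<in> KerPt n {1..s}"
        using tri R_ker[OF Y(1)] X unfolding triangulated_subcat_def M.K_sel(1) by blast
    qed
    show "KerPt n {1..s} \<subseteq> M.Image"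
    proof
      fix X assume ker: "X \<in> KerPt n {1..s}"
      then have X: "X \<in> complexes ?M" by (simp add: KerPt_def)
      note RX = M.R_complexes[OF X]
      obtain D i j p q where cone: "is_cone ?M (M.R X) X (\<lambda>m. tu (cob X m)) D i j p q"
        using M.cone_ex[OF RX X M.u_chain[OF X]] by blast
      have "D \<in> M.Kernel"
        by (rule M.cone_in_Kernel[OF cone M.R_R[OF X]]) (simp add: M.RM_u M.complexes_ob[OF X] M.RO_RO)
      moreover have "D \<in> KerPt n {1..s}"
        using tri M.standard_triangle_distinguished[OF cone] R_ker[OF X] ker unfolding triangulated_subcat_def by blast
      ultimately have D: "D \<in> KerPt n {s + 1..n}" "D \<in> KerPt n {1..s}" using Kernel_eq by auto
      then have "contr C (component k D)" if "k \<in> {1..n}" for k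
        using that unfolding KerPt_def by (cases "k \<le> s") auto
      then have "contr ?M D" using D(1) contr_of_components by (simp add: KerPt_def del: One_nat_def)
      then have "heq ?M (M.R X) X"
        by (rule mapping_cone.heq_of_contr_cone[OF M.mapping_cone_of_is_cone[OF cone]])
      then show "X \<in> M.Image" using X M.heq_sym by (auto simp: M.Image_def)
    qed
  qed
qed

end

section \<open>The polygon of recollements\<close>

context additive_category
begin

text \<open>Truncation provides the pairs of neighbours without an F: \<open>s = 1\<close> gives
  \<open>E^[2,N-1]\<close> and \<open>E^1\<close>, and \<open>s = N - 2\<close> gives
  \<open>E^(N-1)\<close> and \<open>E^[1,N-2]\<close>, with \<open>n = N - 1\<close>.\<close>

lemma KerPt_pair:
  assumes "1 \<le> s" "s < n"
  shows "stable_t_structure (K (mor_sm C n)) (KerPt n {1..s}) (KerPt n {s + 1..n})"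
proof -
  obtain O' where "is_zero_ob C O'" using zero_ob_ex by blast
  then interpret t: truncation C n s O' by unfold_locales (use assms in auto)
  interpret M: coreflection "mor_sm C n" t.tO t.tM t.tu by (rule t.coreflection)
  show ?thesis using M.coreflection_stable(1) t.Kernel_eq t.Image_eq by simp
qed

lemma collapse_block:
  assumes "1 \<le> s" "c \<in> {s..t}" "t \<le> n"
  shows "collapse C n (\<lambda>i. if i \<in> {s..t} then c else i)"
    and "(\<lambda>i. if i \<in> {s..t} then c else i) ` {1..n} = insert c ({1..n} - {s..t})"
proof -
  show "collapse C n (\<lambda>i. if i \<in> {s..t} then c else i)"
    by unfold_locales (use assms in auto)
  show "(\<lambda>i. if i \<in> {s..t} then c else i) ` {1..n} = insert c ({1..n} - {s..t})"
    using assms by (force simp: image_iff)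
qed

text \<open>Collapsing the block to its first entry retains \<open>s\<close> and gives the right
  partner of the F class.\<close>

lemma F_int_KerPt_pair:
  assumes st: "1 \<le> s" "s \<le> t" "t \<le> N - 1"
  shows "stable_t_structure (K (mor_sm C (N - 1))) (F_int C N s t) (KerPt (N - 1) (insert s ({1..N - 1} - {s..t})))"
    and "triangulated_subcat (K (mor_sm C (N - 1))) (F_int C N s t)"
    and "triangulated_subcat (K (mor_sm C (N - 1))) (KerPt (N - 1) (insert s ({1..N - 1} - {s..t})))"
proof -
  have c: "s \<in> {s..t}" using st by simp
  interpret c: collapse C "N - 1" "\<lambda>i. if i \<in> {s..t} then s else i"
    by (rule collapse_block(1)[OF st(1) c st(3)])
  interpret M: coreflection "mor_sm C (N - 1)" c.colO c.colM
    "\<lambda>X. \<lambda>i\<in>{1..N - 1}. path C X (if i \<in> {s..t} then s else i) i"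
    by (rule c.coreflection) auto
  have "M.Image = F_int C N s t"
    by (rule c.Image_eq[OF st(1) c st(3)]) auto
  then show "stable_t_structure (K (mor_sm C (N - 1))) (F_int C N s t) (KerPt (N - 1) (insert s ({1..N - 1} - {s..t})))"
    "triangulated_subcat (K (mor_sm C (N - 1))) (F_int C N s t)"
    "triangulated_subcat (K (mor_sm C (N - 1))) (KerPt (N - 1) (insert s ({1..N - 1} - {s..t})))"
    using M.coreflection_stable unfolding c.Kernel_eq collapse_block(2)[OF st(1) c st(3)] by simp_all
qed

text \<open>Collapsing the same block to its last entry has the same image but retains
  \<open>t\<close>; this gives the left partner.\<close>

lemma KerPt_F_int_pair:
  assumes st: "1 \<le> s" "s \<le> t" "t \<le> N - 1"
  shows "stable_t_structure (K (mor_sm C (N - 1))) (KerPt (N - 1) (insert t ({1..N - 1} - {s..t}))) (F_int C N s t)"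
    and "triangulated_subcat (K (mor_sm C (N - 1))) (KerPt (N - 1) (insert t ({1..N - 1} - {s..t})))"
proof -
  have c: "t \<in> {s..t}" using st by simp
  interpret c: collapse C "N - 1" "\<lambda>i. if i \<in> {s..t} then t else i"
    by (rule collapse_block(1)[OF st(1) c st(3)])
  interpret M: reflection "mor_sm C (N - 1)" c.colO c.colM
    "\<lambda>X. \<lambda>i\<in>{1..N - 1}. path C X i (if i \<in> {s..t} then t else i)"
    by (rule c.reflection) auto
  have "M.Image = F_int C N s t"
    by (rule c.Image_eq[OF st(1) c st(3)]) auto
  then show "stable_t_structure (K (mor_sm C (N - 1))) (KerPt (N - 1) (insert t ({1..N - 1} - {s..t}))) (F_int C N s t)"
    "triangulated_subcat (K (mor_sm C (N - 1))) (KerPt (N - 1) (insert t ({1..N - 1} - {s..t})))"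
    using M.reflection_stable unfolding c.Kernel_eq collapse_block(2)[OF st(1) c st(3)] by simp_all
qed

text \<open>All three cases of the definition require contractibility at every position other than
  \<open>s\<close>; the boundary cases only avoid an empty interval.\<close>

lemma E_at_eq:
  assumes "N \<ge> 3" "1 \<le> s" "s \<le> N - 1"
  shows "E_at C N s = KerPt (N - 1) ({1..N - 1} - {s})"
proof -
  consider "s = 1" | "s = N - 1" "s \<noteq> 1" | "1 < s" "s < N - 1" using assms by linarith
  then show ?thesis
  proof cases
    case 1
    then have "{1..N - 1} - {s} = {2..N - 1}" by auto
    then show ?thesis using 1 assms Ker_D_eq[of 2 "N - 1" N] by (simp add: E_at_def)
  next
    case 2
    then have "{1..N - 1} - {s} = {1..N - 2}" by auto
    then show ?thesis using 2 assms Ker_D_eq[of 1 "N - 2" N] by (simp add: E_at_def)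
  next
    case 3
    then have "{1..N - 1} - {s} = {1..s - 1} \<union> {s + 1..N - 1}" by auto
    then show ?thesis using 3 assms Ker_D_eq[of 1 "s - 1" N] Ker_D_eq[of "s + 1" "N - 1" N]
      by (auto simp: E_at_def KerPt_def)
  qed
qed

text \<open>Position arithmetic for the repeated pattern. The length is carried along in the same
  induction because locating the appended pair needs it.\<close>

lemma nth_concat_pairs:
  "i < 2 * n \<Longrightarrow> concat (map (\<lambda>s. [f s, g s]) [1..<n + 1]) ! i = (if even i then f (i div 2 + 1) else g (i div 2 + 1))"
  "length (concat (map (\<lambda>s. [f s, g s]) [1..<n + 1])) = 2 * n"
proof (induction n)
  case (Suc n)
  let ?l = "concat (map (\<lambda>s. [f s, g s]) [1..<n + 1])"
  have e: "concat (map (\<lambda>s. [f s, g s]) [1..<Suc n + 1]) = ?l @ [f (n + 1), g (n + 1)]" by simp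
  { case 1
    show ?case
    proof (cases "i < 2 * n")
      case True
      then show ?thesis unfolding e nth_append Suc.IH(2) using Suc.IH(1) by simp
    next
      case False
      then have "i = 2 * n \<or> i = 2 * n + 1" using 1 by auto
      then show ?thesis unfolding e nth_append Suc.IH(2) by auto
    qed
  }
  { case 2 show ?case unfolding e length_append Suc.IH(2) by simp }
qed simp_all

end

theorem theorem0p6:
  fixes B :: "('o, 'm, 'z) preadd_scheme" and N :: nat
  assumes "additive_category B" and "N \<ge> 3"
  shows "polygon_of_recollements (K (mor_sm B (N - 1))) (2 * N)
    ([F_int B N 1 (N - 1), E_from_2 B N]
      @ concat (map (\<lambda>s. [E_at B N s, F_int B N s (s + 1)]) [1..<N - 1])
      @ [E_at B N (N - 1), E_upto_N2 B N])"
proof -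
  interpret additive_category B by fact
  let ?K = "K (mor_sm B (N - 1))"
  define P where "P S = KerPt (N - 1) S" for S
  define L where "L = concat (map (\<lambda>s. [E_at B N s, F_int B N s (s + 1)]) [1..<N - 1])"
  define Us where "Us = [F_int B N 1 (N - 1), E_from_2 B N] @ L @ [E_at B N (N - 1), E_upto_N2 B N]"
  have E: "E_at B N s = P ({1..N - 1} - {s})" if "1 \<le> s" "s \<le> N - 1" for s
    using E_at_eq[OF assms(2) that] by (simp add: P_def)
  have E1: "E_from_2 B N = P {1}" and EN: "E_upto_N2 B N = P {N - 1}"
    using Ker_D_eq[of 1 1 N] Ker_D_eq[of "N - 1" "N - 1" N] assms(2) by (simp_all add: E_from_2_def E_upto_N2_def P_def)
  have L: "length L = 2 * (N - 2)" "i < 2 * (N - 2) \<Longrightarrow>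
      L ! i = (if even i then E_at B N (i div 2 + 1) else F_int B N (i div 2 + 1) (i div 2 + 2))" for i
    using nth_concat_pairs(2)[of "E_at B N" "\<lambda>s. F_int B N s (s + 1)" "N - 2"]
      nth_concat_pairs(1)[of i "N - 2" "E_at B N" "\<lambda>s. F_int B N s (s + 1)"] assms(2)
    by (simp_all add: L_def Suc_diff_le numeral_2_eq_2 Suc_diff_Suc)
  have len: "length Us = 2 * N" using L(1) assms(2) by (simp add: Us_def)
  have U0: "Us ! 0 = F_int B N 1 (N - 1)" and U1: "Us ! 1 = P {1}"
    by (simp_all add: Us_def E1)
  have Us_drop: "Us ! (j + 2) = (L @ [E_at B N (N - 1), E_upto_N2 B N]) ! j" for j
    by (simp add: Us_def)
  have U_even: "Us ! (2 * k) = P ({1..N - 1} - {k})" if "1 \<le> k" "k \<le> N - 1" for k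
  proof -
    have k: "2 * k = 2 * (k - 1) + 2" using that by simp
    show ?thesis
    proof (cases "k = N - 1")
      case True
      then have "2 * (k - 1) = length L" using L(1) by simp
      then show ?thesis unfolding k Us_drop using E[OF that] True by simp
    next
      case False
      then have "2 * (k - 1) < 2 * (N - 2)" using that by auto
      then show ?thesis unfolding k Us_drop nth_append L(1) using L(2)[of "2 * (k - 1)"] E[OF that] that by simp
    qed
  qed
  have U_odd: "Us ! (2 * k + 1) = F_int B N k (k + 1)" if "1 \<le> k" "k \<le> N - 2" for k
  proof -
    have k: "2 * k + 1 = (2 * (k - 1) + 1) + 2" and lt: "2 * (k - 1) + 1 < 2 * (N - 2)" using that by auto
    show ?thesis unfolding k Us_drop nth_append L(1) using lt L(2)[OF lt] that by simp
  qed
  have U_last: "Us ! (2 * N - 1) = P {N - 1}"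
  proof -
    have l: "2 * N - 1 = (length L + 1) + 2" using L(1) assms(2) by simp
    show ?thesis unfolding l Us_drop by (simp add: nth_append EN)
  qed
  \<comment> \<open>Positions tested by the kernels of the collapses: for the full block only the
    retained end, for two adjacent positions everything except the other end.\<close>
  have full: "insert s ({1..N - 1} - {1..N - 1}) = {s}" for s by auto
  have drop: "insert s ({1..N - 1} - {s..s + 1}) = {1..N - 1} - {s + 1}"
      "insert (s + 1) ({1..N - 1} - {s..s + 1}) = {1..N - 1} - {s}" if "1 \<le> s" "s \<le> N - 2" for s
    using that assms(2) by auto
  note all = F_int_KerPt_pair[of 1 "N - 1" N, unfolded full, folded P_def]
    and all' = KerPt_F_int_pair[of 1 "N - 1" N, unfolded full, folded P_def]
  have FE: "stable_t_structure ?K (F_int B N s (s + 1)) (P ({1..N - 1} - {s + 1}))"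
      "triangulated_subcat ?K (F_int B N s (s + 1))" "triangulated_subcat ?K (P ({1..N - 1} - {s + 1}))"
      "stable_t_structure ?K (P ({1..N - 1} - {s})) (F_int B N s (s + 1))"
      "triangulated_subcat ?K (P ({1..N - 1} - {s}))" if "1 \<le> s" "s \<le> N - 2" for s
    using F_int_KerPt_pair[of s "s + 1" N] KerPt_F_int_pair[of s "s + 1" N] that assms(2)
    unfolding drop[OF that] P_def by auto
  \<comment> \<open>At \<open>k = N - 1\<close> no block of two positions starts, so this class is
    obtained as right partner of the block that ends there.\<close>
  have tri_E: "triangulated_subcat ?K (P ({1..N - 1} - {k}))" if "1 \<le> k" "k \<le> N - 1" for k
  proof (cases "k = N - 1")
    case True
    then have "1 \<le> k - 1" "k - 1 \<le> N - 2" "k - 1 + 1 = k" using that assms(2) by auto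
    then show ?thesis using FE(3)[of "k - 1"] by metis
  next
    case False
    then show ?thesis using FE(5)[of k] that by linarith
  qed
  \<comment> \<open>Positions 0, 1 and 2N - 1 hold the entries outside the pattern. Even positions
    from 2 on hold the \<open>E_at\<close>, the odd ones from 3 to 2N - 3 the two-element
    \<open>F_int\<close>.\<close>
  have index: "i = 0 \<or> i = 1 \<or> i = 2 * N - 1 \<or> (\<exists>k. 1 \<le> k \<and> k \<le> N - 1 \<and> i = 2 * k) \<or>
      (\<exists>k. 1 \<le> k \<and> k \<le> N - 2 \<and> i = 2 * k + 1)" if "i < 2 * N" for i
    using that by presburger
  have "triangulated_subcat ?K (Us ! i) \<and> stable_t_structure ?K (Us ! i) (Us ! ((i + 1) mod (2 * N)))" if i: "i < 2 * N" for i
    using index[OF i]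
  proof (elim disjE exE conjE)
    assume "i = 0"
    then show ?thesis using all assms(2) U0 U1 by simp
  next
    assume 1: "i = 1"
    have "{1..N - 1} - {1} = {1 + 1..N - 1}" by auto
    then show ?thesis
      using 1 all(3) assms(2) U1 U_even[of 1] KerPt_pair[of 1 "N - 1"] by (simp add: P_def numeral_2_eq_2)
  next
    \<comment> \<open>The polygon closes here: the index wraps around to 0, and
      \<open>F^[1,N-1]\<close> is reached through the collapse of the full block onto its last
      position.\<close>
    assume i: "i = 2 * N - 1"
    then have "(i + 1) mod (2 * N) = 0" using assms(2) by simp
    then show ?thesis using i all' assms(2) U_last U0 by simp
  next
    fix k assume k: "1 \<le> k" "k \<le> N - 1" "i = 2 * k"
    show ?thesis
    proof (cases "k = N - 1")
      case True
      \<comment> \<open>The second gap without an F, filled by truncation after position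
        \<open>N - 2\<close>.\<close>
      have "{1..N - 1} - {N - 1} = {1..N - 2}" "{N - 2 + 1..N - 1} = {N - 1}" using assms(2) by auto
      moreover have "(i + 1) mod (2 * N) = 2 * N - 1" using k True assms(2) by simp
      ultimately show ?thesis
        using k True tri_E[OF k(1,2)] U_even[OF k(1,2)] U_last KerPt_pair[of "N - 2" "N - 1"] assms(2)
        by (simp add: P_def)
    next
      case False
      then show ?thesis
        using k tri_E[OF k(1,2)] U_even[OF k(1,2)] U_odd[of k] FE(4)[of k] by simp
    qed
  next
    fix k assume k: "1 \<le> k" "k \<le> N - 2" "i = 2 * k + 1"
    then have "(i + 1) mod (2 * N) = 2 * (k + 1)" using assms(2) by simp
    then show ?thesis
      using k U_odd[OF k(1,2)] U_even[of "k + 1"] FE(1,2)[OF k(1,2)] assms(2) by simp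
  qed
  then have "polygon_of_recollements ?K (2 * N) Us"
    unfolding polygon_of_recollements_def using len by (metis in_set_conv_nth)
  then show ?thesis by (simp add: Us_def L_def)
qed

end
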